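(* Let $a\in(0,1]$ and let $\theta\in C^1((0,\infty))$ satisfy $\sup_{r\in(0,\infty)} |r\,\theta'(r)|<\infty$, and suppose that $\operatorname{supp}\theta'$ is compact in $\mathbb{R}$ (i.e. there is $R>0$ with $\theta'(r)=0$ for all $r\ge R$). Let $\Omega$ be the curved wedge defined by $\theta$ and $a$. Then $$\Gamma_{\theta,a}=\frac12+\frac1{4a}.$$
   Context: For $\theta:(0,\infty)\to\mathbb{R}$ and $a\in(0,1]$, the curved wedge is $\Omega:=\{(r\cos[\varphi+\theta(r)],\,r\sin[\varphi+\theta(r)]) : r\in(0,\infty),\ \varphi\in(0,2\pi a)\}\subset\mathbb{R}^2$. $-\Delta_D^\Omega$ denotes the Dirichlet Laplacian in $L^2(\Omega)$, i.e. the self-adjoint operator associated with the form $u\mapsto\|\nabla u\|_{L^2(\Omega)}^2$ on $H_0^1(\Omega)$. Let $w(x):=e^{|x|^2/4}$ and $L^2_w(\Omega):=L^2(\Omega,w(x)\,dx)\subset L^2(\Omega)$. The decay rate is $$\Gamma_{\theta,a}:=\sup\Big\{\gamma\ :\ \exists C_\gamma>0\ \forall t\ge0,\ \big\|e^{t\Delta_D^\Omega}\big\|_{L^2_w(\Omega)\to L^2(\Omega)}\le C_\gamma(1+t)^{-\gamma}\Big\}.$$ *)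

theory Defs
  imports "HOL-Analysis.Analysis"
begin

definition curved_wedge :: "(real \<Rightarrow> real) \<Rightarrow> real \<Rightarrow> (real \<times> real) set" where
  "curved_wedge \<theta> a =
     {(r * cos (\<phi> + \<theta> r), r * sin (\<phi> + \<theta> r)) | r \<phi>. 0 < r \<and> 0 < \<phi> \<and> \<phi> < 2 * pi * a}"

definition L2 :: "(real \<times> real) set \<Rightarrow> ((real \<times> real) \<Rightarrow> real) set" where
  "L2 \<Omega> = {u. u \<in> borel_measurable lborel \<and> set_integrable lborel \<Omega> (\<lambda>x. (u x)\<^sup>2)}"

definition L2_norm :: "(real \<times> real) set \<Rightarrow> ((real \<times> real) \<Rightarrow> real) \<Rightarrow> real" where
  "L2_norm \<Omega> u = sqrt (LINT x:\<Omega>|lborel. (u x)\<^sup>2)"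

definition gauss_weight :: "real \<times> real \<Rightarrow> real" where
  "gauss_weight x = exp ((norm x)\<^sup>2 / 4)"

definition L2w :: "(real \<times> real) set \<Rightarrow> ((real \<times> real) \<Rightarrow> real) set" where
  "L2w \<Omega> = {u. u \<in> borel_measurable lborel \<and> set_integrable lborel \<Omega> (\<lambda>x. gauss_weight x * (u x)\<^sup>2)}"

definition L2w_norm :: "(real \<times> real) set \<Rightarrow> ((real \<times> real) \<Rightarrow> real) \<Rightarrow> real" where
  "L2w_norm \<Omega> u = sqrt (LINT x:\<Omega>|lborel. gauss_weight x * (u x)\<^sup>2)"

definition Cc1 :: "(real \<times> real) set \<Rightarrow> ((real \<times> real) \<Rightarrow> real) \<Rightarrow>
     ((real \<times> real) \<Rightarrow> real) \<Rightarrow> ((real \<times> real) \<Rightarrow> real) \<Rightarrow> bool" where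
  "Cc1 \<Omega> \<phi> d1 d2 \<longleftrightarrow>
     (\<forall>x. (\<phi> has_derivative (\<lambda>h. d1 x * fst h + d2 x * snd h)) (at x)) \<and>
     continuous_on UNIV d1 \<and> continuous_on UNIV d2 \<and>
     (\<exists>K. compact K \<and> K \<subseteq> \<Omega> \<and> (\<forall>x. x \<notin> K \<longrightarrow> \<phi> x = 0))"

definition H01_grad :: "(real \<times> real) set \<Rightarrow> ((real \<times> real) \<Rightarrow> real) \<Rightarrow>
     ((real \<times> real) \<Rightarrow> real) \<Rightarrow> ((real \<times> real) \<Rightarrow> real) \<Rightarrow> bool" where
  "H01_grad \<Omega> u g1 g2 \<longleftrightarrow>
     u \<in> L2 \<Omega> \<and> g1 \<in> L2 \<Omega> \<and> g2 \<in> L2 \<Omega> \<and>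
     (\<exists>\<phi> d1 d2. (\<forall>n. Cc1 \<Omega> (\<phi> n) (d1 n) (d2 n)) \<and>
        (\<lambda>n. L2_norm \<Omega> (\<lambda>x. \<phi> n x - u x)) \<longlonglongrightarrow> 0 \<and>
        (\<lambda>n. L2_norm \<Omega> (\<lambda>x. d1 n x - g1 x)) \<longlonglongrightarrow> 0 \<and>
        (\<lambda>n. L2_norm \<Omega> (\<lambda>x. d2 n x - g2 x)) \<longlonglongrightarrow> 0)"

text \<open>The Dirichlet Laplacian -Delta_D: the self-adjoint operator associated with the form
  u \<mapsto> ||grad u||^2 on H^1_0(Omega). dirichlet_op Omega u f means u \<in> dom and (-Delta_D) u = f.\<close>
definition dirichlet_op :: "(real \<times> real) set \<Rightarrow> ((real \<times> real) \<Rightarrow> real) \<Rightarrow>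
     ((real \<times> real) \<Rightarrow> real) \<Rightarrow> bool" where
  "dirichlet_op \<Omega> u f \<longleftrightarrow>
     (\<exists>g1 g2. H01_grad \<Omega> u g1 g2 \<and> f \<in> L2 \<Omega> \<and>
        (\<forall>v h1 h2. H01_grad \<Omega> v h1 h2 \<longrightarrow>
           (LINT x:\<Omega>|lborel. g1 x * h1 x + g2 x * h2 x) = (LINT x:\<Omega>|lborel. f x * v x)))"

text \<open>u t = e^{t Delta_D} u0: the (unique) strong solution of u' = Delta_D u, u(0) = u0 in L^2(Omega).\<close>
definition heat_sol :: "(real \<times> real) set \<Rightarrow> ((real \<times> real) \<Rightarrow> real) \<Rightarrow>
     (real \<Rightarrow> (real \<times> real) \<Rightarrow> real) \<Rightarrow> bool" where
  "heat_sol \<Omega> u0 u \<longleftrightarrow>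
     u0 \<in> L2 \<Omega> \<and>
     (\<forall>t\<ge>0. u t \<in> L2 \<Omega>) \<and>
     L2_norm \<Omega> (\<lambda>x. u 0 x - u0 x) = 0 \<and>
     (\<forall>t\<ge>0. ((\<lambda>s. L2_norm \<Omega> (\<lambda>x. u s x - u t x)) \<longlongrightarrow> 0) (at t within {0..})) \<and>
     (\<forall>t>0. \<exists>f. dirichlet_op \<Omega> (u t) f \<and>
        ((\<lambda>s. L2_norm \<Omega> (\<lambda>x. (u s x - u t x) / (s - t) + f x)) \<longlongrightarrow> 0) (at t))"

definition decay_bound :: "(real \<Rightarrow> real) \<Rightarrow> real \<Rightarrow> real \<Rightarrow> bool" where
  "decay_bound \<theta> a \<gamma> \<longleftrightarrow>
     (\<exists>C>0. \<forall>u0 u t. u0 \<in> L2w (curved_wedge \<theta> a) \<and> heat_sol (curved_wedge \<theta> a) u0 u \<and> 0 \<le> t \<longrightarrow>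
        L2_norm (curved_wedge \<theta> a) (u t) \<le> C * (1 + t) powr (- \<gamma>) * L2w_norm (curved_wedge \<theta> a) u0)"

definition decay_rate :: "(real \<Rightarrow> real) \<Rightarrow> real \<Rightarrow> real" where
  "decay_rate \<theta> a = Sup {\<gamma>. decay_bound \<theta> a \<gamma>}"

end

theory Submission
  imports Defs "HOL-Probability.Distributions"
begin

text \<open>Put \<open>\<nu> = 1/(2a)\<close>, so that \<open>\<nu>\<^sup>2\<close> is the lowest Dirichlet eigenvalue on an arc of angle \<open>2\<pi>a\<close>.

  \<^bold>\<open>Lower bound.\<close> Along a solution \<open>u\<close>, the functional \<open>(1+t)\<^bsup>2\<gamma>\<^esup> \<integral> e\<^bsup>|x|\<^sup>2/(4(1+t))\<^esup> u\<^sup>2\<close> is nonincreasing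
  if \<open>\<integral> e\<^bsup>|x|\<^sup>2/(4\<tau>)\<^esup> (\<gamma>/\<tau> - |x|\<^sup>2/(8\<tau>\<^sup>2)) u\<^sup>2 \<le> \<integral> \<nabla>u \<cdot> \<nabla>(e\<^bsup>|x|\<^sup>2/(4\<tau>)\<^esup> u)\<close> with \<open>\<tau> = 1+t\<close>. For \<open>\<gamma> \<le> (\<nu>+1)/2\<close> this
  follows by completing a square with a radial field that comes from the harmonic oscillator with angular
  momentum \<open>\<nu>\<close> and an angular field proportional to \<open>cot (\<nu>\<phi>)\<close>. The latter is tangent to circles, so
  the twist \<open>\<theta>\<close> does not change its divergence, and \<open>\<theta>\<close> plays no role. A bounded substitute for
  \<open>|x|\<^sup>2\<close> in the weight makes the functional differentiable, at the cost of an arbitrarily small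
  loss in \<open>\<gamma>\<close>.

  \<^bold>\<open>Upper bound.\<close> Where the wedge is straight, \<open>H = (2T-t)\<^bsup>-(1+\<nu>)\<^esup> r\<^sup>\<nu> e\<^bsup>-r\<^sup>2/(4(2T-t))\<^esup> sin (\<nu>\<phi>)\<close> solves the
  backward heat equation. For convex \<open>\<psi>\<close> vanishing on the negative half-line and a large constant \<open>c\<close>,
  \<open>\<psi> ((2T)\<^bsup>1+\<nu>\<^esup> H - c)\<close> vanishes near the curved part and is a subsolution, so its pairing with a
  positive solution \<open>u\<close> is nondecreasing. It is bounded from below at \<open>t = 0\<close>, uniformly in \<open>T\<close>, and at
  \<open>t = T\<close> it is at most a constant times \<open>T\<^bsup>(1+\<nu>)/2\<^esup> \<parallel>u(T)\<parallel>\<close>.\<close>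

section \<open>Semigroups of closed forms\<close>

text \<open>\<open>decay_bound\<close> quantifies over all strong solutions, so proving it is an a
  priori estimate, but refuting it requires a solution that provably exists, is nonnegative and is
  differentiable in time. This is why a semigroup is built from scratch. Instead of spectral
  calculus, the initial datum is taken in the domain of the cube of the operator, where implicit
  Euler steps converge with explicit rates; positivity is inherited from the resolvent.

  Both halves meet at the same threshold because r^\<nu> e^(-r^2/(4\<sigma>)) sin(\<nu>\<phi>) is at
  once the ground state behind the completed square and the spatial profile of H. The time 2T keeps
  the width 2T - t between T and 2T on [0, T], so the ratio of (2T)^(1+\<nu>) to (2T - t)^(1+\<nu>)
  is bounded; the norm at t = T is then O(T^((1+\<nu>)/2)), with T^(\<nu>/2) from r^\<nu> and
  T^(1/2) from the area. A small loss in \<gamma> is harmless since the rate is a supremum.\<close>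

lemma orthogonal_projection_exists:
  fixes S :: "'a::{real_inner,complete_space} set" and x :: 'a
  assumes "closed S" "subspace S"
  shows "\<exists>y\<in>S. \<forall>v\<in>S. inner (x - y) v = 0"
proof -
  have ne: "S \<noteq> {}" using assms(2) subspace_0 by blast
  define d where "d = infdist x S"
  have d0: "d \<ge> 0" by (simp add: d_def infdist_nonneg)
  have d_le: "d \<le> norm (x - z)" if "z \<in> S" for z
    using infdist_le[OF that, of x] by (simp add: d_def dist_norm)
  have "\<exists>y\<in>S. (norm (x - y))\<^sup>2 < d\<^sup>2 + 1 / real (Suc n)" for n
  proof -
    have "sqrt (d\<^sup>2 + 1 / real (Suc n)) > d"
      using d0 by (intro real_less_rsqrt) auto
    then obtain y where "y \<in> S" "dist x y < sqrt (d\<^sup>2 + 1 / real (Suc n))"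
      using cInf_lessD[of "dist x ` S" "sqrt (d\<^sup>2 + 1 / real (Suc n))"] ne
      by (auto simp: d_def infdist_notempty)
    then have "(norm (x - y))\<^sup>2 < (sqrt (d\<^sup>2 + 1 / real (Suc n)))\<^sup>2"
      by (intro power_strict_mono) (auto simp: dist_norm)
    then show ?thesis using \<open>y \<in> S\<close> by (auto simp: add_nonneg_nonneg)
  qed
  then obtain y where yS: "\<And>n. y n \<in> S" and y: "\<And>n. (norm (x - y n))\<^sup>2 < d\<^sup>2 + 1 / real (Suc n)"
    by metis
  \<comment> \<open>Parallelogram law, with the midpoint again in S: the slack 1/(n+1) in the
    squared distance shows that a minimizing sequence is Cauchy.\<close>
  have par: "(norm (y n - y m))\<^sup>2 \<le> 2 / real (Suc n) + 2 / real (Suc m)" for n m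
  proof -
    have "(1/2) *\<^sub>R (y n + y m) \<in> S"
      using assms(2) yS by (simp add: subspace_add subspace_scale)
    then have "d\<^sup>2 \<le> (norm (x - (1/2) *\<^sub>R (y n + y m)))\<^sup>2"
      using d_le d0 by (intro power_mono) auto
    moreover have "(norm (y n - y m))\<^sup>2 = 2 * (norm (x - y n))\<^sup>2 + 2 * (norm (x - y m))\<^sup>2
        - 4 * (norm (x - (1/2) *\<^sub>R (y n + y m)))\<^sup>2"
      by (simp add: power2_norm_eq_inner inner_diff_left inner_diff_right inner_add_left inner_add_right
          inner_commute algebra_simps)
    ultimately show ?thesis using y[of n] y[of m] by simp
  qed
  have "Cauchy y"
  proof (rule metric_CauchyI)
    fix e :: real assume e: "e > 0"
    obtain N where "4 / e\<^sup>2 < real N" using reals_Archimedean2 by blast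
    then have N: "4 / e\<^sup>2 < real (Suc N)" by simp
    have "dist (y m) (y n) < e" if "m \<ge> N" "n \<ge> N" for m n
    proof -
      have "2 / real (Suc m) \<le> 2 / real (Suc N)" "2 / real (Suc n) \<le> 2 / real (Suc N)"
        using that by (auto intro!: divide_left_mono)
      moreover have "4 / real (Suc N) < e\<^sup>2" using N e by (simp add: field_simps)
      ultimately have "(norm (y m - y n))\<^sup>2 < e\<^sup>2" using par[of m n] by simp
      then show ?thesis using e by (simp add: dist_norm power_less_imp_less_base)
    qed
    then show "\<exists>M. \<forall>m\<ge>M. \<forall>n\<ge>M. dist (y m) (y n) < e" by blast
  qed
  then obtain l where l: "y \<longlonglongrightarrow> l" using Cauchy_convergent convergent_def by blast
  have lS: "l \<in> S" using assms(1) yS l closed_sequentially by blast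
  have "(norm (x - l))\<^sup>2 \<le> d\<^sup>2"
  proof (rule LIMSEQ_le)
    show "(\<lambda>n. (norm (x - y n))\<^sup>2) \<longlonglongrightarrow> (norm (x - l))\<^sup>2" by (intro tendsto_intros l)
    show "(\<lambda>n. d\<^sup>2 + 1 / real (Suc n)) \<longlonglongrightarrow> d\<^sup>2"
      using tendsto_add[OF tendsto_const LIMSEQ_inverse_real_of_nat, of "d\<^sup>2"] by (simp add: inverse_eq_divide)
    show "\<exists>N. \<forall>n\<ge>N. (norm (x - y n))\<^sup>2 \<le> d\<^sup>2 + 1 / real (Suc n)" using y less_imp_le by blast
  qed
  then have min: "(norm (x - l))\<^sup>2 \<le> (norm (x - z))\<^sup>2" if "z \<in> S" for z
    using power_mono[OF d_le[OF that] d0, of 2] by (rule order_trans)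
  have "inner (x - l) v = 0" if v: "v \<in> S" for v
  proof (cases "v = 0")
    case False
    \<comment> \<open>The minimizer of the quadratic polynomial in t; minimality of l then forces
      the linear coefficient to vanish.\<close>
    define t where "t = inner (x - l) v / inner v v"
    have "l + t *\<^sub>R v \<in> S" using lS v assms(2) by (simp add: subspace_add subspace_scale)
    from min[OF this] have "(norm (x - l))\<^sup>2 \<le> (norm ((x - l) - t *\<^sub>R v))\<^sup>2"
      by (simp add: diff_diff_eq)
    moreover have "(norm (z - t *\<^sub>R v))\<^sup>2 = (norm z)\<^sup>2 - 2 * t * inner z v + t\<^sup>2 * inner v v" for z
      unfolding power2_norm_eq_inner inner_diff_left inner_diff_right
      by (simp add: inner_commute power2_eq_square)
    ultimately have "0 \<le> - 2 * t * inner (x - l) v + t\<^sup>2 * inner v v"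
      by simp
    also have "\<dots> = - (inner (x - l) v)\<^sup>2 / inner v v"
      using False by (simp add: t_def power2_eq_square field_simps)
    finally have "(inner (x - l) v)\<^sup>2 / inner v v \<le> 0" by simp
    moreover have "inner v v > 0" using False by simp
    ultimately show ?thesis by (simp add: divide_le_0_iff)
  qed simp
  with lS show ?thesis by blast
qed

text \<open>A closed symmetric form is given by the graph \<open>V\<close> of its gradient.\<close>

locale closed_form =
  fixes V :: "('a::{real_inner,complete_space} \<times> 'b::{real_inner,complete_space}) set"
  assumes closed_V: "closed V" and subspace_V: "subspace V"
begin

text \<open>The operator A of the form, written weakly and as a relation: nothing in the locale
  makes the form domain dense, so \<open>f\<close> is determined by \<open>u\<close> only up to the
  orthogonal complement of that domain. For \<open>grad_graph\<close> this freedom is the part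
  outside \<Omega>.\<close>

definition form_op :: "'a \<Rightarrow> 'a \<Rightarrow> bool" where
  "form_op u f \<longleftrightarrow> (\<exists>g. (u, g) \<in> V \<and> (\<forall>v k. (v, k) \<in> V \<longrightarrow> inner g k = inner f v))"

lemma V_add: "(u, g) \<in> V \<Longrightarrow> (v, k) \<in> V \<Longrightarrow> (u + v, g + k) \<in> V"
  using subspace_add[OF subspace_V] by fastforce

lemma V_scale: "(u, g) \<in> V \<Longrightarrow> (c *\<^sub>R u, c *\<^sub>R g) \<in> V"
  using subspace_scale[OF subspace_V] by fastforce

lemma form_op_add: "form_op u f \<Longrightarrow> form_op v k \<Longrightarrow> form_op (u + v) (f + k)"
  unfolding form_op_def using V_add by (metis inner_add_left)

lemma form_op_scale: "form_op u f \<Longrightarrow> form_op (c *\<^sub>R u) (c *\<^sub>R f)"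
  unfolding form_op_def using V_scale by (metis inner_scaleR_left)

lemma form_op_diff: "form_op u f \<Longrightarrow> form_op v k \<Longrightarrow> form_op (u - v) (f - k)"
  using form_op_add[of u f "-v" "-k"] form_op_scale[of v k "-1"] by simp

lemma form_op_nonneg: "form_op u f \<Longrightarrow> 0 \<le> inner f u"
  unfolding form_op_def by (metis inner_ge_zero)

lemma form_op_symmetric: "form_op u f \<Longrightarrow> form_op v k \<Longrightarrow> inner f v = inner k u"
  unfolding form_op_def by (metis inner_commute)

text \<open>Inserting differences into their own weak equation gives |g_n - g_m|^2 = <f_n - f_m, u_n
  - u_m>, so the gradients converge as well and closedness of \<open>V\<close> applies.\<close>

lemma form_op_closed:
  assumes op: "\<And>n::nat. form_op (u n) (f n)" and u: "u \<longlonglongrightarrow> u'" and f: "f \<longlonglongrightarrow> f'"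
  shows "form_op u' f'"
proof -
  obtain g where gV: "\<And>n. (u n, g n) \<in> V"
    and g: "\<And>n v k. (v, k) \<in> V \<Longrightarrow> inner (g n) k = inner (f n) v"
    using op unfolding form_op_def by metis
  have diff: "(u n - u m, g n - g m) \<in> V" for n m
    using V_add[OF gV[of n] V_scale[OF gV[of m], of "-1"]] by simp
  have eq: "(norm (g n - g m))\<^sup>2 \<le> norm (f n - f m) * norm (u n - u m)" for n m
  proof -
    have "(norm (g n - g m))\<^sup>2 = inner (f n - f m) (u n - u m)"
      using g[OF diff[of n m], of n] g[OF diff[of n m], of m]
      by (simp add: power2_norm_eq_inner inner_diff_left)
    then show ?thesis using norm_cauchy_schwarz[of "f n - f m" "u n - u m"] by simp
  qed
  have "Cauchy g"
  proof (rule metric_CauchyI)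
    fix e :: real assume e: "e > 0"
    have "Cauchy u" "Cauchy f" using u f by (auto intro: LIMSEQ_imp_Cauchy)
    then obtain M N where "\<And>m n. m \<ge> M \<Longrightarrow> n \<ge> M \<Longrightarrow> norm (u m - u n) < e"
      "\<And>m n. m \<ge> N \<Longrightarrow> n \<ge> N \<Longrightarrow> norm (f m - f n) < e"
      using e unfolding Cauchy_def dist_norm by metis
    then have "dist (g m) (g n) < e" if "m \<ge> max M N" "n \<ge> max M N" for m n
    proof -
      have "norm (f m - f n) * norm (u m - u n) < e * e"
        using that \<open>\<And>m n. m \<ge> M \<Longrightarrow> n \<ge> M \<Longrightarrow> norm (u m - u n) < e\<close>
          \<open>\<And>m n. m \<ge> N \<Longrightarrow> n \<ge> N \<Longrightarrow> norm (f m - f n) < e\<close>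
        by (intro mult_strict_mono) (use e in auto)
      then have "(norm (g m - g n))\<^sup>2 < e\<^sup>2" using eq[of m n] by (simp add: power2_eq_square)
      then show ?thesis using e by (simp add: dist_norm power_less_imp_less_base)
    qed
    then show "\<exists>M. \<forall>m\<ge>M. \<forall>n\<ge>M. dist (g m) (g n) < e" by blast
  qed
  then obtain g' where g': "g \<longlonglongrightarrow> g'" using Cauchy_convergent convergent_def by blast
  have "(u', g') \<in> V"
    using closed_sequentially[OF closed_V, of "\<lambda>n. (u n, g n)"] gV tendsto_Pair[OF u g'] by blast
  moreover have "inner g' k = inner f' v" if "(v, k) \<in> V" for v k
    by (rule LIMSEQ_unique[OF tendsto_inner[OF g' tendsto_const]])
      (simp add: g[OF that] tendsto_inner[OF f tendsto_const])
  ultimately show ?thesis unfolding form_op_def by blast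
qed

section \<open>Resolvents J_h = (1 + hA)^(-1) of the form operator\<close>

lemma resolvent_exists:
  assumes h: "0 < h"
  shows "\<exists>u. form_op u ((1/h) *\<^sub>R (f - u))"
proof -
  \<comment> \<open>Minimizing |f - u|^2 + h |g|^2 over \<open>V\<close> is the orthogonal
    projection of (f, 0) onto the graph whose gradients are multiplied by sqrt h; orthogonality of
    the error is the resolvent equation.\<close>
  define s where "s = sqrt h"
  have s: "s > 0" "s * s = h" using h by (auto simp: s_def)
  define Vh where "Vh = (\<lambda>p. (fst p, (1/s) *\<^sub>R snd p)) -` V"
  have mem: "(u, g) \<in> Vh \<longleftrightarrow> (u, (1/s) *\<^sub>R g) \<in> V" for u g by (simp add: Vh_def)
  have "closed Vh" unfolding Vh_def
    by (rule continuous_closed_vimage[OF closed_V]) (intro continuous_intros)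
  moreover have "subspace Vh"
    unfolding subspace_def
  proof (intro conjI ballI allI)
    show "0 \<in> Vh" using subspace_0[OF subspace_V] by (simp add: Vh_def zero_prod_def)
    show "x + y \<in> Vh" if "x \<in> Vh" "y \<in> Vh" for x y
      using that V_add by (fastforce simp: Vh_def scaleR_add_right)
    show "c *\<^sub>R x \<in> Vh" if "x \<in> Vh" for c x
      using that V_scale[of "fst x" "(1/s) *\<^sub>R snd x" c] by (simp add: Vh_def mult.commute)
  qed
  ultimately obtain y where y: "y \<in> Vh" "\<And>v. v \<in> Vh \<Longrightarrow> inner ((f, 0) - y) v = 0"
    using orthogonal_projection_exists[of Vh "(f, 0)"] by blast
  obtain u g where ug: "y = (u, g)" by fastforce
  define g' where "g' = (1/s) *\<^sub>R g"
  have "(u, g') \<in> V" using y(1) ug mem g'_def by simp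
  moreover have "inner g' k = inner ((1/h) *\<^sub>R (f - u)) v" if "(v, k) \<in> V" for v k
  proof -
    have "(v, s *\<^sub>R k) \<in> Vh" using that s by (simp add: mem)
    from y(2)[OF this] have "inner (f - u) v = s * inner g k" by (simp add: ug inner_diff_left)
    then have "inner ((1/h) *\<^sub>R (f - u)) v = (1 / (s * s)) * (s * inner g k)"
      by (simp add: s(2))
    then show ?thesis using s(1) by (simp add: g'_def)
  qed
  ultimately show ?thesis unfolding form_op_def by blast
qed

definition resolvent :: "real \<Rightarrow> 'a \<Rightarrow> 'a" where
  "resolvent h f = (SOME u. form_op u ((1/h) *\<^sub>R (f - u)))"

lemma form_op_resolvent: "0 < h \<Longrightarrow> form_op (resolvent h f) ((1/h) *\<^sub>R (f - resolvent h f))"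
  unfolding resolvent_def by (rule someI_ex[OF resolvent_exists])

text \<open>Nonnegativity of the form applied to the difference of two solutions. With f = f' it
  gives uniqueness, from which the algebraic rules for \<open>resolvent\<close> follow.\<close>

lemma resolvent_dist_aux:
  assumes "0 < h" "form_op u ((1/h) *\<^sub>R (f - u))" "form_op u' ((1/h) *\<^sub>R (f' - u'))"
  shows "norm (u - u') \<le> norm (f - f')"
proof -
  have "form_op (u - u') ((1/h) *\<^sub>R ((f - f') - (u - u')))"
    using form_op_diff[OF assms(2,3)] by (simp add: algebra_simps)
  from form_op_nonneg[OF this] have "0 \<le> inner ((f - f') - (u - u')) (u - u')"
    using assms(1) by (simp add: zero_le_divide_iff)
  then have "(norm (u - u'))\<^sup>2 \<le> inner (f - f') (u - u')"
    by (simp add: inner_diff_left power2_norm_eq_inner)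
  also have "\<dots> \<le> norm (f - f') * norm (u - u')" by (rule norm_cauchy_schwarz)
  finally show ?thesis
    by (cases "u = u'") (auto simp: power2_eq_square)
qed

lemma resolvent_eqI: "0 < h \<Longrightarrow> form_op u ((1/h) *\<^sub>R (f - u)) \<Longrightarrow> resolvent h f = u"
  using resolvent_dist_aux[OF _ form_op_resolvent, of h u f f] by auto

lemma norm_resolvent_diff: "0 < h \<Longrightarrow> norm (resolvent h f - resolvent h k) \<le> norm (f - k)"
  using resolvent_dist_aux[OF _ form_op_resolvent form_op_resolvent] by blast

lemma resolvent_scale: "0 < h \<Longrightarrow> resolvent h (c *\<^sub>R f) = c *\<^sub>R resolvent h f"
  using form_op_scale[OF form_op_resolvent, of h c f]
  by (intro resolvent_eqI) (simp_all add: algebra_simps)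

lemma resolvent_add: "0 < h \<Longrightarrow> resolvent h (f + k) = resolvent h f + resolvent h k"
  using form_op_add[OF form_op_resolvent form_op_resolvent, of h h f k]
  by (intro resolvent_eqI) (simp_all add: algebra_simps)

lemma resolvent_diff: "0 < h \<Longrightarrow> resolvent h (f - k) = resolvent h f - resolvent h k"
  using resolvent_add[of h "f - k" k] by simp

lemma resolvent_0: "0 < h \<Longrightarrow> resolvent h 0 = 0"
  using resolvent_scale[of h 0 0] by simp

lemma norm_resolvent: "0 < h \<Longrightarrow> norm (resolvent h f) \<le> norm f"
  using norm_resolvent_diff[of h f 0] by (simp add: resolvent_0)

lemma resolvent_identity:
  assumes "0 < h" "0 < k"
  shows "resolvent k ((k/h) *\<^sub>R f + (1 - k/h) *\<^sub>R resolvent h f) = resolvent h f"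
proof (rule resolvent_eqI[OF assms(2)])
  have "(k/h) *\<^sub>R f + (1 - k/h) *\<^sub>R resolvent h f - resolvent h f = (k/h) *\<^sub>R (f - resolvent h f)"
    by (simp add: scaleR_diff_left scaleR_diff_right)
  then have "(1/k) *\<^sub>R ((k/h) *\<^sub>R f + (1 - k/h) *\<^sub>R resolvent h f - resolvent h f)
      = (1/h) *\<^sub>R (f - resolvent h f)"
    using assms(2) by simp
  then show "form_op (resolvent h f) ((1/k) *\<^sub>R ((k/h) *\<^sub>R f + (1 - k/h) *\<^sub>R resolvent h f - resolvent h f))"
    using form_op_resolvent[OF assms(1)] by simp
qed

lemma resolvent_resolvent:
  assumes "0 < h" "0 < k"
  shows "(h - k) *\<^sub>R resolvent k (resolvent h f) = h *\<^sub>R resolvent h f - k *\<^sub>R resolvent k f"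
proof -
  have "h *\<^sub>R resolvent h f = k *\<^sub>R resolvent k f + (h - k) *\<^sub>R resolvent k (resolvent h f)"
    using arg_cong[OF resolvent_identity[OF assms, of f], of "\<lambda>x. h *\<^sub>R x"] assms
    by (simp add: resolvent_add resolvent_scale scaleR_add_right right_diff_distrib)
  then show ?thesis by simp
qed

lemma resolvent_commute:
  assumes "0 < h" "0 < k"
  shows "resolvent k (resolvent h f) = resolvent h (resolvent k f)"
proof (cases "h = k")
  case False
  have "(h - k) *\<^sub>R resolvent k (resolvent h f) = (h - k) *\<^sub>R resolvent h (resolvent k f)"
    using resolvent_resolvent[OF assms, of f] resolvent_resolvent[OF assms(2,1), of f]
    by (metis minus_diff_eq scaleR_minus_left)
  then show ?thesis using False by simp
qed simp

lemma resolvent_form_op: "0 < h \<Longrightarrow> form_op u f \<Longrightarrow> resolvent h (u + h *\<^sub>R f) = u"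
  by (rule resolvent_eqI) simp_all

text \<open>The identity I - J_h = h J_h A on the domain. The powers of h in the error estimates
  below come from it, each at the price of one more application of A to the datum.\<close>

lemma diff_resolvent:
  assumes "0 < h" "form_op u f"
  shows "u - resolvent h u = h *\<^sub>R resolvent h f"
  using resolvent_form_op[OF assms] assms(1) by (simp add: resolvent_add resolvent_scale algebra_simps)

lemma form_op_resolvent_both:
  assumes "0 < h" "form_op u f"
  shows "form_op (resolvent h u) (resolvent h f)"
  using form_op_resolvent[OF assms(1), of u] diff_resolvent[OF assms] assms(1) by simp

text \<open>One implicit Euler step of size \<open>h\<close> and two steps of size \<open>h/2\<close> differ by
  \<open>(I - J\<^bsub>h/2\<^esub>)\<^sup>2 J\<^bsub>h\<^esub>\<close>, which is quadratic in \<open>h\<close> on the domain of the square.\<close>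

lemma euler_step_halving:
  assumes h: "0 < h" and op: "form_op u f" "form_op f e"
  shows "norm (resolvent h u - resolvent (h/2) (resolvent (h/2) u)) \<le> h\<^sup>2 / 4 * norm e"
proof -
  let ?J = "resolvent h" and ?B = "resolvent (h/2)"
  have h2: "0 < h/2" using h by simp
  have BJ: "?B (?J x) = ?J x + ?J x - ?B x" for x
    using arg_cong[OF resolvent_resolvent[OF h h2, of x], of "\<lambda>y. (2/h) *\<^sub>R y"] h
    by (simp add: scaleR_diff_right scaleR_2)
  have "?J u - ?B (?B u) = ?J (u - ?B u - ?B (u - ?B u))"
    using h h2 by (simp add: resolvent_diff resolvent_add resolvent_commute[OF h2 h] BJ algebra_simps)
  also have "u - ?B u - ?B (u - ?B u) = (h\<^sup>2/4) *\<^sub>R ?B (?B e)"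
  proof -
    have "u - ?B u - ?B (u - ?B u) = (h/2) *\<^sub>R ?B (f - ?B f)"
      using diff_resolvent[OF h2 op(1)] h2 by (simp add: resolvent_scale resolvent_diff scaleR_diff_right)
    also have "\<dots> = (h/2) *\<^sub>R (h/2) *\<^sub>R ?B (?B e)"
      using diff_resolvent[OF h2 op(2)] h2 by (simp add: resolvent_scale)
    finally show ?thesis by (simp add: power2_eq_square)
  qed
  finally have "norm (?J u - ?B (?B u)) = norm (?J ((h\<^sup>2/4) *\<^sub>R ?B (?B e)))" by simp
  also have "\<dots> \<le> norm ((h\<^sup>2/4) *\<^sub>R ?B (?B e))" by (rule norm_resolvent[OF h])
  also have "\<dots> \<le> h\<^sup>2 / 4 * norm e"
    using norm_resolvent[OF h2, of "?B e"] norm_resolvent[OF h2, of e] by (simp add: mult_left_mono)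
  finally show ?thesis .
qed

section \<open>Implicit Euler iterates and their dyadic limit\<close>

abbreviation euler :: "nat \<Rightarrow> real \<Rightarrow> 'a \<Rightarrow> 'a" where
  "euler n h \<equiv> (resolvent h ^^ n)"

lemma euler_form_op: "0 < h \<Longrightarrow> form_op u f \<Longrightarrow> form_op (euler n h u) (euler n h f)"
  by (induction n) (auto simp: form_op_resolvent_both)

lemma norm_euler: "0 < h \<Longrightarrow> norm (euler n h u) \<le> norm u"
  by (induction n) (auto intro: order_trans[OF norm_resolvent])

text \<open>Local errors add up because each resolvent is a contraction, and the Euler iterates of
  \<open>e\<close> stay below norm e, so the bound of a single step is multiplied by n.\<close>

lemma euler_halving:
  assumes h: "0 < h" and op: "form_op u f" "form_op f e"
  shows "norm (euler n h u - euler (2 * n) (h/2) u) \<le> real n * (h\<^sup>2 / 4 * norm e)"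
proof (induction n)
  case (Suc n)
  have h2: "0 < h/2" using h by simp
  let ?B = "resolvent (h/2)" and ?x = "euler n h u"
  have "norm (resolvent h ?x - ?B (?B ?x)) \<le> h\<^sup>2 / 4 * norm (euler n h e)"
    by (rule euler_step_halving[OF h euler_form_op[OF h op(1)] euler_form_op[OF h op(2)]])
  also have "\<dots> \<le> h\<^sup>2 / 4 * norm e" by (intro mult_left_mono norm_euler h) auto
  finally have 1: "norm (resolvent h ?x - ?B (?B ?x)) \<le> h\<^sup>2 / 4 * norm e" .
  have 2: "norm (?B (?B ?x) - ?B (?B (euler (2 * n) (h/2) u))) \<le> real n * (h\<^sup>2 / 4 * norm e)"
    using norm_resolvent_diff[OF h2] Suc.IH by (meson order_trans)
  have "norm (euler (Suc n) h u - euler (2 * Suc n) (h/2) u)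
      = norm ((resolvent h ?x - ?B (?B ?x)) + (?B (?B ?x) - ?B (?B (euler (2 * n) (h/2) u))))"
    by simp
  also have "\<dots> \<le> h\<^sup>2 / 4 * norm e + real n * (h\<^sup>2 / 4 * norm e)"
    using norm_triangle_le[of _ _ "h\<^sup>2 / 4 * norm e + real n * (h\<^sup>2 / 4 * norm e)"] 1 2 add_mono by blast
  finally show ?case by (simp add: algebra_simps)
qed simp

text \<open>The exponential formula along dyadic step sizes, for which consecutive approximations
  are comparable by \<open>euler_halving\<close>. Convergence of the \<open>lim\<close> is
  established for \<open>u\<close> in the domain of the square; t = 0 is separate because the
  resolvent rules require a positive step.\<close>

definition semigroup :: "real \<Rightarrow> 'a \<Rightarrow> 'a" where
  "semigroup t u = (if t = 0 then u else lim (\<lambda>j. euler (2 ^ j) (t / 2 ^ j) u))"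

text \<open>With 2^j steps of size t/2^j the halving error is at most t^2/4 times norm e times
  2^(-j), which is summable in j.\<close>

lemma euler_tendsto_semigroup:
  assumes t: "0 < t" and op: "form_op u f" "form_op f e"
  shows "(\<lambda>j. euler (2 ^ j) (t / 2 ^ j) u) \<longlonglongrightarrow> semigroup t u"
proof -
  define x where "x j = euler (2 ^ j) (t / 2 ^ j) u" for j :: nat
  have step: "norm (x (Suc j) - x j) \<le> (t\<^sup>2 / 4 * norm e) * (1/2) ^ j" for j
  proof -
    have "norm (x j - x (Suc j)) \<le> 2 ^ j * ((t / 2 ^ j)\<^sup>2 / 4 * norm e)"
      using euler_halving[OF _ op, of "t / 2 ^ j" "2 ^ j"] t by (simp add: x_def mult.commute)
    also have "\<dots> = (t\<^sup>2 / 4 * norm e) * (1/2) ^ j"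
      by (simp add: power2_eq_square field_simps)
    finally show ?thesis by (simp add: norm_minus_commute)
  qed
  have sum: "summable (\<lambda>j. norm (x (Suc j) - x j))"
    by (rule summable_comparison_test[where g="\<lambda>j. (t\<^sup>2 / 4 * norm e) * (1/2) ^ j"])
      (use step in \<open>auto intro!: summable_mult summable_geometric\<close>)
  have "Cauchy x"
  proof (rule metric_CauchyI)
    fix r :: real assume r: "r > 0"
    obtain N where N: "\<And>m n. N \<le> m \<Longrightarrow> norm (\<Sum>j=m..<n. norm (x (Suc j) - x j)) < r"
      using sum r unfolding summable_Cauchy by metis
    have le: "norm (x n - x m) \<le> (\<Sum>j=m..<n. norm (x (Suc j) - x j))" if "m \<le> n" for m n
    proof -
      have "x n - x m = (\<Sum>j=m..<n. x (Suc j) - x j)" using sum_Suc_diff'[OF that, of x] by simp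
      then show ?thesis by (simp add: norm_sum)
    qed
    have "dist (x m) (x n) < r" if "N \<le> m" "m \<le> n" for m n
      using le[OF that(2)] N[OF that(1), of n] by (simp add: dist_norm norm_minus_commute)
    then have "dist (x m) (x n) < r" if "N \<le> m" "N \<le> n" for m n
      using that by (metis dist_commute linorder_linear)
    then show "\<exists>M. \<forall>m\<ge>M. \<forall>n\<ge>M. dist (x m) (x n) < r" by blast
  qed
  then show ?thesis using t
    by (simp add: semigroup_def Cauchy_convergent_iff convergent_LIMSEQ_iff flip: x_def)
qed

lemma semigroup_0 [simp]: "semigroup 0 u = u"
  by (simp add: semigroup_def)

text \<open>Used with the cone of nonnegative functions, so that positivity has to be checked for a
  single resolvent step only.\<close>

lemma semigroup_closed_invariant:
  assumes t: "0 \<le> t" and op: "form_op u f" "form_op f e"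
    and C: "closed C" "u \<in> C" "\<And>h v. 0 < h \<Longrightarrow> v \<in> C \<Longrightarrow> resolvent h v \<in> C"
  shows "semigroup t u \<in> C"
proof (cases "t = 0")
  case False
  then have t: "0 < t" using assms by simp
  have "euler n h u \<in> C" if "0 < h" for n h
    by (induction n) (use C that in auto)
  then show ?thesis using closed_sequentially[OF C(1) _ euler_tendsto_semigroup[OF t op]] t by simp
qed (use C in auto)

text \<open>A commutes with every Euler step, and \<open>form_op_closed\<close> passes this to the
  limit. The third element \<open>d\<close> makes the iterates of \<open>f\<close> converge,
  too.\<close>

lemma form_op_semigroup:
  assumes t: "0 \<le> t" and op: "form_op u f" "form_op f e" "form_op e d"
  shows "form_op (semigroup t u) (semigroup t f)"
proof (cases "t = 0")
  case False
  then have t: "0 < t" using assms by simp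
  show ?thesis
    by (rule form_op_closed[OF euler_form_op[OF _ op(1)]
          euler_tendsto_semigroup[OF t op(1,2)] euler_tendsto_semigroup[OF t op(2,3)]]) (use t in simp)
qed (use op in auto)

section \<open>Differentiability of the semigroup in time\<close>

lemma resolvent_diff_step:
  assumes "0 < h" "0 < k" "form_op u f"
  shows "resolvent k u - resolvent h u = - ((k - h) *\<^sub>R resolvent k (resolvent h f))"
proof -
  have "h *\<^sub>R resolvent k (resolvent h f) = resolvent k u - resolvent k (resolvent h u)"
    using diff_resolvent[OF assms(1,3)] assms by (simp flip: resolvent_scale resolvent_diff)
  moreover have "k *\<^sub>R resolvent k (resolvent h f) = resolvent h u - resolvent k (resolvent h u)"
    using diff_resolvent[OF assms(2,3)] assms
    by (simp add: resolvent_commute[OF assms(1,2)] flip: resolvent_scale resolvent_diff)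
  ultimately show ?thesis by (simp add: scaleR_diff_left)
qed

text \<open>Taylor expansion in the step size: the derivative of (1 + hA)^(-n) is -n (1 + hA)^(-n-1)
  A, hence the extra step in \<open>euler (Suc n) h f\<close>. With h = t/n and k = s/n the factor
  n(k - h) is s - t, so the remainder is independent of n and survives the limit.\<close>

lemma euler_taylor:
  assumes h: "0 < h" and k: "0 < k" and op: "form_op u f" "form_op f e"
  shows "norm (euler n k u - euler n h u + (real n * (k - h)) *\<^sub>R euler (Suc n) h f)
    \<le> (real n * (k - h))\<^sup>2 * norm e"
proof -
  \<comment> \<open>The passage from i to i + 1 steps contributes (i + 1)(k - h)^2 norm e, whence
    the triangular number.\<close>
  have "norm (euler n k u - euler n h u + (real n * (k - h)) *\<^sub>R euler (Suc n) h f)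
    \<le> real n * (real n + 1) / 2 * ((k - h)\<^sup>2 * norm e)"
  proof (induction n)
    case (Suc n)
    let ?x = "euler n h u" and ?y = "euler (Suc n) h f"
    let ?a = "euler n k u - ?x + (real n * (k - h)) *\<^sub>R ?y"
    have 1: "resolvent k ?x - resolvent h ?x = - ((k - h) *\<^sub>R resolvent k ?y)"
      using resolvent_diff_step[OF h k euler_form_op[OF h op(1)], of n] by simp
    have 2: "norm (resolvent h ?y - resolvent k ?y) \<le> \<bar>k - h\<bar> * norm e"
    proof -
      have "resolvent h ?y - resolvent k ?y = (k - h) *\<^sub>R resolvent k (resolvent h (euler (Suc n) h e))"
        using arg_cong[OF resolvent_diff_step[OF h k euler_form_op[OF h op(2), of "Suc n"]], of uminus]
        by (simp only: minus_diff_eq minus_minus)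
      then have "norm (resolvent h ?y - resolvent k ?y)
          = \<bar>k - h\<bar> * norm (resolvent k (resolvent h (euler (Suc n) h e)))"
        by simp
      also have "norm (resolvent k (resolvent h (euler (Suc n) h e))) \<le> norm e"
        using norm_resolvent[OF k] norm_resolvent[OF h] norm_euler[OF h] by (meson order_trans)
      finally show ?thesis by (simp add: mult_left_mono)
    qed
    have "euler (Suc n) k u - euler (Suc n) h u + (real (Suc n) * (k - h)) *\<^sub>R euler (Suc (Suc n)) h f
        = resolvent k ?a + (real (Suc n) * (k - h)) *\<^sub>R (resolvent h ?y - resolvent k ?y)"
    proof -
      have "euler (Suc n) k u - euler (Suc n) h u
        = resolvent k (euler n k u - ?x) - (k - h) *\<^sub>R resolvent k ?y"
        using 1 k by (simp add: resolvent_diff algebra_simps)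
      moreover have "resolvent k ?a = resolvent k (euler n k u - ?x) + (real n * (k - h)) *\<^sub>R resolvent k ?y"
        using k by (simp only: resolvent_add resolvent_scale)
      ultimately show ?thesis by (simp add: algebra_simps)
    qed
    also have "norm \<dots> \<le> real n * (real n + 1) / 2 * ((k - h)\<^sup>2 * norm e)
        + (real n + 1) * \<bar>k - h\<bar> * (\<bar>k - h\<bar> * norm e)"
    proof (rule norm_triangle_le, rule add_mono)
      show "norm (resolvent k ?a) \<le> real n * (real n + 1) / 2 * ((k - h)\<^sup>2 * norm e)"
        using norm_resolvent[OF k] Suc.IH by (meson order_trans)
      show "norm ((real (Suc n) * (k - h)) *\<^sub>R (resolvent h ?y - resolvent k ?y))
        \<le> (real n + 1) * \<bar>k - h\<bar> * (\<bar>k - h\<bar> * norm e)"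
        using mult_left_mono[OF 2, of "(real n + 1) * \<bar>k - h\<bar>"] by (simp add: abs_mult add.commute)
    qed
    also have "\<dots> = real (Suc n) * (real (Suc n) + 1) / 2 * ((k - h)\<^sup>2 * norm e)"
    proof -
      have "\<bar>k - h\<bar> * (\<bar>k - h\<bar> * norm e) = (k - h)\<^sup>2 * norm e"
        by (simp add: power2_eq_square flip: mult.assoc)
      moreover have "real n * (real n + 1) / 2 * c + (real n + 1) * c = real (Suc n) * (real (Suc n) + 1) / 2 * c" for c
        by (simp add: field_simps)
      ultimately show ?thesis by (simp only: mult.assoc[of "real n + 1"])
    qed
    finally show ?case .
  qed simp
  also have "\<dots> \<le> (real n)\<^sup>2 * ((k - h)\<^sup>2 * norm e)"
  proof (rule mult_right_mono)
    have "real n \<le> (real n)\<^sup>2" by (cases n) (auto simp: power2_eq_square)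
    then show "real n * (real n + 1) / 2 \<le> (real n)\<^sup>2" by (simp add: power2_eq_square algebra_simps)
  qed simp
  finally show ?thesis by (simp add: power_mult_distrib mult.assoc)
qed

lemma semigroup_taylor:
  assumes t: "0 < t" and s: "0 < s" and op: "form_op u f" "form_op f e" "form_op e d"
  shows "norm (semigroup s u - semigroup t u + (s - t) *\<^sub>R semigroup t f) \<le> (s - t)\<^sup>2 * norm e"
proof -
  \<comment> \<open>The extra Euler step in the first-order term changes it by at most t 2^(-j) norm
    e and disappears in the limit.\<close>
  have 0: "(\<lambda>j. euler (Suc (2 ^ j)) (t / 2 ^ j) f) \<longlonglongrightarrow> semigroup t f"
  proof (rule Lim_transform[OF euler_tendsto_semigroup[OF t op(2,3)]])
    have bd: "norm (euler (2 ^ j) (t / 2 ^ j) f - euler (Suc (2 ^ j)) (t / 2 ^ j) f) \<le> t * norm e * (1/2) ^ j" for j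
    proof -
      have h: "0 < t / 2 ^ j" using t by simp
      let ?y = "euler (2 ^ j) (t / 2 ^ j) f"
      have "norm (?y - resolvent (t / 2 ^ j) ?y)
        = t / 2 ^ j * norm (resolvent (t / 2 ^ j) (euler (2 ^ j) (t / 2 ^ j) e))"
        using diff_resolvent[OF h euler_form_op[OF h op(2)]] t by simp
      also have "\<dots> \<le> t / 2 ^ j * norm e"
        using norm_resolvent[OF h] norm_euler[OF h] t
        by (intro mult_left_mono) (auto intro: order_trans)
      finally show ?thesis by (simp add: power_one_over field_simps)
    qed
    have lim: "(\<lambda>j. t * norm e * (1/2) ^ j) \<longlonglongrightarrow> 0"
      by (intro tendsto_mult_right_zero LIMSEQ_power_zero) auto
    have "(\<lambda>j. euler (2 ^ j) (t / 2 ^ j) f - euler (Suc (2 ^ j)) (t / 2 ^ j) f) \<longlonglongrightarrow> 0"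
      by (rule Lim_null_comparison[OF always_eventually[OF allI[OF bd]] lim])
    from tendsto_minus[OF this]
    show "(\<lambda>j. euler (Suc (2 ^ j)) (t / 2 ^ j) f - euler (2 ^ j) (t / 2 ^ j) f) \<longlonglongrightarrow> 0" by simp
  qed
  show ?thesis
  proof (rule LIMSEQ_le_const2)
    show "(\<lambda>j. norm (euler (2 ^ j) (s / 2 ^ j) u - euler (2 ^ j) (t / 2 ^ j) u
        + (s - t) *\<^sub>R euler (Suc (2 ^ j)) (t / 2 ^ j) f))
      \<longlonglongrightarrow> norm (semigroup s u - semigroup t u + (s - t) *\<^sub>R semigroup t f)"
      by (intro tendsto_intros 0 euler_tendsto_semigroup[OF t op(1,2)] euler_tendsto_semigroup[OF s op(1,2)])
    have "norm (euler (2 ^ j) (s / 2 ^ j) u - euler (2 ^ j) (t / 2 ^ j) u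
        + (s - t) *\<^sub>R euler (Suc (2 ^ j)) (t / 2 ^ j) f) \<le> (s - t)\<^sup>2 * norm e" for j
    proof -
      have "real (2 ^ j) * (s / 2 ^ j - t / 2 ^ j) = s - t" by (simp add: field_simps)
      then show ?thesis
        using euler_taylor[OF _ _ op(1,2), of "t / 2 ^ j" "s / 2 ^ j" "2 ^ j"] t s by simp
    qed
    then show "\<exists>N. \<forall>j\<ge>N. norm (euler (2 ^ j) (s / 2 ^ j) u - euler (2 ^ j) (t / 2 ^ j) u
        + (s - t) *\<^sub>R euler (Suc (2 ^ j)) (t / 2 ^ j) f) \<le> (s - t)\<^sup>2 * norm e" by blast
  qed
qed

lemma semigroup_has_vector_derivative:
  assumes t: "0 < t" and op: "form_op u f" "form_op f e" "form_op e d"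
  shows "((\<lambda>s. semigroup s u) has_vector_derivative - semigroup t f) (at t)"
  unfolding has_vector_derivative_def has_derivative_at2
proof (intro conjI bounded_linear_intros)
  show "((\<lambda>y. (1 / norm (y - t)) *\<^sub>R (semigroup y u - (semigroup t u + (y - t) *\<^sub>R - semigroup t f))) \<longlongrightarrow> 0) (at t)"
  proof (rule Lim_null_comparison)
    have "\<forall>\<^sub>F y in at t. y > 0 \<and> y \<noteq> t"
      using t by (auto simp: eventually_at intro!: exI[of _ t] simp: dist_real_def)
    then show "\<forall>\<^sub>F y in at t. norm ((1 / norm (y - t)) *\<^sub>R (semigroup y u - (semigroup t u + (y - t) *\<^sub>R - semigroup t f)))
        \<le> \<bar>y - t\<bar> * norm e"
    proof eventually_elim
      case (elim y)
      have "norm (semigroup y u - semigroup t u + (y - t) *\<^sub>R semigroup t f) \<le> \<bar>y - t\<bar> * (\<bar>y - t\<bar> * norm e)"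
        using semigroup_taylor[OF t _ op, of y] elim by (simp add: power2_eq_square flip: mult.assoc)
      then have "norm (semigroup y u - (semigroup t u + (y - t) *\<^sub>R - semigroup t f)) / \<bar>y - t\<bar> \<le> \<bar>y - t\<bar> * norm e"
        using elim by (simp add: pos_divide_le_eq mult.commute diff_diff_eq2 diff_add_eq)
      then show ?case using elim by simp
    qed
    have "((\<lambda>y. \<bar>y - t\<bar> * norm e) \<longlongrightarrow> \<bar>t - t\<bar> * norm e) (at t)"
      by (intro tendsto_intros)
    then show "((\<lambda>y. \<bar>y - t\<bar> * norm e) \<longlongrightarrow> 0) (at t)" by simp
  qed
qed

lemma semigroup_tendsto_0:
  assumes op: "form_op u f" "form_op f e"
  shows "((\<lambda>s. semigroup s u) \<longlongrightarrow> u) (at 0 within {0..})"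
proof -
  have le: "norm (semigroup s u - u) \<le> s * norm f" if "s > 0" for s
  proof (rule LIMSEQ_le_const2)
    show "(\<lambda>j. norm (euler (2 ^ j) (s / 2 ^ j) u - u)) \<longlonglongrightarrow> norm (semigroup s u - u)"
      by (intro tendsto_intros euler_tendsto_semigroup[OF that op])
    have "norm (euler n h u - u) \<le> real n * (h * norm f)" if h: "0 < h" for n h
    proof (induction n)
      case (Suc n)
      have "norm (resolvent h u - u) \<le> h * norm f"
        using diff_resolvent[OF h op(1)] norm_resolvent[OF h, of f] h
        by (metis mult_left_mono norm_minus_commute norm_scaleR abs_of_pos less_imp_le)
      moreover have "norm (resolvent h (euler n h u) - resolvent h u) \<le> real n * (h * norm f)"
        using norm_resolvent_diff[OF h] Suc.IH by (meson order_trans)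
      ultimately show ?case
        using norm_triangle_ineq[of "resolvent h (euler n h u) - resolvent h u" "resolvent h u - u"]
        by (simp add: algebra_simps)
    qed simp
    from this[of "s / 2 ^ j" "2 ^ j" for j] that
    show "\<exists>N. \<forall>j\<ge>N. norm (euler (2 ^ j) (s / 2 ^ j) u - u) \<le> s * norm f" by simp
  qed
  show ?thesis
  proof (rule LIM_zero_cancel, rule Lim_null_comparison)
    show "\<forall>\<^sub>F s in at 0 within {0..}. norm (semigroup s u - u) \<le> s * norm f"
      using le by (auto simp: eventually_at intro!: exI[of _ 1])
    have "((\<lambda>s. s * norm f) \<longlongrightarrow> 0 * norm f) (at 0 within {0..})" by (intro tendsto_intros)
    then show "((\<lambda>s. s * norm f) \<longlongrightarrow> 0) (at 0 within {0..})" by simp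
  qed
qed

end

section \<open>The space \<open>L\<^sup>2(\<real>\<^sup>2)\<close>\<close>

type_synonym plane_fun = "real \<times> real \<Rightarrow> real"

definition square_integrable :: "plane_fun \<Rightarrow> bool" where
  "square_integrable f \<longleftrightarrow> f \<in> borel_measurable lborel \<and> integrable lborel (\<lambda>x. (f x)\<^sup>2)"

lemma square_integrable_measurable: "square_integrable f \<Longrightarrow> f \<in> borel_measurable lborel"
  by (simp add: square_integrable_def)

lemma square_integrable_mult:
  assumes "square_integrable f" "square_integrable g"
  shows "integrable lborel (\<lambda>x. f x * g x)"
proof (rule Bochner_Integration.integrable_bound[of _ "\<lambda>x. (f x)\<^sup>2 + (g x)\<^sup>2"])
  show "integrable lborel (\<lambda>x. (f x)\<^sup>2 + (g x)\<^sup>2)"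
    using assms by (auto simp: square_integrable_def)
  show "(\<lambda>x. f x * g x) \<in> borel_measurable lborel"
    using assms by (auto simp: square_integrable_def)
  have "\<bar>a * b\<bar> \<le> a\<^sup>2 + b\<^sup>2" for a b :: real
  proof -
    have "2 * (\<bar>a\<bar> * \<bar>b\<bar>) \<le> a\<^sup>2 + b\<^sup>2"
      using sum_squares_bound[of "\<bar>a\<bar>" "\<bar>b\<bar>"] by simp
    moreover have "0 \<le> \<bar>a\<bar> * \<bar>b\<bar>" by simp
    ultimately show ?thesis unfolding abs_mult by linarith
  qed
  then show "AE x in lborel. norm (f x * g x) \<le> norm ((f x)\<^sup>2 + (g x)\<^sup>2)"
    by simp
qed

lemma square_integrable_bound:
  assumes "square_integrable g" "f \<in> borel_measurable lborel" "AE x in lborel. \<bar>f x\<bar> \<le> \<bar>g x\<bar>"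
  shows "square_integrable f"
  unfolding square_integrable_def
proof
  show "integrable lborel (\<lambda>x. (f x)\<^sup>2)"
  proof (rule Bochner_Integration.integrable_bound[of _ "\<lambda>x. (g x)\<^sup>2"])
    show "AE x in lborel. norm ((f x)\<^sup>2) \<le> norm ((g x)\<^sup>2)"
      using assms(3) by eventually_elim (simp add: abs_le_square_iff)
  qed (use assms in \<open>auto simp: square_integrable_def\<close>)
qed (use assms in simp)

lemma square_integrable_add:
  assumes "square_integrable f" "square_integrable g"
  shows "square_integrable (\<lambda>x. f x + g x)"
  using assms square_integrable_mult[OF assms]
  by (auto simp: square_integrable_def power2_sum mult.assoc)

lemma square_integrable_scale: "square_integrable f \<Longrightarrow> square_integrable (\<lambda>x. c * f x)"
  by (auto simp: square_integrable_def power_mult_distrib)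

lemma square_integrable_0: "square_integrable (\<lambda>x. 0)"
  by (simp add: square_integrable_def)

lemma square_integrable_uminus: "square_integrable f \<Longrightarrow> square_integrable (\<lambda>x. - f x)"
  by (auto simp: square_integrable_def)

lemma square_integrable_diff:
  "square_integrable f \<Longrightarrow> square_integrable g \<Longrightarrow> square_integrable (\<lambda>x. f x - g x)"
  using square_integrable_add[OF _ square_integrable_uminus, of f g] by simp

definition eq_ae :: "plane_fun \<Rightarrow> plane_fun \<Rightarrow> bool" where
  "eq_ae f g \<longleftrightarrow> square_integrable f \<and> square_integrable g \<and> (AE x in lborel. f x = g x)"

\<comment> \<open>A partial quotient: \<open>eq_ae\<close> is reflexive exactly on square integrable
  functions, so \<open>rep\<close> always returns one. The functions live on the whole plane;
  L^2(\<Omega>) will enter as the subspace of functions extended by zero.\<close>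
quotient_type l2 = "real \<times> real \<Rightarrow> real" / partial: eq_ae
proof (rule part_equivpI)
  show "\<exists>f. eq_ae f f" using square_integrable_0 by (auto simp: eq_ae_def)
  show "symp eq_ae" by (auto simp: symp_def eq_ae_def)
  show "transp eq_ae" unfolding transp_def eq_ae_def by auto
qed

instantiation l2 :: real_vector
begin
lift_definition zero_l2 :: l2 is "\<lambda>x. 0" by (simp add: eq_ae_def square_integrable_0)
lift_definition plus_l2 :: "l2 \<Rightarrow> l2 \<Rightarrow> l2" is "\<lambda>f g x. f x + g x"
  by (auto simp: eq_ae_def square_integrable_add)
lift_definition minus_l2 :: "l2 \<Rightarrow> l2 \<Rightarrow> l2" is "\<lambda>f g x. f x - g x"
  by (auto simp: eq_ae_def square_integrable_diff)
lift_definition uminus_l2 :: "l2 \<Rightarrow> l2" is "\<lambda>f x. - f x"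
  by (auto simp: eq_ae_def square_integrable_uminus)
lift_definition scaleR_l2 :: "real \<Rightarrow> l2 \<Rightarrow> l2" is "\<lambda>c f x. c * f x"
  by (auto simp: eq_ae_def square_integrable_scale)
instance
  by standard (transfer; auto simp: eq_ae_def algebra_simps intro!: square_integrable_0 square_integrable_add
      square_integrable_scale square_integrable_diff square_integrable_uminus)+
end

lemma integral_square_eq_0:
  assumes "square_integrable f"
  shows "(LINT x|lborel. f x * f x) = 0 \<longleftrightarrow> (AE x in lborel. f x = 0)"
  using integral_nonneg_eq_0_iff_AE[OF square_integrable_mult[OF assms assms]] by simp

instantiation l2 :: real_inner
begin
lift_definition inner_l2 :: "l2 \<Rightarrow> l2 \<Rightarrow> real" is "\<lambda>f g. LINT x|lborel. f x * g x"
  by (rule integral_cong_AE) (auto simp: eq_ae_def square_integrable_def)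
definition norm_l2 :: "l2 \<Rightarrow> real" where "norm_l2 f = sqrt (inner f f)"
definition sgn_l2 :: "l2 \<Rightarrow> l2" where "sgn_l2 f = f /\<^sub>R norm f"
definition dist_l2 :: "l2 \<Rightarrow> l2 \<Rightarrow> real" where "dist_l2 f g = norm (f - g)"
definition uniformity_l2 :: "(l2 \<times> l2) filter" where
  "uniformity_l2 = (INF e\<in>{0 <..}. principal {(x, y). dist x y < e})"
definition open_l2 :: "l2 set \<Rightarrow> bool" where
  "open_l2 U = (\<forall>x\<in>U. \<forall>\<^sub>F (x', y) in uniformity. x' = x \<longrightarrow> y \<in> U)"
instance
proof
  fix x y z :: l2 and r :: real
  show "inner x y = inner y x" by transfer (simp add: mult.commute)
  show "inner (x + y) z = inner x z + inner y z"
    by transfer (simp add: eq_ae_def distrib_right square_integrable_mult)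
  show "inner (r *\<^sub>R x) y = r * inner x y"
    by transfer (simp add: eq_ae_def mult.assoc)
  show "0 \<le> inner x x" by transfer simp
  show "(inner x x = 0) = (x = 0)"
    by transfer (simp add: eq_ae_def integral_square_eq_0 square_integrable_0)
qed (simp_all add: norm_l2_def sgn_l2_def dist_l2_def uniformity_l2_def open_l2_def)
end

abbreviation cls :: "plane_fun \<Rightarrow> l2" where "cls \<equiv> abs_l2"
abbreviation rep :: "l2 \<Rightarrow> plane_fun" where "rep \<equiv> rep_l2"

lemma square_integrable_rep: "square_integrable (rep v)"
  using Quotient3_rep_reflp[OF Quotient3_l2] by (auto simp: eq_ae_def)

lemma cls_rep [simp]: "cls (rep v) = v"
  by (rule Quotient3_abs_rep[OF Quotient3_l2])

lemma cls_eq_iff: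
  "square_integrable f \<Longrightarrow> square_integrable g \<Longrightarrow> cls f = cls g \<longleftrightarrow> (AE x in lborel. f x = g x)"
  using Quotient3_rel[OF Quotient3_l2, of f g] by (auto simp: eq_ae_def)

lemma cls_cong:
  assumes "square_integrable f" "g \<in> borel_measurable lborel" "AE x in lborel. f x = g x"
  shows "cls f = cls g"
  by (subst cls_eq_iff)
    (use assms in \<open>auto intro: square_integrable_bound[OF assms(1)]\<close>)

lemma rep_cls: "square_integrable f \<Longrightarrow> AE x in lborel. rep (cls f) x = f x"
  using cls_eq_iff[OF square_integrable_rep, of f "cls f"] by simp

lemma inner_cls:
  "square_integrable f \<Longrightarrow> square_integrable g \<Longrightarrow> inner (cls f) (cls g) = (LINT x|lborel. f x * g x)"
  by (rule inner_l2.abs_eq) (auto simp: eq_ae_def)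

lemma norm_cls: "square_integrable f \<Longrightarrow> norm (cls f) = sqrt (LINT x|lborel. (f x)\<^sup>2)"
  by (simp add: norm_l2_def inner_cls power2_eq_square)

lemma cls_add: "square_integrable f \<Longrightarrow> square_integrable g \<Longrightarrow> cls f + cls g = cls (\<lambda>x. f x + g x)"
  by (rule plus_l2.abs_eq) (auto simp: eq_ae_def)

lemma cls_diff: "square_integrable f \<Longrightarrow> square_integrable g \<Longrightarrow> cls f - cls g = cls (\<lambda>x. f x - g x)"
  by (rule minus_l2.abs_eq) (auto simp: eq_ae_def)

lemma cls_scale: "square_integrable f \<Longrightarrow> c *\<^sub>R cls f = cls (\<lambda>x. c * f x)"
  by (rule scaleR_l2.abs_eq) (auto simp: eq_ae_def)

lemma cls_0: "cls (\<lambda>x. 0) = 0"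
  by (simp add: zero_l2.abs_eq)

lemma nn_integral_square:
  "square_integrable f \<Longrightarrow> (\<integral>\<^sup>+ x. ennreal ((f x)\<^sup>2) \<partial>lborel) = ennreal ((norm (cls f))\<^sup>2)"
  by (simp add: norm_cls nn_integral_eq_integral square_integrable_def)

lemma cls_abs_norm: "square_integrable f \<Longrightarrow> norm (cls (\<lambda>x. \<bar>f x\<bar>)) = norm (cls f)"
  by (subst norm_cls) (auto simp: norm_cls square_integrable_def)

lemma norm_cls_mono:
  assumes g: "square_integrable g" and f: "f \<in> borel_measurable lborel"
    and le: "AE x in lborel. \<bar>f x\<bar> \<le> \<bar>g x\<bar>"
  shows "norm (cls f) \<le> norm (cls g)"
proof -
  have f': "square_integrable f" by (rule square_integrable_bound[OF g f le])
  have "(LINT x|lborel. (f x)\<^sup>2) \<le> (LINT x|lborel. (g x)\<^sup>2)"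
    by (rule integral_mono_AE)
      (use f' g le in \<open>auto simp: square_integrable_def abs_le_square_iff\<close>)
  then show ?thesis by (simp add: norm_cls f' g)
qed

lemma square_integrable_sum:
  "(\<And>k. k < n \<Longrightarrow> square_integrable (f k)) \<Longrightarrow> square_integrable (\<lambda>x. \<Sum>k<(n::nat). f k x)"
  by (induction n) (auto simp: square_integrable_0 square_integrable_add)

lemma norm_cls_sum_le:
  "(\<And>k. k < n \<Longrightarrow> square_integrable (f k)) \<Longrightarrow>
    norm (cls (\<lambda>x. \<Sum>k<(n::nat). f k x)) \<le> (\<Sum>k<n. norm (cls (f k)))"
proof (induction n)
  case (Suc n)
  have "cls (\<lambda>x. \<Sum>k<Suc n. f k x) = cls (\<lambda>x. \<Sum>k<n. f k x) + cls (f n)"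
    using Suc.prems by (subst cls_add) (auto intro!: square_integrable_sum)
  then show ?case
    using Suc norm_triangle_ineq[of "cls (\<lambda>x. \<Sum>k<n. f k x)" "cls (f n)"] by fastforce
qed (simp add: cls_0)

text \<open>The Riesz-Fischer argument: the partial sums of |F_(k+1) - F_k| have norm at most 2, so
  monotone convergence gives pointwise convergence almost everywhere, and Fatou's lemma turns the
  pointwise limit into a norm limit with a rate.\<close>

lemma l2_fast_Cauchy_convergent:
  fixes X :: "nat \<Rightarrow> l2"
  assumes X: "\<And>n. norm (X (Suc n) - X n) \<le> (1/2) ^ n"
  shows "convergent X"
proof -
  define F where "F n = rep (X n)" for n
  have F: "square_integrable (F n)" for n by (simp add: F_def square_integrable_rep)
  have Fm [measurable]: "F n \<in> borel_measurable lborel" for n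
    using F square_integrable_measurable by blast
  have XF: "X n = cls (F n)" for n by (simp add: F_def)
  define D where "D n x = \<bar>F (Suc n) x - F n x\<bar>" for n x
  have D: "square_integrable (D n)" for n
    unfolding D_def by (rule square_integrable_bound[OF square_integrable_diff[OF F F]]) auto
  have nD: "norm (cls (D n)) \<le> (1/2) ^ n" for n
    using X[of n] cls_abs_norm[OF square_integrable_diff[OF F F], of "Suc n" n]
    by (simp add: XF cls_diff F D_def[abs_def])
  define S where "S n x = (\<Sum>k<n. D k x)" for n x
  have S: "square_integrable (S n)" for n unfolding S_def using D by (intro square_integrable_sum)
  have Sm [measurable]: "S n \<in> borel_measurable lborel" for n
    using S square_integrable_measurable by blast
  have "norm (cls (S n)) \<le> 2" for n
  proof -
    have "norm (cls (S n)) \<le> (\<Sum>k<n. norm (cls (D k)))"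
      unfolding S_def[abs_def] using D by (intro norm_cls_sum_le)
    also have "\<dots> \<le> (\<Sum>k<n. (1/2) ^ k)" by (intro sum_mono nD)
    also have "\<dots> \<le> (\<Sum>k. (1/2) ^ k)" by (intro sum_le_suminf summable_geometric) auto
    also have "\<dots> = 2" by (subst suminf_geometric) auto
    finally show ?thesis .
  qed
  then have S4: "(\<integral>\<^sup>+ x. ennreal ((S n x)\<^sup>2) \<partial>lborel) \<le> 4" for n
    using nn_integral_square[OF S, of n] power_mono[of "norm (cls (S n))" 2 2] ennreal_leI[of _ 4] by simp
  have mono: "incseq (\<lambda>n x. ennreal ((S n x)\<^sup>2))"
    unfolding incseq_def le_fun_def
    by (auto intro!: power_mono sum_mono2 sum_nonneg ennreal_leI simp: S_def D_def)
  have "(\<integral>\<^sup>+ x. (SUP n. ennreal ((S n x)\<^sup>2)) \<partial>lborel) \<le> 4"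
    using S4 by (subst nn_integral_monotone_convergence_SUP[OF mono]) (auto intro: SUP_least)
  then have "AE x in lborel. (SUP n. ennreal ((S n x)\<^sup>2)) \<noteq> \<infinity>"
    by (intro nn_integral_noteq_infinite) (auto simp: top_unique)
  then have conv: "AE x in lborel. convergent (\<lambda>n. F n x)"
  proof eventually_elim
    case (elim x)
    then obtain b where b: "b \<ge> 0" "(SUP n. ennreal ((S n x)\<^sup>2)) = ennreal b"
      by (metis ennreal_cases infinity_ennreal_def)
    have "S n x \<le> sqrt b" for n
    proof -
      have "ennreal ((S n x)\<^sup>2) \<le> ennreal b" unfolding b(2)[symmetric] by (rule SUP_upper) simp
      then have "(S n x)\<^sup>2 \<le> b" using b by (simp add: ennreal_le_iff)
      then show ?thesis by (rule real_le_rsqrt)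
    qed
    then have "summable (\<lambda>k. D k x)"
      by (intro summableI_nonneg_bounded[of _ "sqrt b"]) (auto simp: S_def D_def)
    then have "summable (\<lambda>k. F (Suc k) x - F k x)"
      unfolding D_def by (rule summable_rabs_cancel)
    then have "convergent (\<lambda>n. F n x - F 0 x)"
      by (simp add: summable_iff_convergent sum_lessThan_telescope[of "\<lambda>n. F n x"])
    then show ?case
      using convergent_add[OF _ convergent_const, of "\<lambda>n. F n x - F 0 x" "F 0 x"] by simp
  qed
  define G where "G x = lim (\<lambda>n. F n x)" for x
  have Gm [measurable]: "G \<in> borel_measurable lborel" unfolding G_def by measurable
  have lim: "AE x in lborel. (\<lambda>n. F n x) \<longlonglongrightarrow> G x"
    using conv by eventually_elim (simp add: G_def convergent_LIMSEQ_iff)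
  have dist: "norm (X m - X n) \<le> 2 * (1/2) ^ n" if "n \<le> m" for m n
  proof -
    have "X m - X n = (\<Sum>k=n..<m. X (Suc k) - X k)" using sum_Suc_diff'[OF that, of X] by simp
    then have "norm (X m - X n) \<le> (\<Sum>k=n..<m. (1/2) ^ k)"
      using X by (auto intro!: order_trans[OF norm_sum] sum_mono)
    also have "\<dots> = 2 * (1/2) ^ n - 2 * (1/2) ^ m"
      using that by (induction m rule: dec_induct) simp_all
    also have "\<dots> \<le> 2 * (1/2) ^ n" by simp
    finally show ?thesis .
  qed
  have GF: "(\<integral>\<^sup>+ x. ennreal ((G x - F n x)\<^sup>2) \<partial>lborel) \<le> ennreal ((2 * (1/2) ^ n)\<^sup>2)" for n
  proof -
    have "(\<integral>\<^sup>+ x. ennreal ((G x - F n x)\<^sup>2) \<partial>lborel)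
        = (\<integral>\<^sup>+ x. liminf (\<lambda>m. ennreal ((F m x - F n x)\<^sup>2)) \<partial>lborel)"
    proof (rule nn_integral_cong_AE, use lim in eventually_elim)
      case (elim x)
      then have "(\<lambda>m. ennreal ((F m x - F n x)\<^sup>2)) \<longlonglongrightarrow> ennreal ((G x - F n x)\<^sup>2)"
        by (intro tendsto_intros) 
      then show ?case using lim_imp_Liminf[OF trivial_limit_sequentially] by metis
    qed
    also have "\<dots> \<le> liminf (\<lambda>m. \<integral>\<^sup>+ x. ennreal ((F m x - F n x)\<^sup>2) \<partial>lborel)"
      by (rule nn_integral_liminf) measurable
    also have "\<dots> \<le> ennreal ((2 * (1/2) ^ n)\<^sup>2)"
    proof (rule Liminf_le)
      have "(\<integral>\<^sup>+ x. ennreal ((F m x - F n x)\<^sup>2) \<partial>lborel) \<le> ennreal ((2 * (1/2) ^ n)\<^sup>2)" if "n \<le> m" for m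
        using power_mono[OF dist[OF that], of 2] nn_integral_square[OF square_integrable_diff[OF F F], of m n]
        by (auto simp: XF cls_diff F intro!: ennreal_leI)
      then show "\<forall>\<^sub>F m in sequentially. (\<integral>\<^sup>+ x. ennreal ((F m x - F n x)\<^sup>2) \<partial>lborel) \<le> ennreal ((2 * (1/2) ^ n)\<^sup>2)"
        using eventually_sequentially by blast
    qed simp
    finally show ?thesis .
  qed
  have GFs: "square_integrable (\<lambda>x. G x - F n x)" for n
    unfolding square_integrable_def
  proof
    show "integrable lborel (\<lambda>x. (G x - F n x)\<^sup>2)"
      using GF[of n] by (intro integrableI_nonneg) (auto simp: less_top[symmetric] top_unique)
  qed measurable
  have G: "square_integrable G" using square_integrable_add[OF GFs[of 0] F[of 0]] by simp
  have "norm (cls G - X n) \<le> 2 * (1/2) ^ n" for n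
  proof -
    have "ennreal ((norm (cls G - X n))\<^sup>2) \<le> ennreal ((2 * (1/2) ^ n)\<^sup>2)"
      using GF[of n] nn_integral_square[OF GFs[of n]] by (simp add: XF cls_diff G F)
    then show ?thesis by (subst (asm) ennreal_le_iff) (auto intro: power2_le_imp_le)
  qed
  then have "X \<longlonglongrightarrow> cls G"
  proof (intro LIM_zero_cancel[of X "cls G"] Lim_null_comparison[of "\<lambda>n. X n - cls G" "\<lambda>n. 2 * (1/2) ^ n"])
    show "(\<lambda>n. 2 * (1/2) ^ n :: real) \<longlonglongrightarrow> 0"
      by (intro tendsto_mult_right_zero LIMSEQ_power_zero) auto
  qed (auto simp: norm_minus_commute)
  then show ?thesis by (auto simp: convergent_def)
qed

instance l2 :: complete_space
proof
  fix X :: "nat \<Rightarrow> l2" assume X: "Cauchy X"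
  have "\<exists>N. \<forall>m\<ge>N. \<forall>n\<ge>N. norm (X m - X n) < (1/2) ^ k" for k :: nat
    using X unfolding Cauchy_def dist_norm by (metis half_gt_zero zero_less_one zero_less_power)
  then obtain N where N: "\<And>k m n. N k \<le> m \<Longrightarrow> N k \<le> n \<Longrightarrow> norm (X m - X n) < (1/2) ^ k" by metis
  \<comment> \<open>The sum dominates N k at the indices k and Suc k; the summand k makes r strictly
    increasing.\<close>
  define r where "r k = k + (\<Sum>j\<le>k. N j)" for k
  have rN: "N k \<le> r k" "N k \<le> r (Suc k)" for k
  proof -
    have "N k \<le> (\<Sum>j\<le>k. N j)" by (rule member_le_sum) auto
    then show "N k \<le> r k" "N k \<le> r (Suc k)" by (auto simp: r_def)
  qed
  have r: "strict_mono r" by (rule strict_monoI_Suc) (simp add: r_def)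
  have "convergent (X \<circ> r)"
    by (rule l2_fast_Cauchy_convergent) (simp add: N rN less_imp_le)
  then obtain l where "(X \<circ> r) \<longlonglongrightarrow> l" by (auto simp: convergent_def)
  then have "X \<longlonglongrightarrow> l" by (rule Cauchy_converges_subseq[OF X r])
  then show "convergent X" by (auto simp: convergent_def)
qed

section \<open>Integration by parts and ground states\<close>

text \<open>Partial derivatives are carried as explicit functions, so a second derivative is another
  instance with \<open>f1\<close> or \<open>f2\<close> in first place. The derivative is
  unrestricted at each point, hence \<open>S\<close> is meant to be open.\<close>

definition C1_on :: "(real \<times> real) set \<Rightarrow> plane_fun \<Rightarrow> plane_fun \<Rightarrow> plane_fun \<Rightarrow> bool" where
  "C1_on S f f1 f2 \<longleftrightarrow> (\<forall>x\<in>S. (f has_derivative (\<lambda>h. f1 x * fst h + f2 x * snd h)) (at x)) \<and>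
     continuous_on S f1 \<and> continuous_on S f2"

lemma Cc1_iff:
  "Cc1 \<Omega> \<phi> d1 d2 \<longleftrightarrow> C1_on UNIV \<phi> d1 d2 \<and> (\<exists>K. compact K \<and> K \<subseteq> \<Omega> \<and> (\<forall>x. x \<notin> K \<longrightarrow> \<phi> x = 0))"
  by (auto simp: Cc1_def C1_on_def)

lemma C1_on_subset: "C1_on S f f1 f2 \<Longrightarrow> T \<subseteq> S \<Longrightarrow> C1_on T f f1 f2"
  by (auto simp: C1_on_def intro: continuous_on_subset)

lemma C1_on_continuous: "C1_on S f f1 f2 \<Longrightarrow> continuous_on S f"
  unfolding C1_on_def
  by (meson continuous_at_imp_continuous_on has_derivative_continuous)

lemma C1_on_cong:
  assumes "C1_on S f f1 f2" "\<And>x. x \<in> S \<Longrightarrow> f1 x = g1 x" "\<And>x. x \<in> S \<Longrightarrow> f2 x = g2 x"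
  shows "C1_on S f g1 g2"
  using assms(1) continuous_on_cong[of S S f1 g1] continuous_on_cong[of S S f2 g2] assms(2,3)
  by (simp add: C1_on_def)

lemma C1_on_const: "C1_on S (\<lambda>x. c) (\<lambda>x. 0) (\<lambda>x. 0)"
  by (auto simp: C1_on_def)

lemma C1_on_fst: "C1_on S fst (\<lambda>x. 1) (\<lambda>x. 0)"
  by (auto simp: C1_on_def intro!: derivative_eq_intros)

lemma C1_on_snd: "C1_on S snd (\<lambda>x. 0) (\<lambda>x. 1)"
  by (auto simp: C1_on_def intro!: derivative_eq_intros)

lemma C1_on_add:
  assumes "C1_on S f f1 f2" "C1_on S g g1 g2"
  shows "C1_on S (\<lambda>x. f x + g x) (\<lambda>x. f1 x + g1 x) (\<lambda>x. f2 x + g2 x)"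
  using assms unfolding C1_on_def
  by (auto intro!: continuous_intros derivative_eq_intros ext simp: algebra_simps)

lemma C1_on_mult:
  assumes "C1_on S f f1 f2" "C1_on S g g1 g2"
  shows "C1_on S (\<lambda>x. f x * g x) (\<lambda>x. f1 x * g x + f x * g1 x) (\<lambda>x. f2 x * g x + f x * g2 x)"
  using assms C1_on_continuous[OF assms(1)] C1_on_continuous[OF assms(2)] unfolding C1_on_def
  by (auto intro!: continuous_intros derivative_eq_intros ext simp: algebra_simps)

lemma C1_on_cmult: "C1_on S f f1 f2 \<Longrightarrow> C1_on S (\<lambda>x. c * f x) (\<lambda>x. c * f1 x) (\<lambda>x. c * f2 x)"
  using C1_on_mult[OF C1_on_const] by simp

lemma C1_on_diff:
  assumes "C1_on S f f1 f2" "C1_on S g g1 g2"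
  shows "C1_on S (\<lambda>x. f x - g x) (\<lambda>x. f1 x - g1 x) (\<lambda>x. f2 x - g2 x)"
  using C1_on_add[OF assms(1) C1_on_cmult[OF assms(2), of "-1"]] by simp

lemma C1_on_compose:
  assumes f: "C1_on S f f1 f2" and g: "\<And>x. x \<in> S \<Longrightarrow> (g has_real_derivative g' (f x)) (at (f x))"
    and c: "continuous_on S (\<lambda>x. g' (f x))"
  shows "C1_on S (\<lambda>x. g (f x)) (\<lambda>x. g' (f x) * f1 x) (\<lambda>x. g' (f x) * f2 x)"
  unfolding C1_on_def
proof (intro conjI ballI continuous_intros c)
  fix x assume x: "x \<in> S"
  have "(g has_derivative (\<lambda>h. h * g' (f x))) (at (f x))"
    using g[OF x] by (simp add: has_field_derivative_def mult_commute_abs)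
  moreover have "(f has_derivative (\<lambda>h. f1 x * fst h + f2 x * snd h)) (at x)"
    using f x by (simp add: C1_on_def)
  ultimately have "((g \<circ> f) has_derivative (\<lambda>h. h * g' (f x)) \<circ> (\<lambda>h. f1 x * fst h + f2 x * snd h)) (at x)"
    by (rule diff_chain_at[rotated])
  then show "((\<lambda>x. g (f x)) has_derivative (\<lambda>h. g' (f x) * f1 x * fst h + g' (f x) * f2 x * snd h)) (at x)"
    by (simp add: o_def algebra_simps)
qed (use f in \<open>auto simp: C1_on_def\<close>)

text \<open>A polynomial in the coordinates, hence smooth at the origin, unlike
  \<open>norm\<close>.\<close>

definition sqn :: "real \<times> real \<Rightarrow> real" where "sqn x = (fst x)\<^sup>2 + (snd x)\<^sup>2"

lemma sqn_norm: "sqn x = (norm x)\<^sup>2"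
  by (cases x) (simp add: sqn_def norm_Pair)

lemma sqn_nonneg [simp]: "0 \<le> sqn x" by (simp add: sqn_def)

lemma sqn_pos: "x \<noteq> 0 \<Longrightarrow> 0 < sqn x" by (simp add: sqn_norm)

lemma continuous_on_sqn [continuous_intros]: "continuous_on S sqn"
  unfolding sqn_def[abs_def] by (intro continuous_intros)

lemma C1_on_sqn: "C1_on S sqn (\<lambda>x. 2 * fst x) (\<lambda>x. 2 * snd x)"
  unfolding C1_on_def sqn_def[abs_def]
  by (auto intro!: continuous_intros derivative_eq_intros)

lemma C1_on_radial:
  assumes "\<And>s. s \<in> sqn ` S \<Longrightarrow> (g has_real_derivative g' s) (at s)" "continuous_on (sqn ` S) g'"
  shows "C1_on S (\<lambda>x. g (sqn x)) (\<lambda>x. g' (sqn x) * (2 * fst x)) (\<lambda>x. g' (sqn x) * (2 * snd x))"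
  by (rule C1_on_compose[OF C1_on_sqn])
    (use assms in \<open>auto intro: continuous_on_compose2[OF assms(2) continuous_on_sqn]\<close>)

section \<open>Compactly supported functions and integration by parts\<close>

lemma C1_on_zero_derivative:
  assumes "C1_on UNIV f f1 f2" "open U" "\<And>x. x \<in> U \<Longrightarrow> f x = 0" "x \<in> U"
  shows "f1 x = 0 \<and> f2 x = 0"
proof -
  have "(f has_derivative (\<lambda>h. f1 x * fst h + f2 x * snd h)) (at x)"
    using assms(1) unfolding C1_on_def by blast
  moreover have "(f has_derivative (\<lambda>h. 0)) (at x)"
    by (rule has_derivative_transform_within_open[OF _ assms(2,4), of "\<lambda>x. 0"]) (use assms in auto)
  ultimately have "(\<lambda>h. f1 x * fst h + f2 x * snd h) = (\<lambda>h. 0)" by (rule has_derivative_unique)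
  from fun_cong[OF this, of "(1, 0)"] fun_cong[OF this, of "(0, 1)"] show ?thesis by simp
qed

lemma Cc1_support:
  assumes "Cc1 \<Omega> \<phi> d1 d2"
  shows "\<exists>K. compact K \<and> K \<subseteq> \<Omega> \<and> (\<forall>x. x \<notin> K \<longrightarrow> \<phi> x = 0 \<and> d1 x = 0 \<and> d2 x = 0)"
proof -
  obtain K where K: "compact K" "K \<subseteq> \<Omega>" "\<And>x. x \<notin> K \<Longrightarrow> \<phi> x = 0" and C: "C1_on UNIV \<phi> d1 d2"
    using assms unfolding Cc1_iff by blast
  have "open (- K)" using K(1) by (simp add: compact_imp_closed open_Compl)
  then show ?thesis using C1_on_zero_derivative[OF C, of "- K"] K by blast
qed

lemma Cc1_mono: "Cc1 S \<phi> d1 d2 \<Longrightarrow> S \<subseteq> T \<Longrightarrow> Cc1 T \<phi> d1 d2"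
  unfolding Cc1_def by blast

lemma Cc1_C1_on: "Cc1 S \<phi> d1 d2 \<Longrightarrow> C1_on T \<phi> d1 d2"
  by (auto simp: Cc1_iff intro: C1_on_subset)

lemma Cc1_continuous:
  assumes "Cc1 S \<phi> d1 d2"
  shows "continuous_on T \<phi>" "continuous_on T d1" "continuous_on T d2"
  using Cc1_C1_on[OF assms, of T] C1_on_continuous[OF Cc1_C1_on[OF assms, of T]]
  by (simp_all add: C1_on_def)

text \<open>\<open>S\<close> and the complement of \<open>K\<close> form an open cover of the plane;
  on the second set everything is zero, so regularity on \<open>S\<close> is enough.\<close>

lemma Cc1_glue:
  assumes S: "open S" and K: "compact K" "K \<subseteq> S" and f: "C1_on S f f1 f2"
    and 0: "\<And>x. x \<notin> K \<Longrightarrow> f x = 0" "\<And>x. x \<notin> K \<Longrightarrow> f1 x = 0" "\<And>x. x \<notin> K \<Longrightarrow> f2 x = 0"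
  shows "Cc1 S f f1 f2"
proof -
  have K': "open (- K)" using K(1) by (simp add: compact_imp_closed open_Compl)
  have U: "S \<union> - K = UNIV" using K(2) by auto
  have c: "continuous_on UNIV g" if "continuous_on S g" "\<And>x. x \<notin> K \<Longrightarrow> g x = 0" for g :: plane_fun
    using continuous_on_open_Un[OF S K' that(1)] continuous_on_cong[of "- K" "- K" g "\<lambda>x. 0"] that(2)
    by (simp add: U)
  have "(f has_derivative (\<lambda>h. f1 x * fst h + f2 x * snd h)) (at x)" for x
  proof (cases "x \<in> S")
    case False
    then have x: "x \<in> - K" using K by auto
    have "(f has_derivative (\<lambda>h. 0)) (at x)"
      by (rule has_derivative_transform_within_open[OF _ K' x, of "\<lambda>x. 0"]) (use 0 in auto)
    then show ?thesis using x 0 by simp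
  qed (use f in \<open>auto simp: C1_on_def\<close>)
  then show ?thesis
    unfolding Cc1_def using c f 0 K by (auto simp: C1_on_def)
qed

lemma Cc1_mult:
  assumes S: "open S" and \<phi>: "Cc1 S \<phi> d1 d2" and m: "C1_on S m m1 m2"
  shows "Cc1 S (\<lambda>x. \<phi> x * m x) (\<lambda>x. d1 x * m x + \<phi> x * m1 x) (\<lambda>x. d2 x * m x + \<phi> x * m2 x)"
proof -
  obtain K where K: "compact K" "K \<subseteq> S" "\<And>x. x \<notin> K \<Longrightarrow> \<phi> x = 0"
    "\<And>x. x \<notin> K \<Longrightarrow> d1 x = 0" "\<And>x. x \<notin> K \<Longrightarrow> d2 x = 0" using Cc1_support[OF \<phi>] by blast
  show ?thesis
    by (rule Cc1_glue[OF S K(1,2) C1_on_mult[OF Cc1_C1_on[OF \<phi>] m]]) (auto simp: K)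
qed

lemma integrable_compact_support:
  fixes f :: "'a::euclidean_space \<Rightarrow> real"
  assumes "continuous_on UNIV f" "compact K" "\<And>x. x \<notin> K \<Longrightarrow> f x = 0"
  shows "integrable lborel f"
proof -
  have "integrable lborel (\<lambda>x. indicator K x *\<^sub>R f x)"
    by (rule borel_integrable_compact[OF assms(2) continuous_on_subset[OF assms(1)]]) auto
  then show ?thesis
    by (rule Bochner_Integration.integrable_cong[THEN iffD1, rotated 2])
      (use assms(3) in \<open>auto simp: indicator_def\<close>)
qed

lemma Cc1_integrable:
  assumes "Cc1 S \<phi> d1 d2"
  shows "integrable lborel \<phi>" "integrable lborel d1" "integrable lborel d2"
proof -
  obtain K where K: "compact K" "\<And>x. x \<notin> K \<Longrightarrow> \<phi> x = 0"
    "\<And>x. x \<notin> K \<Longrightarrow> d1 x = 0" "\<And>x. x \<notin> K \<Longrightarrow> d2 x = 0" using Cc1_support[OF assms] by blast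
  note c = Cc1_continuous[OF assms, of UNIV]
  show "integrable lborel \<phi>" by (rule integrable_compact_support[OF c(1) K(1,2)])
  show "integrable lborel d1" by (rule integrable_compact_support[OF c(2) K(1,3)])
  show "integrable lborel d2" by (rule integrable_compact_support[OF c(3) K(1,4)])
qed

lemma integral_deriv_eq_0:
  fixes F f :: "real \<Rightarrow> real"
  assumes F: "\<And>x. (F has_real_derivative f x) (at x)" and f: "continuous_on UNIV f"
    and 0: "\<And>x. \<bar>x\<bar> \<ge> B \<Longrightarrow> F x = 0" "\<And>x. \<bar>x\<bar> \<ge> B \<Longrightarrow> f x = 0" and B: "B > 0"
  shows "(LINT x|lborel. f x) = 0"
proof -
  have "(LINT x|lborel. f x) = (LINT x|lborel. f x * indicator {-B..B} x)"
  proof (rule Bochner_Integration.integral_cong)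
    show "f x = f x * indicator {-B..B} x" for x
      using 0(2)[of x] by (cases "\<bar>x\<bar> \<ge> B") (auto simp: indicator_def)
  qed simp
  also have "\<dots> = F B - F (-B)"
    by (rule integral_FTC_Icc_real) (use B F f in \<open>auto simp: continuous_on_eq_continuous_at\<close>)
  also have "\<dots> = 0" using 0 B by simp
  finally show ?thesis .
qed

text \<open>Fubini and the fundamental theorem of calculus on each coordinate line: the divergence
  theorem for compact support, and the source of every integration by parts below.\<close>

lemma Cc1_integral_eq_0:
  assumes "Cc1 S \<phi> d1 d2"
  shows "(LINT x|lborel. d1 x) = 0" "(LINT x|lborel. d2 x) = 0"
proof -
  obtain K where K: "compact K" "\<And>x. x \<notin> K \<Longrightarrow> \<phi> x = 0"
    "\<And>x. x \<notin> K \<Longrightarrow> d1 x = 0" "\<And>x. x \<notin> K \<Longrightarrow> d2 x = 0" using Cc1_support[OF assms] by blast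
  obtain B where B: "B > 0" "\<And>x. x \<in> K \<Longrightarrow> norm x < B"
    using K(1) compact_imp_bounded bounded_pos_less by metis
  have nK: "(x, y) \<notin> K" if "\<bar>x\<bar> \<ge> B \<or> \<bar>y\<bar> \<ge> B" for x y
    using B(2)[of "(x, y)"] norm_fst_le[of x y] norm_snd_le[of y x] that by fastforce
  have der: "(\<phi> has_derivative (\<lambda>h. d1 x * fst h + d2 x * snd h)) (at x)" for x
    using assms unfolding Cc1_def by blast
  have dx: "((\<lambda>x. \<phi> (x, y)) has_real_derivative d1 (x, y)) (at x)" for x y
    unfolding has_field_derivative_def
    by (rule has_derivative_eq_rhs[OF has_derivative_compose[OF _ der]])
      (auto intro!: derivative_eq_intros)
  have dy: "((\<lambda>y. \<phi> (x, y)) has_real_derivative d2 (x, y)) (at y)" for x y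
    unfolding has_field_derivative_def
    by (rule has_derivative_eq_rhs[OF has_derivative_compose[OF _ der]])
      (auto intro!: derivative_eq_intros)
  have 1: "(LINT x|lborel. d1 (x, y)) = 0" for y
    by (rule integral_deriv_eq_0[OF dx _ _ _ B(1)])
      (use nK K in \<open>auto intro!: continuous_on_compose2[OF Cc1_continuous(2)[OF assms, of UNIV]] continuous_intros\<close>)
  have 2: "(LINT y|lborel. d2 (x, y)) = 0" for x
    by (rule integral_deriv_eq_0[OF dy _ _ _ B(1)])
      (use nK K in \<open>auto intro!: continuous_on_compose2[OF Cc1_continuous(3)[OF assms, of UNIV]] continuous_intros\<close>)
  have i1: "integrable (lborel \<Otimes>\<^sub>M lborel) (\<lambda>(x, y). d1 (x, y))"
    and i2: "integrable (lborel \<Otimes>\<^sub>M lborel) (\<lambda>(x, y). d2 (x, y))"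
    using Cc1_integrable[OF assms] by (simp_all add: lborel_prod)
  show "(LINT x|lborel. d1 x) = 0"
    using lborel_pair.integral_snd[OF i1] by (simp add: 1 lborel_prod)
  show "(LINT x|lborel. d2 x) = 0"
    using lborel_pair.integral_fst[OF i2] by (simp add: 2 lborel_prod)
qed

text \<open>The ground state method: expand
  \<open>0 \<le> W \<bar>\<nabla>\<phi> - (A - \<nabla>W/2) \<phi> / W\<bar>\<^sup>2\<close> and integrate \<open>A \<cdot> \<nabla>(\<phi>\<^sup>2)\<close> by parts.\<close>

lemma ground_state_inequality:
  assumes S: "open S" and \<phi>: "Cc1 S \<phi> d1 d2"
    and W: "C1_on UNIV W W1 W2" "\<And>x. 0 < W x"
    and A: "C1_on S A A1 A2" and B: "C1_on S B B1 B2"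
    and P: "continuous_on UNIV P"
      "\<And>x. x \<in> S \<Longrightarrow> P x \<le> - (A1 x + B2 x) - ((A x - W1 x / 2)\<^sup>2 + (B x - W2 x / 2)\<^sup>2) / W x"
  shows "(LINT x|lborel. P x * (\<phi> x)\<^sup>2)
    \<le> (LINT x|lborel. d1 x * (d1 x * W x + \<phi> x * W1 x) + d2 x * (d2 x * W x + \<phi> x * W2 x))"
proof -
  obtain K where K: "compact K" "K \<subseteq> S" "\<And>x. x \<notin> K \<Longrightarrow> \<phi> x = 0"
    "\<And>x. x \<notin> K \<Longrightarrow> d1 x = 0" "\<And>x. x \<notin> K \<Longrightarrow> d2 x = 0" using Cc1_support[OF \<phi>] by blast
  note c = Cc1_continuous[OF \<phi>, of UNIV]
  have \<phi>2: "Cc1 S (\<lambda>x. \<phi> x * \<phi> x) (\<lambda>x. d1 x * \<phi> x + \<phi> x * d1 x) (\<lambda>x. d2 x * \<phi> x + \<phi> x * d2 x)"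
    by (rule Cc1_mult[OF S \<phi> Cc1_C1_on[OF \<phi>]])
  note a = Cc1_mult[OF S \<phi>2 A] and b = Cc1_mult[OF S \<phi>2 B]
  have cW: "continuous_on UNIV W" "continuous_on UNIV W1" "continuous_on UNIV W2"
    using W(1) C1_on_continuous[OF W(1)] by (simp_all add: C1_on_def)
  let ?R = "\<lambda>x. d1 x * (d1 x * W x + \<phi> x * W1 x) + d2 x * (d2 x * W x + \<phi> x * W2 x)"
  let ?a = "\<lambda>x. (d1 x * \<phi> x + \<phi> x * d1 x) * A x + \<phi> x * \<phi> x * A1 x"
  let ?b = "\<lambda>x. (d2 x * \<phi> x + \<phi> x * d2 x) * B x + \<phi> x * \<phi> x * B2 x"
  have ia: "integrable lborel ?a" and ib: "integrable lborel ?b"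
    using Cc1_integrable[OF a] Cc1_integrable[OF b] by auto
  have iR: "integrable lborel ?R"
    by (rule integrable_compact_support[OF _ K(1)])
      (use K in \<open>auto intro!: continuous_intros c cW\<close>)
  have iP: "integrable lborel (\<lambda>x. P x * (\<phi> x)\<^sup>2)"
    by (rule integrable_compact_support[OF _ K(1)])
      (use K in \<open>auto intro!: continuous_intros c P\<close>)
  have "(LINT x|lborel. P x * (\<phi> x)\<^sup>2) + (LINT x|lborel. ?a x + ?b x) \<le> (LINT x|lborel. ?R x)"
    unfolding Bochner_Integration.integral_add[OF iP Bochner_Integration.integrable_add[OF ia ib], symmetric]
  proof (rule integral_mono)
    fix x
    show "P x * (\<phi> x)\<^sup>2 + (?a x + ?b x) \<le> ?R x"
    proof (cases "x \<in> S")
      case True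
      let ?X = "A x - W1 x / 2" and ?Y = "B x - W2 x / 2"
      have "P x * (\<phi> x)\<^sup>2 \<le> (- (A1 x + B2 x) - (?X\<^sup>2 + ?Y\<^sup>2) / W x) * (\<phi> x)\<^sup>2"
        by (rule mult_right_mono[OF P(2)[OF True]]) simp
      moreover have "0 \<le> ((W x * d1 x - ?X * \<phi> x)\<^sup>2 + (W x * d2 x - ?Y * \<phi> x)\<^sup>2) / W x"
        using W(2)[of x] by simp
      moreover have "((W x * d1 x - ?X * \<phi> x)\<^sup>2 + (W x * d2 x - ?Y * \<phi> x)\<^sup>2) / W x
        = W x * ((d1 x)\<^sup>2 + (d2 x)\<^sup>2) - 2 * \<phi> x * (d1 x * ?X + d2 x * ?Y) + (?X\<^sup>2 + ?Y\<^sup>2) / W x * (\<phi> x)\<^sup>2"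
      proof -
        have "((w * p - X * f)\<^sup>2 + (w * q - Y * f)\<^sup>2) / w
          = w * (p\<^sup>2 + q\<^sup>2) - 2 * f * (p * X + q * Y) + (X\<^sup>2 + Y\<^sup>2) / w * f\<^sup>2"
          if "w \<noteq> 0" for w p q X Y f :: real
          using that by (simp add: power2_eq_square field_simps)
        then show ?thesis using W(2)[of x] by (metis less_irrefl)
      qed
      ultimately show ?thesis by (simp add: power2_eq_square algebra_simps)
    next
      case False
      then have "x \<notin> K" using K(2) by blast
      then show ?thesis by (simp add: K)
    qed
  qed (use ia ib iP iR in auto)
  moreover have "(LINT x|lborel. ?a x + ?b x) = 0"
    using Cc1_integral_eq_0(1)[OF a] Cc1_integral_eq_0(2)[OF b]
      Bochner_Integration.integral_add[OF ia ib] by simp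
  ultimately show ?thesis by simp
qed

section \<open>Multiplication operators\<close>

declare split_paired_All [simp del] split_paired_Ex [simp del]

definition mul :: "plane_fun \<Rightarrow> l2 \<Rightarrow> l2" where
  "mul m v = cls (\<lambda>x. m x * rep v x)"

definition bounded_by :: "real \<Rightarrow> plane_fun \<Rightarrow> bool" where
  "bounded_by B m \<longleftrightarrow> m \<in> borel_measurable lborel \<and> (\<forall>x. \<bar>m x\<bar> \<le> B)"

lemma bounded_by_measurable: "bounded_by B m \<Longrightarrow> m \<in> borel_measurable lborel"
  by (simp add: bounded_by_def)

lemma bounded_by_nonneg: "bounded_by B m \<Longrightarrow> 0 \<le> B"
  unfolding bounded_by_def using abs_ge_zero order_trans by blast

lemma bounded_by_diff:
  assumes "bounded_by B m" "bounded_by C n"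
  shows "bounded_by (B + C) (\<lambda>x. m x - n x)"
proof -
  have "\<bar>m x - n x\<bar> \<le> B + C" for x
    using assms abs_triangle_ineq4[of "m x" "n x"] add_mono[of "\<bar>m x\<bar>" B "\<bar>n x\<bar>" C]
    unfolding bounded_by_def by (meson order_trans)
  then show ?thesis using assms unfolding bounded_by_def by (blast intro: borel_measurable_diff)
qed

lemma bounded_by_scale:
  assumes "bounded_by B m"
  shows "bounded_by (\<bar>c\<bar> * B) (\<lambda>x. c * m x)"
  using assms unfolding bounded_by_def
  by (auto simp: abs_mult mult_left_mono intro: borel_measurable_times)

lemma square_integrable_bounded_mult:
  assumes m: "bounded_by B m" and f: "square_integrable f"
  shows "square_integrable (\<lambda>x. m x * f x)"
proof (rule square_integrable_bound[OF square_integrable_scale[OF f, of B]])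
  show "(\<lambda>x. m x * f x) \<in> borel_measurable lborel"
    using m f by (auto simp: bounded_by_def square_integrable_def)
  show "AE x in lborel. \<bar>m x * f x\<bar> \<le> \<bar>B * f x\<bar>"
    using m by (auto simp: abs_mult bounded_by_def bounded_by_nonneg[OF m] intro!: mult_right_mono)
qed

lemma mul_cls:
  assumes m: "bounded_by B m" and f: "square_integrable f"
  shows "mul m (cls f) = cls (\<lambda>x. m x * f x)"
  unfolding mul_def
proof (rule cls_cong)
  show "square_integrable (\<lambda>x. m x * rep (cls f) x)"
    by (rule square_integrable_bounded_mult[OF m square_integrable_rep])
  show "(\<lambda>x. m x * f x) \<in> borel_measurable lborel"
    by (rule square_integrable_measurable[OF square_integrable_bounded_mult[OF m f]])
  show "AE x in lborel. m x * rep (cls f) x = m x * f x"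
    using rep_cls[OF f] by auto
qed

lemma norm_mul_le:
  assumes m: "bounded_by B m"
  shows "norm (mul m v) \<le> B * norm v"
proof -
  have "norm (mul m v) \<le> norm (cls (\<lambda>x. B * rep v x))"
    unfolding mul_def
  proof (rule norm_cls_mono)
    show "(\<lambda>x. m x * rep v x) \<in> borel_measurable lborel"
      using square_integrable_bounded_mult[OF m square_integrable_rep] square_integrable_measurable by blast
    show "AE x in lborel. \<bar>m x * rep v x\<bar> \<le> \<bar>B * rep v x\<bar>"
      using m by (auto simp: abs_mult bounded_by_def bounded_by_nonneg[OF m] intro!: mult_right_mono)
  qed (intro square_integrable_scale square_integrable_rep)
  also have "\<dots> = B * norm v"
    using bounded_by_nonneg[OF m] by (simp flip: cls_scale[OF square_integrable_rep])
  finally show ?thesis .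
qed

lemma mul_scale_left:
  assumes "bounded_by B m"
  shows "mul (\<lambda>x. c * m x) v = c *\<^sub>R mul m v"
  unfolding mul_def using assms
  by (subst cls_scale) (auto simp: algebra_simps intro!: square_integrable_bounded_mult square_integrable_rep)

lemma mul_diff_left:
  assumes "bounded_by B m" "bounded_by C n"
  shows "mul (\<lambda>x. m x - n x) v = mul m v - mul n v"
  unfolding mul_def using assms
  by (subst cls_diff) (auto simp: algebra_simps intro!: square_integrable_bounded_mult square_integrable_rep)

lemma mul_add_right:
  assumes m: "bounded_by B m"
  shows "mul m (u + v) = mul m u + mul m v"
proof -
  have "mul m (cls (rep u) + cls (rep v)) = mul m (cls (rep u)) + mul m (cls (rep v))"
    by (simp only: cls_add square_integrable_rep mul_cls[OF m] square_integrable_add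
        square_integrable_bounded_mult[OF m] distrib_left)
  then show ?thesis by simp
qed

lemma mul_scale_right:
  assumes m: "bounded_by B m"
  shows "mul m (c *\<^sub>R v) = c *\<^sub>R mul m v"
proof -
  have "mul m (c *\<^sub>R cls (rep v)) = c *\<^sub>R mul m (cls (rep v))"
    by (simp only: cls_scale square_integrable_rep mul_cls[OF m] square_integrable_scale
        square_integrable_bounded_mult[OF m] mult.left_commute)
  then show ?thesis by simp
qed

lemma bounded_linear_mul: "bounded_by B m \<Longrightarrow> bounded_linear (mul m)"
  by (rule bounded_linear_intro[of _ B])
    (auto simp: mul_add_right mul_scale_right mult.commute norm_mul_le)

lemma inner_mul_left:
  "bounded_by B m \<Longrightarrow> inner (mul m u) v = (LINT x|lborel. m x * rep u x * rep v x)"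
  using inner_cls[OF square_integrable_bounded_mult[OF _ square_integrable_rep] square_integrable_rep, of B m u v]
  by (simp add: mul_def)

lemma inner_mul_commute: "bounded_by B m \<Longrightarrow> inner (mul m u) v = inner u (mul m v)"
  by (simp add: inner_mul_left inner_commute[of u] algebra_simps)

lemma integrable_bounded_mult3:
  assumes "bounded_by B m" "square_integrable f" "square_integrable g"
  shows "integrable lborel (\<lambda>x. m x * f x * g x)"
  using square_integrable_mult[OF square_integrable_bounded_mult[OF assms(1,2)] assms(3)] .

lemma inner_mul_mono:
  assumes "bounded_by B m" "bounded_by C n" "\<And>x. m x \<le> n x"
  shows "inner (mul m u) u \<le> inner (mul n u) u"
proof -
  have "(LINT x|lborel. m x * rep u x * rep u x) \<le> (LINT x|lborel. n x * rep u x * rep u x)"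
    by (intro integral_mono integrable_bounded_mult3[OF assms(1)] integrable_bounded_mult3[OF assms(2)]
        square_integrable_rep)
      (use assms(3) in \<open>simp add: mult_right_mono mult.assoc\<close>)
  then show ?thesis by (simp add: inner_mul_left[OF assms(1)] inner_mul_left[OF assms(2)])
qed

text \<open>Multiplication by a time-dependent function is differentiable in operator norm as soon as the
  difference quotients converge uniformly.\<close>

lemma mul_has_vector_derivative:
  assumes m: "\<And>s. s \<in> T \<Longrightarrow> bounded_by B (m s)" and m': "bounded_by C m'" and T: "open T" "t \<in> T"
    and unif: "\<And>e. e > 0 \<Longrightarrow> \<exists>d>0. \<forall>s\<in>T. \<bar>s - t\<bar> < d \<longrightarrow>
        (\<forall>x. \<bar>m s x - m t x - (s - t) * m' x\<bar> \<le> e * \<bar>s - t\<bar>)"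
    and U: "(U has_vector_derivative U') (at t)"
  shows "((\<lambda>s. mul (m s) (U s)) has_vector_derivative mul (m t) U' + mul m' (U t)) (at t)"
proof -
  \<comment> \<open>Viewing multiplication as an element of the space of bounded operators reduces
    the claim to the product rule for the bilinear evaluation of an operator at a vector.\<close>
  let ?M = "\<lambda>s. Blinfun (mul (m s))"
  have app: "blinfun_apply (?M s) v = mul (m s) v" if "s \<in> T" for s v
    using bounded_linear_Blinfun_apply[OF bounded_linear_mul[OF m[OF that]]] by metis
  have app': "blinfun_apply (Blinfun (mul m')) v = mul m' v" for v
    using bounded_linear_Blinfun_apply[OF bounded_linear_mul[OF m']] by metis
  have "(?M has_vector_derivative Blinfun (mul m')) (at t)"
    unfolding has_vector_derivative_def has_derivative_at_alt
  proof (intro conjI bounded_linear_intros allI impI)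
    fix e :: real assume e: "e > 0"
    from unif[OF e] obtain d where "d > 0" and d': "\<forall>s\<in>T. \<bar>s - t\<bar> < d \<longrightarrow>
        (\<forall>x. \<bar>m s x - m t x - (s - t) * m' x\<bar> \<le> e * \<bar>s - t\<bar>)" by (elim exE conjE)
    have d: "d > 0" "\<And>s x. s \<in> T \<Longrightarrow> \<bar>s - t\<bar> < d \<Longrightarrow>
        \<bar>m s x - m t x - (s - t) * m' x\<bar> \<le> e * \<bar>s - t\<bar>"
      using \<open>d > 0\<close> d' by simp_all
    obtain r where r: "r > 0" "ball t r \<subseteq> T" using T openE by blast
    have "norm (?M y - ?M t - (y - t) *\<^sub>R Blinfun (mul m')) \<le> e * norm (y - t)"
      if y: "norm (y - t) < min d r" for y
    proof (rule norm_blinfun_bound)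
      show "0 \<le> e * norm (y - t)" using e by simp
      fix v
      have yT: "y \<in> T" using y r(2) by (auto simp: subset_iff dist_real_def)
      note 1 = bounded_by_diff[OF m[OF yT] m[OF T(2)]]
      note 2 = bounded_by_scale[OF m', of "y - t"]
      have 3: "bounded_by (e * \<bar>y - t\<bar>) (\<lambda>x. m y x - m t x - (y - t) * m' x)"
        using d(2)[OF yT] y bounded_by_measurable[OF bounded_by_diff[OF 1 2]]
        unfolding bounded_by_def by simp
      have "mul (\<lambda>x. m y x - m t x - (y - t) * m' x) v = mul (m y) v - mul (m t) v - (y - t) *\<^sub>R mul m' v"
        by (simp only: mul_diff_left[OF 1 2] mul_diff_left[OF m[OF yT] m[OF T(2)]] mul_scale_left[OF m'])
      then show "norm (blinfun_apply (?M y - ?M t - (y - t) *\<^sub>R Blinfun (mul m')) v) \<le> e * norm (y - t) * norm v"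
        using norm_mul_le[OF 3, of v]
        by (simp add: blinfun.diff_left blinfun.scaleR_left app yT T(2) app')
    qed
    then show "\<exists>d>0. \<forall>y. norm (y - t) < d \<longrightarrow>
        norm (?M y - ?M t - (y - t) *\<^sub>R Blinfun (mul m')) \<le> e * norm (y - t)"
      using d(1) r(1) by (intro exI[of _ "min d r"]) auto
  qed
  from bounded_bilinear.has_vector_derivative[OF bounded_bilinear_blinfun_apply this U]
  have "((\<lambda>s. blinfun_apply (?M s) (U s)) has_vector_derivative mul (m t) U' + mul m' (U t)) (at t)"
    by (simp add: app[OF T(2)] app')
  then show ?thesis
    by (rule has_vector_derivative_transform_within_open[OF _ T]) (simp add: app)
qed

text \<open>Mean value inequality for \<open>\<lambda>r. b r y - r * n t y\<close> on the segment
  from t to s; its derivative \<open>n r y - n t y\<close> is small uniformly in y by uniform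
  continuity on a compact product.\<close>

lemma uniform_difference_quotient:
  fixes b n :: "real \<Rightarrow> 'y::metric_space \<Rightarrow> real"
  assumes Y: "compact Y" and n: "continuous_on ({p..q} \<times> Y) (\<lambda>(s, y). n s y)"
    and der: "\<And>s y. s \<in> {p..q} \<Longrightarrow> y \<in> Y \<Longrightarrow> ((\<lambda>s. b s y) has_real_derivative n s y) (at s within {p..q})"
    and t: "t \<in> {p..q}" and e: "e > 0"
  shows "\<exists>d>0. \<forall>s\<in>{p..q}. \<bar>s - t\<bar> < d \<longrightarrow> (\<forall>y\<in>Y. \<bar>b s y - b t y - (s - t) * n t y\<bar> \<le> e * \<bar>s - t\<bar>)"
proof -
  have "uniformly_continuous_on ({p..q} \<times> Y) (\<lambda>(s, y). n s y)"
    by (intro compact_uniformly_continuous n compact_Times Y compact_Icc)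
  then obtain d where d: "d > 0" "\<And>z z'. z \<in> {p..q} \<times> Y \<Longrightarrow> z' \<in> {p..q} \<times> Y \<Longrightarrow> dist z' z < d \<Longrightarrow>
      dist ((\<lambda>(s, y). n s y) z') ((\<lambda>(s, y). n s y) z) < e"
    unfolding uniformly_continuous_on_def using e by metis
  have "\<bar>b s y - b t y - (s - t) * n t y\<bar> \<le> e * \<bar>s - t\<bar>"
    if s: "s \<in> {p..q}" "\<bar>s - t\<bar> < d" and y: "y \<in> Y" for s y
  proof -
    let ?I = "closed_segment t s"
    have I: "?I \<subseteq> {p..q}" using s(1) t by (auto simp: closed_segment_eq_real_ivl split: if_splits)
    have "norm ((b s y - s * n t y) - (b t y - t * n t y)) \<le> e * norm (s - t)"
    proof (rule field_differentiable_bound[of ?I "\<lambda>r. b r y - r * n t y" "\<lambda>r. n r y - n t y"])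
      fix r assume r: "r \<in> ?I"
      show "((\<lambda>r. b r y - r * n t y) has_field_derivative n r y - n t y) (at r within ?I)"
        using DERIV_subset[OF der[OF _ y] I] r I by (auto intro!: derivative_eq_intros)
      have "\<bar>r - t\<bar> \<le> \<bar>s - t\<bar>" using r by (auto simp: closed_segment_eq_real_ivl split: if_splits)
      then show "norm (n r y - n t y) \<le> e"
        using d(2)[of "(t, y)" "(r, y)"] r I t s y
        by (auto simp: dist_Pair_Pair dist_real_def subset_iff)
    qed auto
    then show ?thesis by (simp add: algebra_simps)
  qed
  with d(1) show ?thesis by blast
qed

section \<open>The Dirichlet form\<close>

text \<open>Extension by zero, an isometric embedding of L^2(\<Omega>) into \<open>l2\<close>;
  through it integrals over \<Omega> become inner products.\<close>

definition clsO :: "(real \<times> real) set \<Rightarrow> plane_fun \<Rightarrow> l2" where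
  "clsO \<Omega> u = cls (\<lambda>x. indicator \<Omega> x * u x)"

lemma L2_iff:
  assumes "open \<Omega>"
  shows "u \<in> L2 \<Omega> \<longleftrightarrow> u \<in> borel_measurable lborel \<and> square_integrable (\<lambda>x. indicator \<Omega> x * u x)"
proof -
  have "(\<lambda>x. (indicator \<Omega> x * u x)\<^sup>2) = (\<lambda>x. indicator \<Omega> x * (u x)\<^sup>2)"
    by (auto simp: indicator_def)
  moreover have "(\<lambda>x. indicator \<Omega> x * u x) \<in> borel_measurable lborel" if "u \<in> borel_measurable lborel"
    using that assms by (intro borel_measurable_times borel_measurable_indicator) auto
  ultimately show ?thesis by (auto simp: L2_def square_integrable_def set_integrable_def)
qed

lemma bounded_by_indicator: "open \<Omega> \<Longrightarrow> bounded_by 1 (indicator \<Omega>)"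
  unfolding bounded_by_def by (intro conjI allI borel_measurable_indicator) (auto simp: indicator_def)

lemma square_integrable_L2:
  assumes "open \<Omega>" "square_integrable f"
  shows "f \<in> L2 \<Omega>"
  unfolding L2_iff[OF assms(1)]
proof
  show "square_integrable (\<lambda>x. indicator \<Omega> x * f x)"
    by (rule square_integrable_bounded_mult[OF bounded_by_indicator[OF assms(1)] assms(2)])
qed (rule square_integrable_measurable[OF assms(2)])

lemma L2_norm_eq: "open \<Omega> \<Longrightarrow> u \<in> L2 \<Omega> \<Longrightarrow> L2_norm \<Omega> u = norm (clsO \<Omega> u)"
proof -
  assume "open \<Omega>" "u \<in> L2 \<Omega>"
  moreover have "(\<lambda>x. (indicator \<Omega> x * u x)\<^sup>2) = (\<lambda>x. indicator \<Omega> x * (u x)\<^sup>2)"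
    by (auto simp: indicator_def)
  ultimately show ?thesis
    by (simp add: L2_iff clsO_def norm_cls L2_norm_def set_lebesgue_integral_def)
qed

lemma L2_diff: "open \<Omega> \<Longrightarrow> u \<in> L2 \<Omega> \<Longrightarrow> v \<in> L2 \<Omega> \<Longrightarrow> (\<lambda>x. u x - v x) \<in> L2 \<Omega>"
  using square_integrable_diff by (auto simp: L2_iff right_diff_distrib)

lemma L2_add: "open \<Omega> \<Longrightarrow> u \<in> L2 \<Omega> \<Longrightarrow> v \<in> L2 \<Omega> \<Longrightarrow> (\<lambda>x. u x + v x) \<in> L2 \<Omega>"
  using square_integrable_add by (auto simp: L2_iff distrib_left)

lemma L2_scale: "open \<Omega> \<Longrightarrow> u \<in> L2 \<Omega> \<Longrightarrow> (\<lambda>x. c * u x) \<in> L2 \<Omega>"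
  using square_integrable_scale[of _ c] by (fastforce simp: L2_iff mult.left_commute)

lemma clsO_diff: "open \<Omega> \<Longrightarrow> u \<in> L2 \<Omega> \<Longrightarrow> v \<in> L2 \<Omega> \<Longrightarrow> clsO \<Omega> (\<lambda>x. u x - v x) = clsO \<Omega> u - clsO \<Omega> v"
  by (simp add: clsO_def L2_iff cls_diff right_diff_distrib)

lemma clsO_add: "open \<Omega> \<Longrightarrow> u \<in> L2 \<Omega> \<Longrightarrow> v \<in> L2 \<Omega> \<Longrightarrow> clsO \<Omega> (\<lambda>x. u x + v x) = clsO \<Omega> u + clsO \<Omega> v"
  by (simp add: clsO_def L2_iff cls_add distrib_left)

lemma clsO_scale: "open \<Omega> \<Longrightarrow> u \<in> L2 \<Omega> \<Longrightarrow> clsO \<Omega> (\<lambda>x. c * u x) = c *\<^sub>R clsO \<Omega> u"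
  by (simp add: clsO_def L2_iff cls_scale mult.left_commute)

lemma set_integral_eq_inner:
  assumes "open \<Omega>" "u \<in> L2 \<Omega>" "v \<in> L2 \<Omega>"
  shows "set_integrable lborel \<Omega> (\<lambda>x. u x * v x)" "(LINT x:\<Omega>|lborel. u x * v x) = inner (clsO \<Omega> u) (clsO \<Omega> v)"
proof -
  have eq: "(\<lambda>x. (indicator \<Omega> x * u x) * (indicator \<Omega> x * v x)) = (\<lambda>x. indicator \<Omega> x *\<^sub>R (u x * v x))"
    by (auto simp: indicator_def)
  have s: "square_integrable (\<lambda>x. indicator \<Omega> x * u x)" "square_integrable (\<lambda>x. indicator \<Omega> x * v x)"
    using assms by (auto simp: L2_iff)
  show "set_integrable lborel \<Omega> (\<lambda>x. u x * v x)"
    using square_integrable_mult[OF s] by (simp add: set_integrable_def eq)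
  show "(LINT x:\<Omega>|lborel. u x * v x) = inner (clsO \<Omega> u) (clsO \<Omega> v)"
    unfolding clsO_def by (subst inner_cls[OF s]) (simp add: set_lebesgue_integral_def eq)
qed

lemma Cc1_square_integrable:
  assumes "Cc1 S \<phi> d1 d2"
  shows "square_integrable \<phi>" "square_integrable d1" "square_integrable d2"
proof -
  obtain K where K: "compact K" "\<And>x. x \<notin> K \<Longrightarrow> \<phi> x = 0"
    "\<And>x. x \<notin> K \<Longrightarrow> d1 x = 0" "\<And>x. x \<notin> K \<Longrightarrow> d2 x = 0" using Cc1_support[OF assms] by blast
  have "square_integrable f" if "continuous_on UNIV f" "\<And>x. x \<notin> K \<Longrightarrow> f x = 0" for f
    unfolding square_integrable_def
    by (intro conjI integrable_compact_support[OF _ K(1)])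
      (use that in \<open>auto intro!: continuous_intros borel_measurable_continuous_onI\<close>)
  then show "square_integrable \<phi>" "square_integrable d1" "square_integrable d2"
    using Cc1_continuous[OF assms, of UNIV] K by blast+
qed

lemma Cc1_clsO:
  assumes "Cc1 \<Omega> \<phi> d1 d2"
  shows "clsO \<Omega> \<phi> = cls \<phi>" "clsO \<Omega> d1 = cls d1" "clsO \<Omega> d2 = cls d2"
proof -
  obtain K where K: "K \<subseteq> \<Omega>" "\<And>x. x \<notin> K \<Longrightarrow> \<phi> x = 0"
    "\<And>x. x \<notin> K \<Longrightarrow> d1 x = 0" "\<And>x. x \<notin> K \<Longrightarrow> d2 x = 0" using Cc1_support[OF assms] by blast
  have "(\<lambda>x. indicator \<Omega> x * f x) = f" if "\<And>x. x \<notin> K \<Longrightarrow> f x = 0" for f :: plane_fun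
    using that K(1) by (auto simp: indicator_def fun_eq_iff)
  then show "clsO \<Omega> \<phi> = cls \<phi>" "clsO \<Omega> d1 = cls d1" "clsO \<Omega> d2 = cls d2"
    using K by (simp_all add: clsO_def)
qed

lemma Cc1_add:
  assumes "Cc1 \<Omega> \<phi> d1 d2" "Cc1 \<Omega> \<psi> e1 e2"
  shows "Cc1 \<Omega> (\<lambda>x. \<phi> x + \<psi> x) (\<lambda>x. d1 x + e1 x) (\<lambda>x. d2 x + e2 x)"
proof -
  obtain K L where "compact K" "K \<subseteq> \<Omega>" "\<forall>x. x \<notin> K \<longrightarrow> \<phi> x = 0"
    "compact L" "L \<subseteq> \<Omega>" "\<forall>x. x \<notin> L \<longrightarrow> \<psi> x = 0" using assms unfolding Cc1_def by blast
  then have "\<exists>K. compact K \<and> K \<subseteq> \<Omega> \<and> (\<forall>x. x \<notin> K \<longrightarrow> \<phi> x + \<psi> x = 0)"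
    by (intro exI[of _ "K \<union> L"]) auto
  then show ?thesis unfolding Cc1_iff using C1_on_add assms[unfolded Cc1_iff] by blast
qed

lemma Cc1_scale:
  assumes "Cc1 \<Omega> \<phi> d1 d2"
  shows "Cc1 \<Omega> (\<lambda>x. c * \<phi> x) (\<lambda>x. c * d1 x) (\<lambda>x. c * d2 x)"
proof -
  obtain K where "compact K" "K \<subseteq> \<Omega>" "\<forall>x. x \<notin> K \<longrightarrow> \<phi> x = 0"
    using assms unfolding Cc1_def by blast
  then have "\<exists>K. compact K \<and> K \<subseteq> \<Omega> \<and> (\<forall>x. x \<notin> K \<longrightarrow> c * \<phi> x = 0)"
    by (intro exI[of _ "K"]) auto
  then show ?thesis unfolding Cc1_iff using C1_on_cmult assms[unfolded Cc1_iff] by blast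
qed

section \<open>The closed gradient graph, a model of H^1_0 with its gradient\<close>

definition smooth_graph :: "(real \<times> real) set \<Rightarrow> (l2 \<times> l2 \<times> l2) set" where
  "smooth_graph \<Omega> = {(cls \<phi>, cls d1, cls d2) | \<phi> d1 d2. Cc1 \<Omega> \<phi> d1 d2}"

definition grad_graph :: "(real \<times> real) set \<Rightarrow> (l2 \<times> l2 \<times> l2) set" where
  "grad_graph \<Omega> = closure (smooth_graph \<Omega>)"

lemma smooth_graphI: "Cc1 \<Omega> \<phi> d1 d2 \<Longrightarrow> (cls \<phi>, cls d1, cls d2) \<in> smooth_graph \<Omega>"
  unfolding smooth_graph_def by blast

lemma grad_graphI: "Cc1 \<Omega> \<phi> d1 d2 \<Longrightarrow> (cls \<phi>, cls d1, cls d2) \<in> grad_graph \<Omega>"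
  unfolding grad_graph_def using smooth_graphI closure_subset by blast

lemma subspace_closure:
  fixes S :: "'a::real_normed_vector set"
  assumes "subspace S"
  shows "subspace (closure S)"
  unfolding subspace_def
proof (intro conjI ballI allI)
  show "0 \<in> closure S" using assms closure_subset subspace_0 by blast
  fix x y assume "x \<in> closure S" "y \<in> closure S"
  then obtain p q where "\<And>n. p n \<in> S" "p \<longlonglongrightarrow> x" "\<And>n. q n \<in> S" "q \<longlonglongrightarrow> y"
    unfolding closure_sequential by blast
  then show "x + y \<in> closure S"
    unfolding closure_sequential
    by (intro exI[of _ "\<lambda>n. p n + q n"]) (auto intro: tendsto_add subspace_add[OF assms])
next
  fix c x assume "x \<in> closure S"
  then obtain p where "\<And>n. p n \<in> S" "p \<longlonglongrightarrow> x" unfolding closure_sequential by blast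
  then show "c *\<^sub>R x \<in> closure S"
    unfolding closure_sequential
    by (intro exI[of _ "\<lambda>n. c *\<^sub>R p n"]) (auto intro: tendsto_intros subspace_scale[OF assms])
qed

lemma subspace_smooth_graph: "subspace (smooth_graph \<Omega>)"
  unfolding subspace_def
proof (intro conjI ballI allI)
  have "Cc1 \<Omega> (\<lambda>x. 0) (\<lambda>x. 0) (\<lambda>x. 0)"
    unfolding Cc1_iff using C1_on_const[of UNIV 0] by auto
  from smooth_graphI[OF this] show "0 \<in> smooth_graph \<Omega>" by (simp add: cls_0 zero_prod_def)
next
  fix p q assume "p \<in> smooth_graph \<Omega>" "q \<in> smooth_graph \<Omega>"
  then obtain \<phi> d1 d2 \<psi> e1 e2 where c: "Cc1 \<Omega> \<phi> d1 d2" "Cc1 \<Omega> \<psi> e1 e2"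
    and p: "p = (cls \<phi>, cls d1, cls d2)" and q: "q = (cls \<psi>, cls e1, cls e2)"
    unfolding smooth_graph_def by blast
  from smooth_graphI[OF Cc1_add[OF c]] show "p + q \<in> smooth_graph \<Omega>"
    by (simp add: p q cls_add Cc1_square_integrable[OF c(1)] Cc1_square_integrable[OF c(2)])
next
  fix p and r :: real assume "p \<in> smooth_graph \<Omega>"
  then obtain \<phi> d1 d2 where c: "Cc1 \<Omega> \<phi> d1 d2" and p: "p = (cls \<phi>, cls d1, cls d2)"
    unfolding smooth_graph_def by blast
  from smooth_graphI[OF Cc1_scale[OF c, of r]] show "r *\<^sub>R p \<in> smooth_graph \<Omega>"
    by (simp add: p cls_scale Cc1_square_integrable[OF c])
qed

interpretation grad: closed_form "grad_graph \<Omega>" for \<Omega>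
  by standard (simp_all add: grad_graph_def subspace_smooth_graph subspace_closure)

text \<open>Being fixed by multiplication with the indicator of \<Omega> is a closed condition that
  test functions satisfy, so it passes to the closure.\<close>

lemma grad_graph_supported:
  assumes "open \<Omega>" "(u, g1, g2) \<in> grad_graph \<Omega>"
  shows "clsO \<Omega> (rep u) = u" "clsO \<Omega> (rep g1) = g1" "clsO \<Omega> (rep g2) = g2"
proof -
  note b = bounded_by_indicator[OF assms(1)]
  have bl: "continuous_on UNIV (mul (indicator \<Omega>))"
    using bounded_linear_mul[OF b] linear_continuous_on by blast
  let ?T = "{p. mul (indicator \<Omega>) (fst p) = fst p \<and> mul (indicator \<Omega>) (fst (snd p)) = fst (snd p) \<and>
      mul (indicator \<Omega>) (snd (snd p)) = snd (snd p)}"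
  have "closed ?T"
    by (intro closed_Collect_conj closed_Collect_eq continuous_on_compose2[OF bl] continuous_intros) auto
  moreover have "smooth_graph \<Omega> \<subseteq> ?T"
    using Cc1_clsO Cc1_square_integrable by (auto simp: smooth_graph_def mul_cls[OF b] clsO_def)
  ultimately have "grad_graph \<Omega> \<subseteq> ?T" unfolding grad_graph_def by (rule closure_minimal[rotated])
  then show "clsO \<Omega> (rep u) = u" "clsO \<Omega> (rep g1) = g1" "clsO \<Omega> (rep g2) = g2"
    using assms(2) by (auto simp: clsO_def mul_def)
qed

text \<open>Membership in a closure is approximation by a sequence, and the \<open>L2_norm\<close>
  of a difference is the distance of the embedded classes; so the definition through sequences of
  test functions describes \<open>grad_graph\<close>.\<close>

lemma H01_grad_iff:
  assumes \<Omega>: "open \<Omega>"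
  shows "H01_grad \<Omega> u g1 g2 \<longleftrightarrow> u \<in> L2 \<Omega> \<and> g1 \<in> L2 \<Omega> \<and> g2 \<in> L2 \<Omega> \<and>
     (clsO \<Omega> u, clsO \<Omega> g1, clsO \<Omega> g2) \<in> grad_graph \<Omega>"
proof -
  have key: "L2_norm \<Omega> (\<lambda>x. f x - w x) = norm (cls f - clsO \<Omega> w)"
    if "square_integrable f" "clsO \<Omega> f = cls f" "w \<in> L2 \<Omega>" for f w
    using that L2_diff[OF \<Omega> square_integrable_L2[OF \<Omega> that(1)] that(3)]
    by (simp add: L2_norm_eq[OF \<Omega>] clsO_diff[OF \<Omega> square_integrable_L2[OF \<Omega>]])
  have "(\<exists>\<phi> d1 d2. (\<forall>n. Cc1 \<Omega> (\<phi> n) (d1 n) (d2 n)) \<and>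
        (\<lambda>n. L2_norm \<Omega> (\<lambda>x. \<phi> n x - u x)) \<longlonglongrightarrow> 0 \<and>
        (\<lambda>n. L2_norm \<Omega> (\<lambda>x. d1 n x - g1 x)) \<longlonglongrightarrow> 0 \<and>
        (\<lambda>n. L2_norm \<Omega> (\<lambda>x. d2 n x - g2 x)) \<longlonglongrightarrow> 0)
     \<longleftrightarrow> (clsO \<Omega> u, clsO \<Omega> g1, clsO \<Omega> g2) \<in> grad_graph \<Omega>" (is "?L \<longleftrightarrow> ?R")
    if m: "u \<in> L2 \<Omega>" "g1 \<in> L2 \<Omega>" "g2 \<in> L2 \<Omega>"
  proof
    assume ?L
    then obtain \<phi> d1 d2 where c: "\<And>n. Cc1 \<Omega> (\<phi> n) (d1 n) (d2 n)"
      and l: "(\<lambda>n. L2_norm \<Omega> (\<lambda>x. \<phi> n x - u x)) \<longlonglongrightarrow> 0"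
        "(\<lambda>n. L2_norm \<Omega> (\<lambda>x. d1 n x - g1 x)) \<longlonglongrightarrow> 0"
        "(\<lambda>n. L2_norm \<Omega> (\<lambda>x. d2 n x - g2 x)) \<longlonglongrightarrow> 0" by blast
    have "(\<lambda>n. cls (\<phi> n)) \<longlonglongrightarrow> clsO \<Omega> u" "(\<lambda>n. cls (d1 n)) \<longlonglongrightarrow> clsO \<Omega> g1" "(\<lambda>n. cls (d2 n)) \<longlonglongrightarrow> clsO \<Omega> g2"
      using l m by (simp_all add: key Cc1_square_integrable[OF c] Cc1_clsO[OF c] tendsto_norm_zero_iff LIM_zero_cancel)
    then have "(\<lambda>n. (cls (\<phi> n), cls (d1 n), cls (d2 n))) \<longlonglongrightarrow> (clsO \<Omega> u, clsO \<Omega> g1, clsO \<Omega> g2)"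
      by (intro tendsto_Pair)
    then show ?R unfolding grad_graph_def closure_sequential
      by (intro exI[of _ "\<lambda>n. (cls (\<phi> n), cls (d1 n), cls (d2 n))"]) (simp add: smooth_graphI[OF c])
  next
    assume ?R
    then obtain p where p: "\<And>n. p n \<in> smooth_graph \<Omega>" "p \<longlonglongrightarrow> (clsO \<Omega> u, clsO \<Omega> g1, clsO \<Omega> g2)"
      unfolding grad_graph_def closure_sequential by blast
    then have "\<forall>n. \<exists>\<phi> d1 d2. Cc1 \<Omega> \<phi> d1 d2 \<and> p n = (cls \<phi>, cls d1, cls d2)"
      unfolding smooth_graph_def by blast
    then obtain \<phi> d1 d2 where c: "\<And>n. Cc1 \<Omega> (\<phi> n) (d1 n) (d2 n)"
      and pn: "\<And>n. p n = (cls (\<phi> n), cls (d1 n), cls (d2 n))" by metis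
    have "(\<lambda>n. cls (\<phi> n)) \<longlonglongrightarrow> clsO \<Omega> u" "(\<lambda>n. cls (d1 n)) \<longlonglongrightarrow> clsO \<Omega> g1" "(\<lambda>n. cls (d2 n)) \<longlonglongrightarrow> clsO \<Omega> g2"
      using tendsto_fst[OF p(2)] tendsto_fst[OF tendsto_snd[OF p(2)]] tendsto_snd[OF tendsto_snd[OF p(2)]]
      by (simp_all add: pn)
    then have "(\<lambda>n. L2_norm \<Omega> (\<lambda>x. \<phi> n x - u x)) \<longlonglongrightarrow> 0"
        "(\<lambda>n. L2_norm \<Omega> (\<lambda>x. d1 n x - g1 x)) \<longlonglongrightarrow> 0"
        "(\<lambda>n. L2_norm \<Omega> (\<lambda>x. d2 n x - g2 x)) \<longlonglongrightarrow> 0"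
      using m by (simp_all add: key Cc1_square_integrable[OF c] Cc1_clsO[OF c] tendsto_norm_zero_iff LIM_zero)
    with c show ?L by blast
  qed
  then show ?thesis unfolding H01_grad_def by blast
qed

lemma H01_grad_rep:
  assumes "open \<Omega>" "(u, g1, g2) \<in> grad_graph \<Omega>"
  shows "H01_grad \<Omega> (rep u) (rep g1) (rep g2)"
  using assms(2) grad_graph_supported[OF assms] square_integrable_L2[OF assms(1) square_integrable_rep]
  by (simp add: H01_grad_iff[OF assms(1)])

lemma dirichlet_op_imp_form_op:
  assumes \<Omega>: "open \<Omega>" and op: "dirichlet_op \<Omega> u f"
  shows "u \<in> L2 \<Omega>" "f \<in> L2 \<Omega>" "grad.form_op \<Omega> (clsO \<Omega> u) (clsO \<Omega> f)"
proof -
  obtain g1 g2 where g: "H01_grad \<Omega> u g1 g2" and f: "f \<in> L2 \<Omega>"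
    and t: "\<And>v h1 h2. H01_grad \<Omega> v h1 h2 \<Longrightarrow>
      (LINT x:\<Omega>|lborel. g1 x * h1 x + g2 x * h2 x) = (LINT x:\<Omega>|lborel. f x * v x)"
    using op unfolding dirichlet_op_def by blast
  have gL: "g1 \<in> L2 \<Omega>" "g2 \<in> L2 \<Omega>" "(clsO \<Omega> u, clsO \<Omega> g1, clsO \<Omega> g2) \<in> grad_graph \<Omega>"
    using g by (auto simp: H01_grad_iff[OF \<Omega>])
  show "u \<in> L2 \<Omega>" "f \<in> L2 \<Omega>" using g f by (auto simp: H01_grad_iff[OF \<Omega>])
  have "inner (clsO \<Omega> g1, clsO \<Omega> g2) k = inner (clsO \<Omega> f) v" if "(v, k) \<in> grad_graph \<Omega>" for v k
  proof -
    obtain k1 k2 where k: "k = (k1, k2)" by fastforce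
    note V = that[unfolded k]
    note r = square_integrable_L2[OF \<Omega> square_integrable_rep]
    have "(LINT x:\<Omega>|lborel. g1 x * rep k1 x + g2 x * rep k2 x) = (LINT x:\<Omega>|lborel. f x * rep v x)"
      by (rule t[OF H01_grad_rep[OF \<Omega> V]])
    then show ?thesis
      by (simp add: set_integral_add set_integral_eq_inner[OF \<Omega>] gL r f grad_graph_supported[OF \<Omega> V] k)
  qed
  with gL(3) show "grad.form_op \<Omega> (clsO \<Omega> u) (clsO \<Omega> f)"
    unfolding grad.form_op_def by blast
qed

text \<open>A right-hand side in \<open>form_op\<close> may be nonzero outside \<Omega>; that part
  is invisible to functions extended by zero.\<close>

lemma inner_clsO_right:
  assumes \<Omega>: "open \<Omega>" and v: "v \<in> L2 \<Omega>"
  shows "inner (clsO \<Omega> (rep F)) (clsO \<Omega> v) = inner F (clsO \<Omega> v)"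
proof -
  have "inner (clsO \<Omega> (rep F)) (clsO \<Omega> v) = (LINT x|lborel. (indicator \<Omega> x * rep F x) * (indicator \<Omega> x * v x))"
    unfolding clsO_def
    by (rule inner_cls) (use v square_integrable_L2[OF \<Omega> square_integrable_rep, of F] in \<open>simp_all add: L2_iff[OF \<Omega>]\<close>)
  also have "\<dots> = (LINT x|lborel. rep F x * (indicator \<Omega> x * v x))"
    by (rule Bochner_Integration.integral_cong) (auto simp: indicator_def)
  also have "\<dots> = inner (cls (rep F)) (clsO \<Omega> v)"
    unfolding clsO_def by (rule inner_cls[symmetric]) (use v in \<open>simp_all add: L2_iff[OF \<Omega>] square_integrable_rep\<close>)
  finally show ?thesis by simp
qed

lemma form_op_imp_dirichlet_op:
  assumes \<Omega>: "open \<Omega>" and op: "grad.form_op \<Omega> U F"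
  shows "dirichlet_op \<Omega> (rep U) (rep F)"
proof -
  obtain G1 G2 where G: "(U, G1, G2) \<in> grad_graph \<Omega>"
    and t: "\<And>v k. (v, k) \<in> grad_graph \<Omega> \<Longrightarrow> inner (G1, G2) k = inner F v"
    using op unfolding grad.form_op_def by (metis surj_pair)
  note r = square_integrable_L2[OF \<Omega> square_integrable_rep]
  have "(LINT x:\<Omega>|lborel. rep G1 x * h1 x + rep G2 x * h2 x) = (LINT x:\<Omega>|lborel. rep F x * v x)"
    if "H01_grad \<Omega> v h1 h2" for v h1 h2
    using that t[of "clsO \<Omega> v" "(clsO \<Omega> h1, clsO \<Omega> h2)"]
    by (simp add: H01_grad_iff[OF \<Omega>] set_integral_add set_integral_eq_inner[OF \<Omega>] r inner_clsO_right[OF \<Omega>])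
  then show ?thesis
    unfolding dirichlet_op_def using H01_grad_rep[OF \<Omega> G] r by blast
qed

section \<open>Strong solutions as differentiable curves in \<open>l2\<close>\<close>

lemma has_vector_derivative_iff_quotient:
  fixes U :: "real \<Rightarrow> 'a::real_normed_vector"
  shows "(U has_vector_derivative - F) (at t) \<longleftrightarrow>
    ((\<lambda>s. norm ((1 / (s - t)) *\<^sub>R (U s - U t) + F)) \<longlongrightarrow> 0) (at t)"
proof -
  have "norm ((1 / norm (s - t)) *\<^sub>R (U s - (U t + (s - t) *\<^sub>R - F))) = norm ((1 / (s - t)) *\<^sub>R (U s - U t) + F)"
    if "s \<noteq> t" for s
  proof -
    have "U s - (U t + (s - t) *\<^sub>R - F) = (s - t) *\<^sub>R ((1 / (s - t)) *\<^sub>R (U s - U t) + F)"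
      using that by (simp add: scaleR_add_right)
    then show ?thesis using that by simp
  qed
  then have "((\<lambda>s. norm ((1 / norm (s - t)) *\<^sub>R (U s - (U t + (s - t) *\<^sub>R - F)))) \<longlongrightarrow> 0) (at t)
      \<longleftrightarrow> ((\<lambda>s. norm ((1 / (s - t)) *\<^sub>R (U s - U t) + F)) \<longlongrightarrow> 0) (at t)"
    by (intro tendsto_cong) (simp add: eventually_at_filter)
  then show ?thesis
    unfolding has_vector_derivative_def has_derivative_at2 tendsto_norm_zero_iff
    using bounded_linear_scaleR_left[of "- F"] by simp
qed

text \<open>Lets the decay estimate treat an arbitrary \<open>heat_sol\<close> as a curve U with U'
  = -F, whatever the origin of the solution.\<close>

lemma heat_sol_imp_curve:
  assumes \<Omega>: "open \<Omega>" and sol: "heat_sol \<Omega> u0 u"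
  shows "clsO \<Omega> (u 0) = clsO \<Omega> u0"
    "\<And>t. 0 \<le> t \<Longrightarrow> u t \<in> L2 \<Omega>"
    "continuous_on {0..} (\<lambda>t. clsO \<Omega> (u t))"
    "\<And>t. 0 < t \<Longrightarrow> \<exists>F. grad.form_op \<Omega> (clsO \<Omega> (u t)) F \<and> ((\<lambda>s. clsO \<Omega> (u s)) has_vector_derivative - F) (at t)"
proof -
  have u0: "u0 \<in> L2 \<Omega>" and u: "\<And>t. 0 \<le> t \<Longrightarrow> u t \<in> L2 \<Omega>"
    and i: "L2_norm \<Omega> (\<lambda>x. u 0 x - u0 x) = 0"
    and c: "\<And>t. 0 \<le> t \<Longrightarrow> ((\<lambda>s. L2_norm \<Omega> (\<lambda>x. u s x - u t x)) \<longlongrightarrow> 0) (at t within {0..})"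
    and d: "\<And>t. 0 < t \<Longrightarrow> \<exists>f. dirichlet_op \<Omega> (u t) f \<and>
        ((\<lambda>s. L2_norm \<Omega> (\<lambda>x. (u s x - u t x) / (s - t) + f x)) \<longlongrightarrow> 0) (at t)"
    using sol unfolding heat_sol_def by blast+
  show "0 \<le> t \<Longrightarrow> u t \<in> L2 \<Omega>" for t by (rule u)
  have n: "L2_norm \<Omega> (\<lambda>x. f x - g x) = norm (clsO \<Omega> f - clsO \<Omega> g)" if "f \<in> L2 \<Omega>" "g \<in> L2 \<Omega>" for f g
    using L2_norm_eq[OF \<Omega> L2_diff[OF \<Omega> that]] clsO_diff[OF \<Omega> that] by simp
  show "clsO \<Omega> (u 0) = clsO \<Omega> u0" using i n[OF u u0] by simp
  show "continuous_on {0..} (\<lambda>t. clsO \<Omega> (u t))"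
    unfolding continuous_on_def
  proof
    fix t :: real assume t: "t \<in> {0..}"
    have "((\<lambda>s. norm (clsO \<Omega> (u s) - clsO \<Omega> (u t))) \<longlongrightarrow> 0) (at t within {0..})"
      by (rule Lim_transform_eventually[OF c]) (use t u n in \<open>auto simp: eventually_at_filter\<close>)
    then show "((\<lambda>t. clsO \<Omega> (u t)) \<longlongrightarrow> clsO \<Omega> (u t)) (at t within {0..})"
      by (simp add: tendsto_norm_zero_iff LIM_zero_cancel)
  qed
  fix t :: real assume t: "0 < t"
  then obtain f where f: "dirichlet_op \<Omega> (u t) f"
    and l: "((\<lambda>s. L2_norm \<Omega> (\<lambda>x. (u s x - u t x) / (s - t) + f x)) \<longlongrightarrow> 0) (at t)" using d by blast
  note fo = dirichlet_op_imp_form_op[OF \<Omega> f]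
  have e: "L2_norm \<Omega> (\<lambda>x. (u s x - u t x) / (s - t) + f x)
      = norm ((1 / (s - t)) *\<^sub>R (clsO \<Omega> (u s) - clsO \<Omega> (u t)) + clsO \<Omega> f)" if "0 < s" for s
  proof -
    have us: "u s \<in> L2 \<Omega>" "u t \<in> L2 \<Omega>" using u t that by auto
    have 1: "(\<lambda>x. (1 / (s - t)) * (u s x - u t x)) \<in> L2 \<Omega>" by (intro L2_scale L2_diff \<Omega> us)
    show ?thesis
      using L2_norm_eq[OF \<Omega> L2_add[OF \<Omega> 1 fo(2)]]
      by (simp add: clsO_add[OF \<Omega> 1 fo(2), simplified] clsO_scale[OF \<Omega> L2_diff[OF \<Omega> us], of "1 / (s - t)", simplified] clsO_diff[OF \<Omega> us])
  qed
  have "((\<lambda>s. clsO \<Omega> (u s)) has_vector_derivative - clsO \<Omega> f) (at t)"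
    unfolding has_vector_derivative_iff_quotient
  proof (rule Lim_transform_eventually[OF l])
    have "\<forall>\<^sub>F s in at t. s \<in> {0<..}" using t by (intro eventually_at_topological[THEN iffD2]) (auto intro!: exI[of _ "{0<..}"])
    then show "\<forall>\<^sub>F s in at t. L2_norm \<Omega> (\<lambda>x. (u s x - u t x) / (s - t) + f x)
        = norm ((1 / (s - t)) *\<^sub>R (clsO \<Omega> (u s) - clsO \<Omega> (u t)) + clsO \<Omega> f)"
      by eventually_elim (simp add: e)
  qed
  with fo(3) show "\<exists>F. grad.form_op \<Omega> (clsO \<Omega> (u t)) F \<and> ((\<lambda>s. clsO \<Omega> (u s)) has_vector_derivative - F) (at t)"
    by blast
qed

lemma L2_norm_le_norm_cls:
  assumes "open \<Omega>" "square_integrable f"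
  shows "L2_norm \<Omega> f \<le> norm (cls f)"
proof -
  have "L2_norm \<Omega> f = norm (clsO \<Omega> f)" by (rule L2_norm_eq[OF assms(1) square_integrable_L2[OF assms]])
  also have "\<dots> \<le> norm (cls f)"
    unfolding clsO_def
    by (rule norm_cls_mono[OF assms(2)])
      (use square_integrable_L2[OF assms] assms(1) in \<open>auto simp: L2_iff indicator_def square_integrable_def\<close>)
  finally show ?thesis .
qed

text \<open>Restriction to \<Omega> can only decrease the norm, so limits and difference quotients
  in \<open>l2\<close> imply those in \<open>L2_norm\<close>. Applied to the semigroup, this
  supplies a genuine solution to test \<open>decay_bound\<close> with.\<close>

lemma heat_sol_of_curve:
  assumes \<Omega>: "open \<Omega>" and u0: "square_integrable u0" and U0: "U 0 = cls u0"
    and c: "((\<lambda>t. U t) \<longlongrightarrow> U 0) (at 0 within {0..})"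
    and d: "\<And>t. 0 < t \<Longrightarrow> \<exists>F. grad.form_op \<Omega> (U t) F \<and> (U has_vector_derivative - F) (at t)"
  shows "heat_sol \<Omega> u0 (\<lambda>t. rep (U t))"
  unfolding heat_sol_def
proof (intro conjI allI impI)
  note r = square_integrable_L2[OF \<Omega> square_integrable_rep]
  note s = square_integrable_diff[OF square_integrable_rep square_integrable_rep]
  have n: "L2_norm \<Omega> (\<lambda>x. rep v x - rep w x) \<le> norm (v - w)" for v w
    using L2_norm_le_norm_cls[OF \<Omega> s, of v w] by (simp flip: cls_diff[OF square_integrable_rep square_integrable_rep])
  have nn: "0 \<le> L2_norm \<Omega> f" for f by (simp add: L2_norm_def set_lebesgue_integral_def)
  show "u0 \<in> L2 \<Omega>" by (rule square_integrable_L2[OF \<Omega> u0])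
  show "rep (U t) \<in> L2 \<Omega>" for t by (rule r)
  have "L2_norm \<Omega> (\<lambda>x. rep (U 0) x - u0 x) \<le> norm (cls (\<lambda>x. rep (U 0) x - u0 x))"
    by (rule L2_norm_le_norm_cls[OF \<Omega> square_integrable_diff[OF square_integrable_rep u0]])
  also have "\<dots> = 0" by (simp add: U0 flip: cls_diff[OF square_integrable_rep u0])
  finally show "L2_norm \<Omega> (\<lambda>x. rep (U 0) x - u0 x) = 0" using nn by (simp add: order_antisym)
  show "((\<lambda>s. L2_norm \<Omega> (\<lambda>x. rep (U s) x - rep (U t) x)) \<longlongrightarrow> 0) (at t within {0..})" if t: "0 \<le> t" for t
  proof (rule Lim_null_comparison)
    show "\<forall>\<^sub>F s in at t within {0..}. norm (L2_norm \<Omega> (\<lambda>x. rep (U s) x - rep (U t) x)) \<le> norm (U s - U t)"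
      using n nn by simp
    have "(U \<longlongrightarrow> U t) (at t within {0..})"
    proof (cases "t = 0")
      case False
      then have "isCont U t" using d[of t] t has_vector_derivative_continuous by fastforce
      then show ?thesis by (simp add: continuous_within isCont_def tendsto_within_subset[OF _ subset_UNIV])
    qed (use c in simp)
    then show "((\<lambda>s. norm (U s - U t)) \<longlongrightarrow> 0) (at t within {0..})"
      by (simp add: tendsto_norm_zero_iff LIM_zero)
  qed
  show "\<exists>f. dirichlet_op \<Omega> (rep (U t)) f \<and>
      ((\<lambda>s. L2_norm \<Omega> (\<lambda>x. (rep (U s) x - rep (U t) x) / (s - t) + f x)) \<longlongrightarrow> 0) (at t)" if t: "0 < t" for t
  proof -
    obtain F where F: "grad.form_op \<Omega> (U t) F" "(U has_vector_derivative - F) (at t)" using d[OF t] by blast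
    have le: "L2_norm \<Omega> (\<lambda>x. (rep (U s) x - rep (U t) x) / (s - t) + rep F x)
        \<le> norm ((1 / (s - t)) *\<^sub>R (U s - U t) + F)" for s
    proof -
      note s1 = square_integrable_scale[OF s, of "1 / (s - t)" "U s" "U t"]
      have "cls (\<lambda>x. (1 / (s - t)) * (rep (U s) x - rep (U t) x) + rep F x) = (1 / (s - t)) *\<^sub>R (U s - U t) + F"
        by (simp only: cls_add[OF s1 square_integrable_rep, symmetric] cls_scale[OF s, symmetric]
            cls_diff[OF square_integrable_rep square_integrable_rep, symmetric] cls_rep)
      then show ?thesis
        using L2_norm_le_norm_cls[OF \<Omega> square_integrable_add[OF s1 square_integrable_rep], of F] by simp
    qed
    have "((\<lambda>s. L2_norm \<Omega> (\<lambda>x. (rep (U s) x - rep (U t) x) / (s - t) + rep F x)) \<longlongrightarrow> 0) (at t)"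
    proof (rule Lim_null_comparison[OF always_eventually F(2)[unfolded has_vector_derivative_iff_quotient]], rule allI)
      fix s
      show "norm (L2_norm \<Omega> (\<lambda>x. (rep (U s) x - rep (U t) x) / (s - t) + rep F x))
          \<le> norm ((1 / (s - t)) *\<^sub>R (U s - U t) + F)"
        using le[of s] nn by (simp only: real_norm_def abs_of_nonneg)
    qed
    with form_op_imp_dirichlet_op[OF \<Omega> F(1)] show ?thesis by blast
  qed
qed

section \<open>The angular coordinate\<close>

text \<open>Rotating by -\<theta>(|x|) straightens the wedge; \<open>Arg2pi\<close>, with values in
  [0, 2 pi), then recovers the parameter \<phi> of \<open>curved_wedge\<close>.\<close>

definition wedge_angle :: "(real \<Rightarrow> real) \<Rightarrow> real \<times> real \<Rightarrow> real" where
  "wedge_angle \<theta> x = Arg2pi (Complex (fst x) (snd x) * cis (- \<theta> (norm x)))"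

lemma cmod_Complex_pair: "cmod (Complex (fst x) (snd x)) = norm x"
  by (cases x) (simp add: cmod_def norm_Pair)

lemma Complex_wedge_angle:
  "Complex (fst x) (snd x) = complex_of_real (norm x) * cis (wedge_angle \<theta> x + \<theta> (norm x))"
proof -
  let ?w = "Complex (fst x) (snd x) * cis (- \<theta> (norm x))"
  have "?w = complex_of_real (norm x) * cis (wedge_angle \<theta> x)"
    using Arg2pi_eq[of ?w] by (simp add: wedge_angle_def norm_mult cmod_Complex_pair cis_conv_exp)
  then have "?w * cis (\<theta> (norm x)) = complex_of_real (norm x) * cis (wedge_angle \<theta> x + \<theta> (norm x))"
    by (simp add: mult.assoc cis_mult)
  then show ?thesis by (simp add: mult.assoc cis_mult)
qed

lemma wedge_angle_polar:
  assumes x: "x = (r * cos (\<phi> + \<theta> r), r * sin (\<phi> + \<theta> r))" and r: "0 < r" and \<phi>: "0 < \<phi>" "\<phi> < 2 * pi"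
  shows "norm x = r" "wedge_angle \<theta> x = \<phi>"
proof -
  have z: "Complex (fst x) (snd x) = complex_of_real r * cis (\<phi> + \<theta> r)"
    by (simp add: x complex_eq_iff)
  show n: "norm x = r"
    using r by (simp flip: cmod_Complex_pair add: z norm_mult)
  have "of_real r * exp (\<i> * of_real \<phi>) = Complex (fst x) (snd x) * cis (- \<theta> (norm x))"
    by (simp add: z n mult.assoc cis_mult flip: cis_conv_exp)
  then show "wedge_angle \<theta> x = \<phi>"
    unfolding wedge_angle_def using r \<phi> by (intro Arg2pi_unique) auto
qed

lemma wedge_angle_coordinates:
  "x = (norm x * cos (wedge_angle \<theta> x + \<theta> (norm x)), norm x * sin (wedge_angle \<theta> x + \<theta> (norm x)))"
  using Complex_wedge_angle[of x \<theta>] by (simp add: complex_eq_iff prod_eq_iff)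

text \<open>Since a \<le> 1, all parameters \<phi> lie below 2 pi, where polar coordinates are
  injective; the wedge becomes a condition on one function.\<close>

lemma curved_wedge_iff:
  assumes "0 < a" "a \<le> 1"
  shows "x \<in> curved_wedge \<theta> a \<longleftrightarrow> x \<noteq> 0 \<and> 0 < wedge_angle \<theta> x \<and> wedge_angle \<theta> x < 2 * pi * a"
proof
  assume "x \<in> curved_wedge \<theta> a"
  then obtain r \<phi> where x: "x = (r * cos (\<phi> + \<theta> r), r * sin (\<phi> + \<theta> r))"
    and r: "0 < r" and \<phi>: "0 < \<phi>" "\<phi> < 2 * pi * a" unfolding curved_wedge_def by blast
  have "2 * pi * a \<le> 2 * pi * 1" using assms by (intro mult_left_mono) auto
  then have "\<phi> < 2 * pi" using \<phi> by linarith
  from wedge_angle_polar[of x r \<phi> \<theta>, OF x r \<phi>(1) this] r \<phi>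
  show "x \<noteq> 0 \<and> 0 < wedge_angle \<theta> x \<and> wedge_angle \<theta> x < 2 * pi * a" by auto
next
  assume x: "x \<noteq> 0 \<and> 0 < wedge_angle \<theta> x \<and> wedge_angle \<theta> x < 2 * pi * a"
  with wedge_angle_coordinates[of x \<theta>] show "x \<in> curved_wedge \<theta> a"
    unfolding curved_wedge_def by (intro CollectI exI[of _ "norm x"] exI[of _ "wedge_angle \<theta> x"]) auto
qed

lemma Arg2pi_pos_iff: "0 < Arg2pi w \<longleftrightarrow> w \<notin> \<real>\<^sub>\<ge>\<^sub>0"
  using Arg2pi_eq_0[of w] Arg2pi[of w] by (auto simp: complex_nonneg_Reals_iff complex_is_Real_iff less_le)

text \<open>\<open>Arg2pi\<close> jumps across the nonnegative real axis, and the principal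
  logarithm of -z has its cut exactly there; off that axis
  \<open>Arg2pi z = Im (Ln (- z)) + pi\<close>.\<close>

lemma has_derivative_Arg2pi:
  assumes "0 < Arg2pi w"
  shows "(Arg2pi has_derivative (\<lambda>k. Im (k / w))) (at w)"
proof (rule has_derivative_transform_within_open[of "\<lambda>z. Im (Ln (- z)) + pi" _ _ _ "- \<real>\<^sub>\<ge>\<^sub>0"])
  have w: "w \<notin> \<real>\<^sub>\<ge>\<^sub>0" using assms by (simp add: Arg2pi_pos_iff)
  then have "- w \<notin> \<real>\<^sub>\<le>\<^sub>0" by (simp add: complex_nonneg_Reals_iff complex_nonpos_Reals_iff)
  then have "(Ln has_derivative (*) (inverse (- w))) (at (- w))"
    by (rule has_field_derivative_Ln[unfolded has_field_derivative_def])
  then have "((\<lambda>z. Ln (- z)) has_derivative (\<lambda>k. inverse (- w) * (- k))) (at w)"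
    by (rule has_derivative_compose[rotated]) (auto intro!: derivative_eq_intros)
  then show "((\<lambda>z. Im (Ln (- z)) + pi) has_derivative (\<lambda>k. Im (k / w))) (at w)"
    by (auto intro!: derivative_eq_intros simp: divide_inverse mult.commute)
  show "open (- (\<real>\<^sub>\<ge>\<^sub>0 :: complex set))" by (simp add: open_Compl)
  show "w \<in> - \<real>\<^sub>\<ge>\<^sub>0" using w by simp
  show "Im (Ln (- z)) + pi = Arg2pi z" if "z \<in> - \<real>\<^sub>\<ge>\<^sub>0" for z
    using that Arg2pi_Ln[of z] by (simp add: Arg2pi_pos_iff)
qed

text \<open>Together with \<open>wedge_angle2\<close> this is the gradient of the curved angle: that
  of the polar angle, minus \<theta>' times the unit radial vector.\<close>

definition wedge_angle1 :: "(real \<Rightarrow> real) \<Rightarrow> real \<times> real \<Rightarrow> real" where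
  "wedge_angle1 \<theta>' x = - snd x / sqn x - \<theta>' (norm x) * fst x / norm x"

definition wedge_angle2 :: "(real \<Rightarrow> real) \<Rightarrow> real \<times> real \<Rightarrow> real" where
  "wedge_angle2 \<theta>' x = fst x / sqn x - \<theta>' (norm x) * snd x / norm x"

lemma has_derivative_wedge_angle:
  assumes \<theta>: "(\<theta> has_real_derivative \<theta>' (norm x)) (at (norm x))" and x: "x \<noteq> 0" "0 < wedge_angle \<theta> x"
  shows "(wedge_angle \<theta> has_derivative (\<lambda>h. wedge_angle1 \<theta>' x * fst h + wedge_angle2 \<theta>' x * snd h)) (at x)"
proof -
  let ?z = "\<lambda>x. Complex (fst x) (snd x)" and ?c = "cis (- \<theta> (norm x))"
  let ?d = "\<lambda>h. \<theta>' (norm x) * (h \<bullet> sgn x)"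
  have z: "(?z has_derivative ?z) (at x)"
    unfolding Complex_eq by (auto intro!: derivative_eq_intros)
  have "(\<theta> has_derivative (\<lambda>k. \<theta>' (norm x) * k)) (at (norm x))"
    using \<theta> by (simp add: has_field_derivative_def)
  from has_derivative_compose[OF has_derivative_norm[OF x(1)] this]
  have t: "((\<lambda>x. - \<theta> (norm x)) has_derivative (\<lambda>h. - ?d h)) (at x)"
    by (rule has_derivative_minus)
  let ?k = "\<lambda>h. ?z x * ((- ?d h) *\<^sub>R (\<i> * ?c)) + ?z h * ?c"
  have "((\<lambda>x. ?z x * cis (- \<theta> (norm x))) has_derivative ?k) (at x)"
    by (rule has_derivative_mult[OF z has_derivative_cis[OF t]])
  moreover have "(Arg2pi has_derivative (\<lambda>k. Im (k / (?z x * ?c)))) (at (?z x * ?c))"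
    using x(2) by (intro has_derivative_Arg2pi) (simp add: wedge_angle_def)
  ultimately have "((\<lambda>x. Arg2pi (?z x * cis (- \<theta> (norm x)))) has_derivative (\<lambda>h. Im (?k h / (?z x * ?c)))) (at x)"
    by (rule has_derivative_compose)
  moreover have "Im (?k h / (?z x * ?c)) = wedge_angle1 \<theta>' x * fst h + wedge_angle2 \<theta>' x * snd h" for h
  proof -
    have nz: "?z x \<noteq> 0" using x(1) cmod_Complex_pair[of x] by auto
    have c: "?c \<noteq> 0" by simp
    have "?k h / (?z x * ?c) = - (of_real (?d h) * \<i>) + ?z h / ?z x"
    proof -
      have "(Z * ((- e) *\<^sub>R (\<i> * C)) + Y * C) / (Z * C) = - (of_real e * \<i>) + Y / Z"
        if "Z \<noteq> 0" "C \<noteq> 0" for Z C Y :: complex and e :: real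
        using that by (simp add: scaleR_conv_of_real field_simps)
      from this[OF nz c] show ?thesis .
    qed
    then have 1: "Im (?k h / (?z x * ?c)) = - ?d h + Im (?z h / ?z x)" by simp
    have 2: "Im (?z h / ?z x) = (fst x * snd h - snd x * fst h) / sqn x"
      by (simp add: Im_divide sqn_def mult.commute)
    have 3: "?d h = \<theta>' (norm x) * (fst x * fst h + snd x * snd h) / norm x"
      by (cases x; cases h) (simp add: sgn_div_norm divide_simps algebra_simps)
    show ?thesis
      unfolding 1 unfolding 2 3
      by (simp add: wedge_angle1_def wedge_angle2_def add_divide_distrib diff_divide_distrib algebra_simps)
  qed
  ultimately show ?thesis unfolding wedge_angle_def[abs_def] by simp
qed

lemma open_curved_wedge:
  assumes a: "0 < a" "a \<le> 1" and \<theta>: "\<And>r. r > 0 \<Longrightarrow> (\<theta> has_real_derivative \<theta>' r) (at r)"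
  shows "open (curved_wedge \<theta> a)"
  unfolding open_contains_ball
proof
  fix x assume "x \<in> curved_wedge \<theta> a"
  then have x: "x \<noteq> 0" "0 < wedge_angle \<theta> x" "wedge_angle \<theta> x < 2 * pi * a"
    using curved_wedge_iff[OF a] by blast+
  have "isCont (wedge_angle \<theta>) x"
    by (rule has_derivative_continuous[OF has_derivative_wedge_angle[of \<theta> \<theta>']]) (use x \<theta> in auto)
  then have "(wedge_angle \<theta> \<longlongrightarrow> wedge_angle \<theta> x) (nhds x)" by (simp add: isCont_def tendsto_at_iff_tendsto_nhds)
  then have "\<forall>\<^sub>F y in nhds x. 0 < wedge_angle \<theta> y \<and> wedge_angle \<theta> y < 2 * pi * a \<and> y \<noteq> 0"
    using x by (intro eventually_conj order_tendstoD t1_space_nhds) auto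
  then have "\<forall>\<^sub>F y in nhds x. y \<in> curved_wedge \<theta> a"
    by eventually_elim (simp add: curved_wedge_iff[OF a])
  then show "\<exists>e>0. ball x e \<subseteq> curved_wedge \<theta> a"
    unfolding eventually_nhds_metric by (auto simp: subset_iff dist_commute)
qed

lemma C1_on_wedge_angle:
  assumes a: "0 < a" "a \<le> 1" and \<theta>: "\<And>r. r > 0 \<Longrightarrow> (\<theta> has_real_derivative \<theta>' r) (at r)"
    and \<theta>': "continuous_on {0<..} \<theta>'"
  shows "C1_on (curved_wedge \<theta> a) (wedge_angle \<theta>) (wedge_angle1 \<theta>') (wedge_angle2 \<theta>')"
  unfolding C1_on_def
proof (intro conjI ballI)
  have nz: "x \<noteq> 0" "sqn x \<noteq> 0" "0 < norm x" if "x \<in> curved_wedge \<theta> a" for x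
    using that curved_wedge_iff[OF a] sqn_pos[of x] by auto
  fix x assume "x \<in> curved_wedge \<theta> a"
  then show "(wedge_angle \<theta> has_derivative (\<lambda>h. wedge_angle1 \<theta>' x * fst h + wedge_angle2 \<theta>' x * snd h)) (at x)"
    using curved_wedge_iff[OF a] nz \<theta> by (intro has_derivative_wedge_angle) auto
next
  have nz: "x \<noteq> 0" "sqn x \<noteq> 0" "0 < norm x" if "x \<in> curved_wedge \<theta> a" for x
    using that curved_wedge_iff[OF a] sqn_pos[of x] by auto
  have c: "continuous_on (curved_wedge \<theta> a) (\<lambda>x. \<theta>' (norm x))"
    by (rule continuous_on_compose2[OF \<theta>' continuous_on_norm_id]) (use nz in auto)
  show "continuous_on (curved_wedge \<theta> a) (wedge_angle1 \<theta>')"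
    unfolding wedge_angle1_def[abs_def] by (intro continuous_intros c) (use nz in auto)
  show "continuous_on (curved_wedge \<theta> a) (wedge_angle2 \<theta>')"
    unfolding wedge_angle2_def[abs_def] by (intro continuous_intros c) (use nz in auto)
qed

text \<open>The \<theta>' terms form a radial vector, which is orthogonal to the rotation field
  (-snd x, fst x).\<close>

lemma wedge_angle_rotation:
  assumes "x \<noteq> 0"
  shows "fst x * wedge_angle2 \<theta>' x - snd x * wedge_angle1 \<theta>' x = 1"
proof -
  have "fst x * wedge_angle2 \<theta>' x - snd x * wedge_angle1 \<theta>' x = ((fst x)\<^sup>2 + (snd x)\<^sup>2) / sqn x"
    unfolding wedge_angle1_def wedge_angle2_def by (simp add: power2_eq_square add_divide_distrib algebra_simps)
  also have "\<dots> = sqn x / sqn x" by (simp only: sqn_def)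
  also have "\<dots> = 1" using sqn_pos[OF assms] by simp
  finally show ?thesis .
qed

lemma sin_wedge_angle_pos:
  assumes a: "0 < a" "a \<le> 1" and x: "x \<in> curved_wedge \<theta> a"
  shows "0 < sin (1 / (2 * a) * wedge_angle \<theta> x)"
proof (rule sin_gt_zero)
  have "0 < wedge_angle \<theta> x" "wedge_angle \<theta> x < 2 * pi * a" using x curved_wedge_iff[OF a] by blast+
  then show "0 < 1 / (2 * a) * wedge_angle \<theta> x" "1 / (2 * a) * wedge_angle \<theta> x < pi"
    using a by (auto simp: field_simps)
qed

section \<open>The Lyapunov functional\<close>

text \<open>A bounded increasing substitute for s: \<open>cap \<epsilon> s \<le> s\<close> keeps the
  initial weight below \<open>gauss_weight\<close>,
  \<open>cap \<epsilon> s \<le> 1 / \<epsilon>\<close> makes the weight a bounded multiplier, and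
  its derivative stays rational.\<close>

definition cap :: "real \<Rightarrow> real \<Rightarrow> real" where
  "cap \<epsilon> s = s / (1 + \<epsilon> * s)"

lemma cap_bounds:
  assumes "0 < \<epsilon>" "0 \<le> s"
  shows "0 \<le> cap \<epsilon> s" "cap \<epsilon> s \<le> s" "cap \<epsilon> s \<le> 1 / \<epsilon>"
proof -
  have D: "1 \<le> 1 + \<epsilon> * s" using assms by simp
  show "0 \<le> cap \<epsilon> s" using assms by (simp add: cap_def)
  have "0 < 1 + \<epsilon> * s" using D by linarith
  then show "cap \<epsilon> s \<le> 1 / \<epsilon>" using assms by (simp add: cap_def divide_simps)
  have "s / (1 + \<epsilon> * s) \<le> s / 1" using \<open>0 < 1 + \<epsilon> * s\<close> assms by (intro divide_left_mono) auto
  then show "cap \<epsilon> s \<le> s" by (simp add: cap_def)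
qed

definition weight :: "real \<Rightarrow> real \<Rightarrow> real \<Rightarrow> real" where
  "weight \<epsilon> \<tau> s = exp (cap \<epsilon> s / (4 * \<tau>))"

lemma DERIV_weight:
  assumes "0 < \<epsilon>" "0 < \<tau>" "0 \<le> s"
  shows "(weight \<epsilon> \<tau> has_real_derivative weight \<epsilon> \<tau> s / (4 * \<tau> * (1 + \<epsilon> * s)\<^sup>2)) (at s)"
proof -
  have D: "1 + \<epsilon> * s \<noteq> 0" using assms by (smt (verit) mult_nonneg_nonneg)
  have "(cap \<epsilon> has_real_derivative 1 / (1 + \<epsilon> * s)\<^sup>2) (at s)"
    unfolding cap_def[abs_def] using D
    by (auto intro!: derivative_eq_intros simp: field_simps power2_eq_square)
  from DERIV_chain2[OF DERIV_exp DERIV_cdivide[OF this, of "4 * \<tau>"]]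
  show ?thesis by (simp add: weight_def[abs_def] mult.commute)
qed

lemma C1_on_weight:
  assumes "0 < \<epsilon>" "0 < \<tau>"
  shows "C1_on UNIV (\<lambda>x. weight \<epsilon> \<tau> (sqn x))
    (\<lambda>x. weight \<epsilon> \<tau> (sqn x) / (4 * \<tau> * (1 + \<epsilon> * sqn x)\<^sup>2) * (2 * fst x))
    (\<lambda>x. weight \<epsilon> \<tau> (sqn x) / (4 * \<tau> * (1 + \<epsilon> * sqn x)\<^sup>2) * (2 * snd x))"
proof (rule C1_on_radial)
  have D: "1 + \<epsilon> * s \<noteq> 0" if "0 \<le> s" for s using that assms by (smt (verit) mult_nonneg_nonneg)
  show "(weight \<epsilon> \<tau> has_real_derivative weight \<epsilon> \<tau> s / (4 * \<tau> * (1 + \<epsilon> * s)\<^sup>2)) (at s)"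
    if "s \<in> range sqn" for s using that DERIV_weight[OF assms] by auto
  have "continuous_on (range sqn) (weight \<epsilon> \<tau>)"
    by (rule DERIV_continuous_on, rule DERIV_subset[OF DERIV_weight[OF assms]]) auto
  then show "continuous_on (range sqn) (\<lambda>s. weight \<epsilon> \<tau> s / (4 * \<tau> * (1 + \<epsilon> * s)\<^sup>2))"
    by (intro continuous_intros) (use D assms in auto)
qed

text \<open>Pointwise form of the harmonic oscillator bound; \<open>\<epsilon>\<close> costs only an arbitrarily small part of the
  optimal constant \<open>(\<nu> + 1) / 2\<close>.\<close>

lemma oscillator_inequality:
  fixes s \<tau> \<epsilon> \<nu> \<gamma> :: real
  assumes s: "0 \<le> s" and \<tau>: "0 < \<tau>" and \<epsilon>: "0 < \<epsilon>" and \<nu>: "0 \<le> \<nu>"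
    and small: "\<epsilon> * (2 * \<tau> * (\<nu> + 2)\<^sup>2) \<le> \<nu> + 1 - 2 * \<gamma>"
  defines "D \<equiv> 1 + \<epsilon> * s"
  shows "\<gamma> / \<tau> - cap \<epsilon> s / (8 * \<tau>\<^sup>2) \<le>
    (2 + 2 * \<nu>) * (1 / (4 * \<tau> * D)) - 2 * s * (\<epsilon> / (4 * \<tau> * D\<^sup>2))
      - s * (1 / (4 * \<tau> * D))\<^sup>2 - s * (1 / (4 * \<tau> * D\<^sup>2))\<^sup>2"
proof -
  \<comment> \<open>At \<epsilon> = 0 both sides coincide for \<gamma> = (\<nu> + 1)/2. In the
    variables i = 1/D and z = \<open>cap \<epsilon> s\<close> the deviation is governed by
    \<epsilon> z = 1 - i.\<close>
  define i where "i = 1 / D"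
  define z where "z = s * i"
  have D: "1 \<le> D" using s \<epsilon> by (simp add: D_def)
  have i: "0 < i" "i \<le> 1" using D by (auto simp: i_def)
  have z: "0 \<le> z" using i s by (simp add: z_def)
  have ez: "\<epsilon> * z = 1 - i" using D by (simp add: z_def i_def D_def field_simps)
  have "i * i * i \<le> 1" using i by (simp add: mult_le_one)
  then have 1: "z * (i * i * i) \<le> z * 1" using z by (intro mult_left_mono)
  have 2: "(1 - i) * i \<le> (1 - i) * 1" using i by (intro mult_left_mono) auto
  \<comment> \<open>Completes z^2/(8\<tau>) - (\<nu> + 2) z to a square; its minimum, at z =
    4\<tau>(\<nu> + 2), is -2\<tau>(\<nu> + 2)^2, which is the constant in
    \<open>small\<close>.\<close>
  have "0 \<le> \<epsilon> * ((z - 4 * \<tau> * (\<nu> + 2))\<^sup>2 / (8 * \<tau>))" using \<epsilon> \<tau> by simp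
  also have "\<dots> = \<epsilon> * z * z / (8 * \<tau>) - (\<nu> + 2) * (\<epsilon> * z) + \<epsilon> * (2 * \<tau> * (\<nu> + 2)\<^sup>2)"
    using \<tau> by (simp add: power2_eq_square field_simps)
  also have "\<epsilon> * z * z / (8 * \<tau>) = (z - z * i) / (8 * \<tau>)" by (simp add: ez algebra_simps)
  finally have 3: "(\<nu> + 2) * (1 - i) \<le> (z - z * i) / (8 * \<tau>) + (\<nu> + 1 - 2 * \<gamma>)"
    using small ez by simp
  have "2 * \<gamma> \<le> z / (4 * \<tau>) + (1 + \<nu>) * i - (1 - i) * i - z * i / (8 * \<tau>) - z * (i * i * i) / (8 * \<tau>)"
  proof -
    have lin: "g \<le> Z + p - r - B - C"
      if "C \<le> A" "Z = A + A" "r \<le> 1 - i" "n + 2 - p - i \<le> A - B + (n + 1 - g)" for A B C Z p r g n :: real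
      using that by linarith
    show ?thesis
    proof (rule lin)
      show "z * (i * i * i) / (8 * \<tau>) \<le> z / (8 * \<tau>)"
        using 1 \<tau> by (intro divide_right_mono) auto
      show "z / (4 * \<tau>) = z / (8 * \<tau>) + z / (8 * \<tau>)" by (simp add: field_simps)
      show "(1 - i) * i \<le> 1 - i" using 2 by simp
      show "\<nu> + 2 - (1 + \<nu>) * i - i \<le> z / (8 * \<tau>) - z * i / (8 * \<tau>) + (\<nu> + 1 - 2 * \<gamma>)"
        using 3 by (simp add: diff_divide_distrib algebra_simps)
    qed
  qed
  then have "2 * \<gamma> / (2 * \<tau>) \<le> (z / (4 * \<tau>) + (1 + \<nu>) * i - (1 - i) * i - z * i / (8 * \<tau>) - z * (i * i * i) / (8 * \<tau>)) / (2 * \<tau>)"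
    using \<tau> by (intro divide_right_mono) auto
  then have f0: "\<gamma> / \<tau> \<le> z / (4 * \<tau>) / (2 * \<tau>) + (1 + \<nu>) * i / (2 * \<tau>) - (1 - i) * i / (2 * \<tau>)
      - z * i / (8 * \<tau>) / (2 * \<tau>) - z * (i * i * i) / (8 * \<tau>) / (2 * \<tau>)"
    by (simp add: add_divide_distrib diff_divide_distrib)
  have e1: "cap \<epsilon> s = z" by (simp add: cap_def z_def i_def D_def)
  have e2: "(2 + 2 * \<nu>) * (1 / (4 * \<tau> * D)) = (1 + \<nu>) * i / (2 * \<tau>)"
    using D \<tau> by (simp add: i_def divide_simps)
  have e3: "2 * s * (\<epsilon> / (4 * \<tau> * D\<^sup>2)) = (1 - i) * i / (2 * \<tau>)"
    unfolding ez[symmetric] by (simp add: z_def i_def power2_eq_square)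
  have e4: "s * (1 / (4 * \<tau> * D))\<^sup>2 = z * i / (8 * \<tau>) / (2 * \<tau>)"
    by (simp add: z_def i_def power2_eq_square)
  have e5: "s * (1 / (4 * \<tau> * D\<^sup>2))\<^sup>2 = z * (i * i * i) / (8 * \<tau>) / (2 * \<tau>)"
    by (simp add: z_def i_def power2_eq_square)
  have e6: "z / (8 * \<tau>\<^sup>2) = z / (4 * \<tau>) / (2 * \<tau>)" by (simp add: power2_eq_square)
  show ?thesis unfolding e1 e2 e3 e4 e5 e6 using f0 by linarith
qed

text \<open>In a straight wedge with \<epsilon> = 0, the optimal field in the ground state method is
  the one for which ((A, B) - \<nabla>W/2)/W is the gradient of log (r^\<nu> sin(\<nu>\<phi>)
  e^(-r^2/(4\<tau>))). Its radial and rotational parts are kept in the form q x + e c (-snd x, fst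
  x), where the cotangent c is evaluated at the curved angle and 1/(4\<tau>) is damped to k.\<close>

lemma wedge_inequality:
  assumes a: "0 < a" "a \<le> 1" and \<theta>: "\<And>r. r > 0 \<Longrightarrow> (\<theta> has_real_derivative \<theta>' r) (at r)"
    and \<theta>': "continuous_on {0<..} \<theta>'"
    and \<phi>: "Cc1 (curved_wedge \<theta> a) \<phi> d1 d2"
    and \<tau>: "0 < \<tau>" and \<epsilon>: "0 < \<epsilon>"
  defines "\<nu> \<equiv> 1 / (2 * a)"
  assumes small: "\<epsilon> * (2 * \<tau> * (\<nu> + 2)\<^sup>2) \<le> \<nu> + 1 - 2 * \<gamma>"
  defines "W \<equiv> \<lambda>x. weight \<epsilon> \<tau> (sqn x)"
    and "W1 \<equiv> \<lambda>x. weight \<epsilon> \<tau> (sqn x) / (4 * \<tau> * (1 + \<epsilon> * sqn x)\<^sup>2) * (2 * fst x)"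
    and "W2 \<equiv> \<lambda>x. weight \<epsilon> \<tau> (sqn x) / (4 * \<tau> * (1 + \<epsilon> * sqn x)\<^sup>2) * (2 * snd x)"
  shows "(LINT x|lborel. W x * (\<gamma> / \<tau> - cap \<epsilon> (sqn x) / (8 * \<tau>\<^sup>2)) * (\<phi> x)\<^sup>2)
    \<le> (LINT x|lborel. d1 x * (d1 x * W x + \<phi> x * W1 x) + d2 x * (d2 x * W x + \<phi> x * W2 x))"
proof -
  let ?\<Omega> = "curved_wedge \<theta> a"
  define w where "w = weight \<epsilon> \<tau>"
  define w' where "w' s = w s / (4 * \<tau> * (1 + \<epsilon> * s)\<^sup>2)" for s
  define k where "k s = 1 / (4 * \<tau> * (1 + \<epsilon> * s))" for s
  define q where "q s = w s * (\<nu> / s - k s)" for s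
  define q' where "q' s = w' s * (\<nu> / s - k s) + w s * (- \<nu> / s\<^sup>2 + \<epsilon> / (4 * \<tau> * (1 + \<epsilon> * s)\<^sup>2))" for s
  define e where "e s = w s * (\<nu> / s)" for s
  define e' where "e' s = w' s * (\<nu> / s) - w s * (\<nu> / s\<^sup>2)" for s
  define c where "c x = cot (\<nu> * wedge_angle \<theta> x)" for x
  have \<nu>: "0 < \<nu>" using a by (simp add: \<nu>_def)
  have D: "1 \<le> 1 + \<epsilon> * s" if "0 \<le> s" for s using that \<epsilon> by simp
  have D0: "1 + \<epsilon> * s \<noteq> 0" if "0 \<le> s" for s using D[OF that] by linarith
  have w_pos: "0 < w s" for s by (simp add: w_def weight_def)
  have dw: "(w has_real_derivative w' s) (at s)" if "0 \<le> s" for s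
    unfolding w_def w'_def using DERIV_weight[OF \<epsilon> \<tau> that] by simp
  have cw: "continuous_on {0..} w" by (rule DERIV_continuous_on, rule DERIV_subset[OF dw]) auto
  have cw': "continuous_on {0..} w'"
    unfolding w'_def[abs_def] by (intro continuous_intros cw) (use D0 \<tau> in auto)
  have dk: "(k has_real_derivative - \<epsilon> / (4 * \<tau> * (1 + \<epsilon> * s)\<^sup>2)) (at s)" if "0 \<le> s" for s
  proof -
    have "((\<lambda>s. 1 / (4 * \<tau>) * inverse (1 + \<epsilon> * s)) has_real_derivative - \<epsilon> / (4 * \<tau> * (1 + \<epsilon> * s)\<^sup>2)) (at s)"
      using D[OF that] \<tau> by (auto intro!: derivative_eq_intros simp: power2_eq_square inverse_eq_divide)
    then show ?thesis by (simp add: k_def[abs_def] inverse_eq_divide)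
  qed
  have ck: "continuous_on {0..} k" by (rule DERIV_continuous_on, rule DERIV_subset[OF dk]) auto
  have dinv: "((\<lambda>s. \<nu> / s) has_real_derivative - \<nu> / s\<^sup>2) (at s)" if "0 < s" for s
    using that by (auto intro!: derivative_eq_intros simp: power2_eq_square)
  have dq: "(q has_real_derivative q' s) (at s)" if "0 < s" for s
    unfolding q_def[abs_def] using that
    by (intro DERIV_cong[OF DERIV_mult[OF dw DERIV_diff[OF dinv dk]]]) (simp_all add: q'_def mult.commute)
  have de: "(e has_real_derivative e' s) (at s)" if "0 < s" for s
    unfolding e_def[abs_def] using that
    by (intro DERIV_cong[OF DERIV_mult[OF dw dinv]]) (simp_all add: e'_def mult.commute)
  have sub: "{0<..} \<subseteq> {0::real..}" by auto
  note cw0 = continuous_on_subset[OF cw sub] and cw0' = continuous_on_subset[OF cw' sub] and ck0 = continuous_on_subset[OF ck sub]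
  have cq': "continuous_on {0<..} q'"
    unfolding q'_def[abs_def] by (intro continuous_intros cw0 cw0' ck0) (use D0 \<tau> in auto)+
  have ce': "continuous_on {0<..} e'"
    unfolding e'_def[abs_def] by (intro continuous_intros cw0 cw0') auto
  have \<Omega>0: "x \<noteq> 0" "0 < sqn x" if "x \<in> ?\<Omega>" for x
    using that curved_wedge_iff[OF a] sqn_pos by auto
  have im: "sqn ` ?\<Omega> \<subseteq> {0<..}" using \<Omega>0 by auto
  have open_\<Omega>: "open ?\<Omega>" by (rule open_curved_wedge[OF a \<theta>])
  have W: "C1_on UNIV W W1 W2"
    unfolding W_def W1_def W2_def by (rule C1_on_weight[OF \<epsilon> \<tau>])
  have Wp: "0 < W x" for x by (simp add: W_def weight_def)
  have Q: "C1_on ?\<Omega> (\<lambda>x. q (sqn x)) (\<lambda>x. q' (sqn x) * (2 * fst x)) (\<lambda>x. q' (sqn x) * (2 * snd x))"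
    by (rule C1_on_radial) (use dq im continuous_on_subset[OF cq' im] in auto)
  have E: "C1_on ?\<Omega> (\<lambda>x. e (sqn x)) (\<lambda>x. e' (sqn x) * (2 * fst x)) (\<lambda>x. e' (sqn x) * (2 * snd x))"
    by (rule C1_on_radial) (use de im continuous_on_subset[OF ce' im] in auto)
  note ang = C1_on_cmult[OF C1_on_wedge_angle[OF a \<theta> \<theta>'], of \<nu>]
  have sin0: "sin (\<nu> * wedge_angle \<theta> x) \<noteq> 0" if "x \<in> ?\<Omega>" for x
    using sin_wedge_angle_pos[OF a that] by (simp add: \<nu>_def)
  have C: "C1_on ?\<Omega> c (\<lambda>x. - inverse ((sin (\<nu> * wedge_angle \<theta> x))\<^sup>2) * (\<nu> * wedge_angle1 \<theta>' x))
      (\<lambda>x. - inverse ((sin (\<nu> * wedge_angle \<theta> x))\<^sup>2) * (\<nu> * wedge_angle2 \<theta>' x))"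
    unfolding c_def[abs_def]
    by (rule C1_on_compose[OF ang]) (use sin0 in \<open>auto intro!: continuous_intros C1_on_continuous[OF ang]\<close>)
  note EC = C1_on_mult[OF E C]
  note A = C1_on_diff[OF C1_on_mult[OF C1_on_fst Q] C1_on_mult[OF C1_on_snd EC]]
  note B = C1_on_add[OF C1_on_mult[OF C1_on_snd Q] C1_on_mult[OF C1_on_fst EC]]
  show ?thesis
  proof (rule ground_state_inequality[OF open_\<Omega> \<phi> W Wp A B])
    show "continuous_on UNIV (\<lambda>x. W x * (\<gamma> / \<tau> - cap \<epsilon> (sqn x) / (8 * \<tau>\<^sup>2)))"
      unfolding cap_def
      by (intro continuous_intros C1_on_continuous[OF W])
        (use D0[OF sqn_nonneg] \<tau> in auto)
    fix x assume x: "x \<in> ?\<Omega>"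
    define s where "s = sqn x"
    define m where "m = 1 / (4 * \<tau> * (1 + \<epsilon> * s)\<^sup>2)"
    have s: "0 < s" using \<Omega>0[OF x] by (simp add: s_def)
    define j where "j = inverse ((sin (\<nu> * wedge_angle \<theta> x))\<^sup>2)"
    \<comment> \<open>Through 1/sin^2 = 1 + cot^2 the divergence of the angular field absorbs its
      square; the \<nu>^2/s left over cancels the one from the square of the radial part in
      \<open>main\<close>.\<close>
    have j: "j = 1 + (c x)\<^sup>2"
      using sin0[OF x] by (simp add: j_def c_def cot_def field_simps)
    have ss: "fst x * fst x + snd x * snd x = s" by (simp add: s_def sqn_def power2_eq_square)
    have rot: "fst x * wedge_angle2 \<theta>' x - snd x * wedge_angle1 \<theta>' x = 1"
      by (rule wedge_angle_rotation[OF \<Omega>0(1)[OF x]])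
    have div: "(1 * q (sqn x) + fst x * (q' (sqn x) * (2 * fst x))
           - (0 * (e (sqn x) * c x) + snd x * (e' (sqn x) * (2 * fst x) * c x + e (sqn x) * (- j * (\<nu> * wedge_angle1 \<theta>' x)))))
        + (1 * q (sqn x) + snd x * (q' (sqn x) * (2 * snd x))
           + (0 * (e (sqn x) * c x) + fst x * (e' (sqn x) * (2 * snd x) * c x + e (sqn x) * (- j * (\<nu> * wedge_angle2 \<theta>' x)))))
        = 2 * q s + 2 * s * q' s - e s * \<nu> * j"
    proof -
      have "(1 * Q + X * (Q' * (2 * X)) - (0 * (E * C) + Y * (E' * (2 * X) * C + E * (- j * (\<nu> * A1)))))
        + (1 * Q + Y * (Q' * (2 * Y)) + (0 * (E * C) + X * (E' * (2 * Y) * C + E * (- j * (\<nu> * A2)))))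
        = 2 * Q + 2 * (X * X + Y * Y) * Q' - E * \<nu> * j * (X * A2 - Y * A1)" for Q Q' X Y E E' C A1 A2
        by (simp add: algebra_simps)
      then show ?thesis by (simp only: ss rot s_def[symmetric] mult_1_right)
    qed
    have sq: "(fst x * q (sqn x) - snd x * (e (sqn x) * c x) - W1 x / 2)\<^sup>2 + (snd x * q (sqn x) + fst x * (e (sqn x) * c x) - W2 x / 2)\<^sup>2
        = s * ((q s - m * w s)\<^sup>2 + (e s * c x)\<^sup>2)"
    proof -
      have W12: "W1 x = m * w s * (2 * fst x)" "W2 x = m * w s * (2 * snd x)"
        by (simp_all add: W1_def W2_def m_def s_def w_def)
      have "(X * Q - Y * F - G * (2 * X) / 2)\<^sup>2 + (Y * Q + X * F - G * (2 * Y) / 2)\<^sup>2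
        = (X * X + Y * Y) * ((Q - G)\<^sup>2 + F\<^sup>2)" for X Y Q F G :: real
        by (simp add: power2_eq_square algebra_simps)
      then show ?thesis by (simp only: W12 ss s_def[symmetric])
    qed
    have Ws: "W x = w s" by (simp add: W_def w_def s_def)
    have main: "- (2 * q s + 2 * s * q' s - e s * \<nu> * j) - s * ((q s - m * w s)\<^sup>2 + (e s * c x)\<^sup>2) / w s
      = w s * ((2 + 2 * \<nu>) * k s - 2 * s * (\<epsilon> * m) - s * (k s)\<^sup>2 - s * m\<^sup>2)"
    proof -
      have w': "w' s = m * w s" by (simp add: w'_def m_def)
      have q'': "q' s = m * w s * (\<nu> / s - k s) + w s * (- \<nu> / s\<^sup>2 + \<epsilon> * m)"
        by (simp add: q'_def w' m_def)
      have "- (2 * (U * (\<nu> / s - K)) + 2 * s * (m * U * (\<nu> / s - K) + U * (- \<nu> / s\<^sup>2 + L)) - (U * (\<nu> / s)) * \<nu> * (1 + C\<^sup>2))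
          - s * ((U * (\<nu> / s - K) - m * U)\<^sup>2 + (U * (\<nu> / s) * C)\<^sup>2) / U
        = U * ((2 + 2 * \<nu>) * K - 2 * s * L - s * K\<^sup>2 - s * m\<^sup>2)" if "U \<noteq> 0" for U K L C :: real
        using s that by (simp add: field_simps power2_eq_square)
      from this[of "w s" "k s" "\<epsilon> * m" "c x"] show ?thesis
        using w_pos[of s] by (simp only: q'' q_def[of s] e_def[of s] j)
    qed
    have "\<gamma> / \<tau> - cap \<epsilon> s / (8 * \<tau>\<^sup>2) \<le> (2 + 2 * \<nu>) * k s - 2 * s * (\<epsilon> * m) - s * (k s)\<^sup>2 - s * m\<^sup>2"
      using oscillator_inequality[OF less_imp_le[OF s] \<tau> \<epsilon> less_imp_le[OF \<nu>] small] by (simp add: k_def m_def)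
    then have "w s * (\<gamma> / \<tau> - cap \<epsilon> s / (8 * \<tau>\<^sup>2))
        \<le> w s * ((2 + 2 * \<nu>) * k s - 2 * s * (\<epsilon> * m) - s * (k s)\<^sup>2 - s * m\<^sup>2)"
      using w_pos[of s] by (intro mult_left_mono) auto
    then show "W x * (\<gamma> / \<tau> - cap \<epsilon> (sqn x) / (8 * \<tau>\<^sup>2)) \<le> - (1 * q (sqn x) + fst x * (q' (sqn x) * (2 * fst x))
           - (0 * (e (sqn x) * c x) + snd x * (e' (sqn x) * (2 * fst x) * c x + e (sqn x) * (- inverse ((sin (\<nu> * wedge_angle \<theta> x))\<^sup>2) * (\<nu> * wedge_angle1 \<theta>' x))))
        + (1 * q (sqn x) + snd x * (q' (sqn x) * (2 * snd x))
           + (0 * (e (sqn x) * c x) + fst x * (e' (sqn x) * (2 * snd x) * c x + e (sqn x) * (- inverse ((sin (\<nu> * wedge_angle \<theta> x))\<^sup>2) * (\<nu> * wedge_angle2 \<theta>' x))))))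
        - ((fst x * q (sqn x) - snd x * (e (sqn x) * c x) - W1 x / 2)\<^sup>2 + (snd x * q (sqn x) + fst x * (e (sqn x) * c x) - W2 x / 2)\<^sup>2) / W x"
      unfolding j_def[symmetric] unfolding div sq unfolding Ws main s_def[symmetric] .
  qed
qed

text \<open>Leibniz rule for test functions, carried to the closure by continuity of bounded
  multipliers; it makes W u an admissible test function for the form.\<close>

lemma grad_graph_mult:
  assumes W: "C1_on UNIV W W1 W2" and b: "bounded_by B W" "bounded_by B1 W1" "bounded_by B2 W2"
    and u: "(u, g1, g2) \<in> grad_graph \<Omega>" and \<Omega>: "open \<Omega>"
  shows "(mul W u, mul W g1 + mul W1 u, mul W g2 + mul W2 u) \<in> grad_graph \<Omega>"
proof -
  let ?T = "\<lambda>p. (mul W (fst p), mul W (fst (snd p)) + mul W1 (fst p), mul W (snd (snd p)) + mul W2 (fst p))"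
  have c: "continuous_on UNIV (mul W)" "continuous_on UNIV (mul W1)" "continuous_on UNIV (mul W2)"
    using bounded_linear_mul[OF b(1)] bounded_linear_mul[OF b(2)] bounded_linear_mul[OF b(3)] linear_continuous_on
    by blast+
  have cT: "continuous_on (grad_graph \<Omega>) ?T"
    by (intro continuous_intros continuous_on_compose2[OF c(1)] continuous_on_compose2[OF c(2)]
        continuous_on_compose2[OF c(3)]) auto
  have "?T p \<in> smooth_graph \<Omega>" if p: "p \<in> smooth_graph \<Omega>" for p
  proof -
    obtain \<phi> d1 d2 where \<phi>: "Cc1 \<Omega> \<phi> d1 d2" and p: "p = (cls \<phi>, cls d1, cls d2)"
      using p unfolding smooth_graph_def by blast
    note s = Cc1_square_integrable[OF \<phi>]
    note sb = square_integrable_bounded_mult[OF b(1)] square_integrable_bounded_mult[OF b(2)]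
      square_integrable_bounded_mult[OF b(3)]
    have "Cc1 \<Omega> (\<lambda>x. \<phi> x * W x) (\<lambda>x. d1 x * W x + \<phi> x * W1 x) (\<lambda>x. d2 x * W x + \<phi> x * W2 x)"
      by (rule Cc1_mult[OF \<Omega> \<phi> C1_on_subset[OF W]]) auto
    then have "Cc1 \<Omega> (\<lambda>x. W x * \<phi> x) (\<lambda>x. W x * d1 x + W1 x * \<phi> x) (\<lambda>x. W x * d2 x + W2 x * \<phi> x)"
      by (simp add: mult.commute)
    from smooth_graphI[OF this] show ?thesis
      by (simp add: p mul_cls[OF b(1)] mul_cls[OF b(2)] mul_cls[OF b(3)] s cls_add sb)
  qed
  then have "?T ` closure (smooth_graph \<Omega>) \<subseteq> closure (smooth_graph \<Omega>)"
    using cT unfolding grad_graph_def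
    by (intro image_closure_subset) (auto intro: subsetD[OF closure_subset])
  from subsetD[OF this[folded grad_graph_def] imageI[OF u]] show ?thesis by simp
qed

text \<open>Both sides are continuous in the graph norm, so an inequality for test functions holds
  on the whole form domain.\<close>

lemma grad_graph_inequality:
  assumes \<Omega>: "open \<Omega>" and b: "bounded_by B W" "bounded_by B1 W1" "bounded_by B2 W2" "bounded_by B3 P"
    and le: "\<And>\<phi> d1 d2. Cc1 \<Omega> \<phi> d1 d2 \<Longrightarrow> (LINT x|lborel. P x * (\<phi> x)\<^sup>2)
      \<le> (LINT x|lborel. d1 x * (d1 x * W x + \<phi> x * W1 x) + d2 x * (d2 x * W x + \<phi> x * W2 x))"
    and u: "(u, g1, g2) \<in> grad_graph \<Omega>"
  shows "inner (mul P u) u \<le> inner g1 (mul W g1 + mul W1 u) + inner g2 (mul W g2 + mul W2 u)"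
proof -
  have c: "continuous_on UNIV (mul W)" "continuous_on UNIV (mul W1)" "continuous_on UNIV (mul W2)"
      "continuous_on UNIV (mul P)"
    using bounded_linear_mul[OF b(1)] bounded_linear_mul[OF b(2)] bounded_linear_mul[OF b(3)]
      bounded_linear_mul[OF b(4)] linear_continuous_on by blast+
  note cc = continuous_on_compose2[OF c(1)] continuous_on_compose2[OF c(2)]
        continuous_on_compose2[OF c(3)] continuous_on_compose2[OF c(4)]
  let ?S = "{p. inner (mul P (fst p)) (fst p) \<le>
      inner (fst (snd p)) (mul W (fst (snd p)) + mul W1 (fst p)) + inner (snd (snd p)) (mul W (snd (snd p)) + mul W2 (fst p))}"
  have "closed ?S"
    by (intro closed_Collect_le continuous_intros cc) auto
  moreover have "smooth_graph \<Omega> \<subseteq> ?S"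
  proof
    fix p assume "p \<in> smooth_graph \<Omega>"
    then obtain \<phi> d1 d2 where \<phi>: "Cc1 \<Omega> \<phi> d1 d2" and p: "p = (cls \<phi>, cls d1, cls d2)"
      unfolding smooth_graph_def by blast
    note s = Cc1_square_integrable[OF \<phi>]
    note sb = square_integrable_bounded_mult[OF b(1)] square_integrable_bounded_mult[OF b(2)]
      square_integrable_bounded_mult[OF b(3)] square_integrable_bounded_mult[OF b(4)]
    have 1: "inner (mul P (cls \<phi>)) (cls \<phi>) = (LINT x|lborel. P x * (\<phi> x)\<^sup>2)"
      by (simp add: mul_cls[OF b(4)] s inner_cls sb power2_eq_square mult.assoc)
    have 2: "inner (cls d) (mul W (cls d) + mul W' (cls \<phi>)) = (LINT x|lborel. d x * (d x * W x + \<phi> x * W' x))"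
      "integrable lborel (\<lambda>x. d x * (d x * W x + \<phi> x * W' x))"
      if b': "bounded_by C W'" and d: "square_integrable d" for C W' d
    proof -
      note s' = square_integrable_bounded_mult[OF b']
      have eq: "(\<lambda>x. d x * (W x * d x + W' x * \<phi> x)) = (\<lambda>x. d x * (d x * W x + \<phi> x * W' x))"
        by (simp add: mult.commute)
      have "mul W (cls d) + mul W' (cls \<phi>) = cls (\<lambda>x. W x * d x + W' x * \<phi> x)"
        by (simp add: mul_cls[OF b(1)] mul_cls[OF b'] d s cls_add sb s')
      then show "inner (cls d) (mul W (cls d) + mul W' (cls \<phi>)) = (LINT x|lborel. d x * (d x * W x + \<phi> x * W' x))"
        using inner_cls[OF d square_integrable_add[OF sb(1)[OF d] s'[OF s(1)]]] by (simp add: eq)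
      show "integrable lborel (\<lambda>x. d x * (d x * W x + \<phi> x * W' x))"
        using square_integrable_mult[OF d square_integrable_add[OF sb(1)[OF d] s'[OF s(1)]]] by (simp add: eq)
    qed
    show "p \<in> ?S"
      using le[OF \<phi>] Bochner_Integration.integral_add[OF 2(2)[OF b(2) s(2)] 2(2)[OF b(3) s(3)]]
      by (simp add: p 1 2(1)[OF b(2) s(2)] 2(1)[OF b(3) s(3)])
  qed
  ultimately have "grad_graph \<Omega> \<subseteq> ?S" unfolding grad_graph_def by (rule closure_minimal[rotated])
  with u show ?thesis by auto
qed

lemma weight_bounds:
  assumes "0 < \<epsilon>" "0 < \<tau>" "0 \<le> s"
  shows "1 \<le> weight \<epsilon> \<tau> s" "weight \<epsilon> \<tau> s \<le> exp (1 / (4 * \<epsilon> * \<tau>))"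
proof -
  note c = cap_bounds[OF assms(1,3)]
  show "1 \<le> weight \<epsilon> \<tau> s" using c assms by (simp add: weight_def)
  have "cap \<epsilon> s / (4 * \<tau>) \<le> (1 / \<epsilon>) / (4 * \<tau>)"
    using c assms by (intro divide_right_mono) auto
  then show "weight \<epsilon> \<tau> s \<le> exp (1 / (4 * \<epsilon> * \<tau>))" by (simp add: weight_def mult_ac)
qed

lemma bounded_by_continuous:
  "continuous_on UNIV m \<Longrightarrow> (\<And>x. \<bar>m x\<bar> \<le> B) \<Longrightarrow> bounded_by B m"
  by (simp add: bounded_by_def borel_measurable_continuous_onI)

lemma bounded_by_weight:
  assumes "0 < \<epsilon>" "0 < \<tau>"
  defines "B \<equiv> exp (1 / (4 * \<epsilon> * \<tau>))"
  shows "bounded_by B (\<lambda>x. weight \<epsilon> \<tau> (sqn x))"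
    and "bounded_by (B / (4 * \<tau>) * (1 + 1 / \<epsilon>)) (\<lambda>x. weight \<epsilon> \<tau> (sqn x) / (4 * \<tau> * (1 + \<epsilon> * sqn x)\<^sup>2) * (2 * fst x))"
    and "bounded_by (B / (4 * \<tau>) * (1 + 1 / \<epsilon>)) (\<lambda>x. weight \<epsilon> \<tau> (sqn x) / (4 * \<tau> * (1 + \<epsilon> * sqn x)\<^sup>2) * (2 * snd x))"
proof -
  note W = C1_on_weight[OF assms(1,2)]
  have wb: "0 < weight \<epsilon> \<tau> (sqn x)" "weight \<epsilon> \<tau> (sqn x) \<le> B" for x
    using weight_bounds[OF assms(1,2), of "sqn x"] by (auto simp: B_def weight_def)
  show "bounded_by B (\<lambda>x. weight \<epsilon> \<tau> (sqn x))"
    using wb C1_on_continuous[OF W] unfolding bounded_by_def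
    by (auto intro: borel_measurable_continuous_onI simp: abs_of_pos)
  have key: "\<bar>weight \<epsilon> \<tau> (sqn x) / (4 * \<tau> * (1 + \<epsilon> * sqn x)\<^sup>2) * (2 * t)\<bar> \<le> B / (4 * \<tau>) * (1 + 1 / \<epsilon>)"
    if t: "t\<^sup>2 \<le> sqn x" for t x
  proof -
    let ?D = "1 + \<epsilon> * sqn x"
    have D: "1 \<le> ?D" using assms by simp
    \<comment> \<open>The gradient of the weight carries a factor x, which the powers of 1 +
      \<epsilon>|x|^2 in the denominator absorb.\<close>
    have "2 * \<bar>t\<bar> \<le> 1 + t\<^sup>2" using sum_squares_bound[of 1 "\<bar>t\<bar>"] by simp
    also have "\<dots> \<le> 1 + sqn x" using t by simp
    also have "\<dots> \<le> (1 + 1 / \<epsilon>) * ?D" using assms by (simp add: field_simps)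
    also have "\<dots> \<le> (1 + 1 / \<epsilon>) * ?D\<^sup>2"
      using assms by (intro mult_left_mono self_le_power[OF D]) auto
    finally have "2 * \<bar>t\<bar> / ?D\<^sup>2 \<le> 1 + 1 / \<epsilon>" using D by (simp add: divide_le_eq)
    moreover have "weight \<epsilon> \<tau> (sqn x) / (4 * \<tau>) \<le> B / (4 * \<tau>)"
      using wb[of x] assms by (intro divide_right_mono) auto
    ultimately have "weight \<epsilon> \<tau> (sqn x) / (4 * \<tau>) * (2 * \<bar>t\<bar> / ?D\<^sup>2) \<le> B / (4 * \<tau>) * (1 + 1 / \<epsilon>)"
      using wb[of x] assms by (intro mult_mono) auto
    moreover have "\<bar>weight \<epsilon> \<tau> (sqn x) / (4 * \<tau> * ?D\<^sup>2) * (2 * t)\<bar> = weight \<epsilon> \<tau> (sqn x) / (4 * \<tau>) * (2 * \<bar>t\<bar> / ?D\<^sup>2)"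
      using wb(1)[of x] assms by (simp add: abs_mult)
    ultimately show ?thesis by simp
  qed
  have q: "(fst x)\<^sup>2 \<le> sqn x" "(snd x)\<^sup>2 \<le> sqn x" for x by (auto simp: sqn_def)
  have c: "continuous_on UNIV (\<lambda>x. weight \<epsilon> \<tau> (sqn x) / (4 * \<tau> * (1 + \<epsilon> * sqn x)\<^sup>2) * (2 * fst x))"
    "continuous_on UNIV (\<lambda>x. weight \<epsilon> \<tau> (sqn x) / (4 * \<tau> * (1 + \<epsilon> * sqn x)\<^sup>2) * (2 * snd x))"
    using W unfolding C1_on_def by blast+
  show "bounded_by (B / (4 * \<tau>) * (1 + 1 / \<epsilon>)) (\<lambda>x. weight \<epsilon> \<tau> (sqn x) / (4 * \<tau> * (1 + \<epsilon> * sqn x)\<^sup>2) * (2 * fst x))"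
    by (rule bounded_by_continuous[OF c(1) key[OF q(1)]])
  show "bounded_by (B / (4 * \<tau>) * (1 + 1 / \<epsilon>)) (\<lambda>x. weight \<epsilon> \<tau> (sqn x) / (4 * \<tau> * (1 + \<epsilon> * sqn x)\<^sup>2) * (2 * snd x))"
    by (rule bounded_by_continuous[OF c(2) key[OF q(2)]])
qed

text \<open>The multiplier \<open>(1 + t)\<^bsup>2\<gamma>\<^esup> weight \<epsilon> (1 + t) (\<bar>x\<bar>\<^sup>2)\<close> of the Lyapunov functional; \<open>y\<close> stands for
  \<open>cap \<epsilon> (\<bar>x\<bar>\<^sup>2)\<close>.\<close>

definition lyapunov :: "real \<Rightarrow> real \<Rightarrow> real \<Rightarrow> real" where
  "lyapunov \<gamma> t y = (1 + t) powr (2 * \<gamma>) * exp (y / (4 * (1 + t)))"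

text \<open>Time derivative of \<open>lyapunov\<close>, with the factor 2 taken out so that the last
  bracket is the one in the potential of \<open>wedge_inequality\<close> at \<tau> = 1 + t.\<close>

definition lyapunov' :: "real \<Rightarrow> real \<Rightarrow> real \<Rightarrow> real" where
  "lyapunov' \<gamma> t y = (1 + t) powr (2 * \<gamma>) * (exp (y / (4 * (1 + t))) * (2 * (\<gamma> / (1 + t) - y / (8 * (1 + t)\<^sup>2))))"

lemma DERIV_lyapunov:
  assumes "0 \<le> t"
  shows "((\<lambda>t. lyapunov \<gamma> t y) has_real_derivative lyapunov' \<gamma> t y) (at t)"
proof -
  have 1: "((\<lambda>t. (1 + t) powr (2 * \<gamma>)) has_real_derivative (1 + t) powr (2 * \<gamma>) * (2 * \<gamma> / (1 + t))) (at t)"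
  proof (rule DERIV_cong[OF DERIV_fun_powr])
    show "((\<lambda>t. 1 + t) has_real_derivative 1) (at t)" by (auto intro!: derivative_eq_intros)
    have pd: "(1 + t) powr (2 * \<gamma> - 1) = (1 + t) powr (2 * \<gamma>) / (1 + t)"
      unfolding powr_diff using assms by simp
    show "2 * \<gamma> * (1 + t) powr (2 * \<gamma> - of_nat 1) * 1 = (1 + t) powr (2 * \<gamma>) * (2 * \<gamma> / (1 + t))"
      unfolding of_nat_1 pd by simp
  qed (use assms in simp)
  have "((\<lambda>t. inverse (1 + t)) has_real_derivative - inverse ((1 + t)\<^sup>2)) (at t)"
  proof -
    have "((\<lambda>t. 1 + t) has_real_derivative 1) (at t)" by (auto intro!: derivative_eq_intros)
    from DERIV_inverse_fun[OF this] assms show ?thesis by (simp add: power2_eq_square)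
  qed
  then have 2: "((\<lambda>t. y / 4 * inverse (1 + t)) has_real_derivative y / 4 * - inverse ((1 + t)\<^sup>2)) (at t)"
    by (rule DERIV_cmult)
  have f: "y / 4 * inverse (1 + t) = y / (4 * (1 + t))" for t by (simp add: inverse_eq_divide)
  have eq: "p * (2 * u) * e + e * (- (2 * v)) * p = p * (e * (2 * (u - v)))" for p u e v :: real
    by (simp add: algebra_simps)
  show ?thesis
    unfolding lyapunov_def[abs_def] lyapunov'_def
  proof (rule DERIV_cong[OF DERIV_mult[OF 1 DERIV_chain2[OF DERIV_exp 2[unfolded f]]]])
    have "2 * \<gamma> / (1 + t) = 2 * (\<gamma> / (1 + t))"
      "y / 4 * - inverse ((1 + t)\<^sup>2) = - (2 * (y / (8 * (1 + t)\<^sup>2)))" by (simp_all add: inverse_eq_divide)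
    then show "(1 + t) powr (2 * \<gamma>) * (2 * \<gamma> / (1 + t)) * exp (y / (4 * (1 + t)))
        + exp (y / (4 * (1 + t))) * (y / 4 * - inverse ((1 + t)\<^sup>2)) * (1 + t) powr (2 * \<gamma>)
      = (1 + t) powr (2 * \<gamma>) * (exp (y / (4 * (1 + t))) * (2 * (\<gamma> / (1 + t) - y / (8 * (1 + t)\<^sup>2))))"
      by (simp only: eq)
  qed
qed

section \<open>Time-dependent multipliers along a curve\<close>

lemma tendsto_mul:
  assumes m: "\<And>s. s \<in> T \<Longrightarrow> bounded_by B (m s)" and t: "t \<in> T"
    and c: "\<And>s x. s \<in> T \<Longrightarrow> \<bar>m s x - m t x\<bar> \<le> c s" "(c \<longlongrightarrow> 0) (at t within T)"
    and U: "(U \<longlongrightarrow> U t) (at t within T)"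
  shows "((\<lambda>s. mul (m s) (U s)) \<longlongrightarrow> mul (m t) (U t)) (at t within T)"
proof (rule LIM_zero_cancel, rule Lim_null_comparison)
  have "norm (mul (m s) (U s) - mul (m t) (U t)) \<le> B * norm (U s - U t) + c s * norm (U t)" if s: "s \<in> T" for s
  proof -
    have b: "bounded_by (c s) (\<lambda>x. m s x - m t x)"
      using c(1)[OF s] bounded_by_measurable[OF bounded_by_diff[OF m[OF s] m[OF t]]] by (simp add: bounded_by_def)
    have "mul (m s) (U s - U t) + mul (\<lambda>x. m s x - m t x) (U t) = mul (m s) (U s) - mul (m t) (U t)"
      using mul_add_right[OF m[OF s], of "U s - U t" "U t"] by (simp add: mul_diff_left[OF m[OF s] m[OF t]])
    then show ?thesis
      using norm_mul_le[OF m[OF s], of "U s - U t"] norm_mul_le[OF b, of "U t"]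
        norm_triangle_ineq[of "mul (m s) (U s - U t)" "mul (\<lambda>x. m s x - m t x) (U t)"] by simp
  qed
  then show "\<forall>\<^sub>F s in at t within T. norm (mul (m s) (U s) - mul (m t) (U t)) \<le> B * norm (U s - U t) + c s * norm (U t)"
    by (auto simp: eventually_at_filter)
  have "((\<lambda>s. B * norm (U s - U t) + c s * norm (U t)) \<longlongrightarrow> B * norm (U t - U t) + 0 * norm (U t)) (at t within T)"
    by (intro tendsto_intros U c(2))
  then show "((\<lambda>s. B * norm (U s - U t) + c s * norm (U t)) \<longlongrightarrow> 0) (at t within T)" by simp
qed

text \<open>If the multiplier depends on x only through \<open>y x\<close> in a compact set,
  estimates uniform in x follow from compactness of the product of [0, q] and Y. This serves the
  Lyapunov weight, where y is \<open>cap\<close> of |x|^2, and the comparison function, where y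
  records the angular mode and |x|^2.\<close>

lemma mul_curve:
  fixes b n :: "real \<Rightarrow> 'y::{metric_space,second_countable_topology} \<Rightarrow> real"
  assumes Y: "compact Y" and y: "y \<in> borel_measurable lborel" "\<And>x. y x \<in> Y"
    and b: "continuous_on ({0..q} \<times> Y) (\<lambda>(s, y). b s y)" "\<forall>t\<in>{0..q}. continuous_on UNIV (b t)"
    and n: "continuous_on ({0..q} \<times> Y) (\<lambda>(s, y). n s y)" "\<forall>t\<in>{0..q}. continuous_on UNIV (n t)"
    and der: "\<forall>s\<in>{0..q}. \<forall>z\<in>Y. ((\<lambda>s. b s z) has_real_derivative n s z) (at s)"
  defines "m \<equiv> \<lambda>t x. b t (y x)" and "m' \<equiv> \<lambda>t x. n t (y x)"
  shows "\<exists>B. \<forall>t\<in>{0..q}. bounded_by B (m t) \<and> bounded_by B (m' t)"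
    and "0 < t \<Longrightarrow> t < q \<Longrightarrow> (U has_vector_derivative U') (at t) \<Longrightarrow>
      ((\<lambda>s. mul (m s) (U s)) has_vector_derivative mul (m t) U' + mul (m' t) (U t)) (at t)"
    and "continuous_on {0..q} U \<Longrightarrow> continuous_on {0..q} (\<lambda>s. mul (m s) (U s))"
proof -
  let ?I = "{0..q}"
  have bdd: "\<exists>B. \<forall>t\<in>?I. \<forall>z\<in>Y. \<bar>f t z\<bar> \<le> B"
    if "continuous_on (?I \<times> Y) (\<lambda>(t, z). f t z)" for f :: "real \<Rightarrow> 'y \<Rightarrow> real"
  proof -
    have "compact ((\<lambda>(t, z). f t z) ` (?I \<times> Y))"
      by (intro compact_continuous_image that compact_Times compact_Icc Y)
    then obtain B where "\<forall>z\<in>(\<lambda>(t, z). f t z) ` (?I \<times> Y). norm z \<le> B"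
      using compact_imp_bounded bounded_iff by blast
    then show ?thesis by (intro exI[of _ B]) auto
  qed
  obtain B1 where B1: "\<And>t z. t \<in> ?I \<Longrightarrow> z \<in> Y \<Longrightarrow> \<bar>b t z\<bar> \<le> B1" using bdd[OF b(1)] by blast
  obtain B2 where B2: "\<And>t z. t \<in> ?I \<Longrightarrow> z \<in> Y \<Longrightarrow> \<bar>n t z\<bar> \<le> B2" using bdd[OF n(1)] by blast
  have meas: "(\<lambda>x. f (y x)) \<in> borel_measurable lborel" if "continuous_on UNIV f" for f :: "'y \<Rightarrow> real"
    by (rule measurable_compose[OF y(1) borel_measurable_continuous_onI[OF that]])
  have mB: "bounded_by (max B1 B2) (m t)" and mB': "bounded_by (max B1 B2) (m' t)" if t: "t \<in> ?I" for t
    using meas[OF b(2)[rule_format, OF t]] meas[OF n(2)[rule_format, OF t]] B1[OF t y(2)] B2[OF t y(2)]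
    unfolding bounded_by_def m_def m'_def by (auto simp: le_max_iff_disj)
  then show "\<exists>B. \<forall>t\<in>?I. bounded_by B (m t) \<and> bounded_by B (m' t)" by blast
  have unif: "\<exists>d>0. \<forall>s\<in>?I. \<bar>s - t\<bar> < d \<longrightarrow> (\<forall>x. \<bar>m s x - m t x - (s - t) * m' t x\<bar> \<le> e * \<bar>s - t\<bar>)"
    if t: "t \<in> ?I" and e: "e > 0" for t e
  proof -
    have der': "((\<lambda>s. b s z) has_real_derivative n s z) (at s within ?I)" if "s \<in> ?I" "z \<in> Y" for s z
      using DERIV_subset[OF der[rule_format, OF that]] by auto
    from uniform_difference_quotient[OF Y n(1) der' t e]
    obtain d where "d > 0" "\<And>s z. s \<in> ?I \<Longrightarrow> \<bar>s - t\<bar> < d \<Longrightarrow> z \<in> Y \<Longrightarrow>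
      \<bar>b s z - b t z - (s - t) * n t z\<bar> \<le> e * \<bar>s - t\<bar>" by blast
    then show ?thesis unfolding m_def m'_def using y(2) by blast
  qed
  show "((\<lambda>s. mul (m s) (U s)) has_vector_derivative mul (m t) U' + mul (m' t) (U t)) (at t)"
    if t: "0 < t" "t < q" and U: "(U has_vector_derivative U') (at t)"
  proof (rule mul_has_vector_derivative[of "{0<..<q}" "max B1 B2" m "max B1 B2"])
    show "\<exists>d>0. \<forall>s\<in>{0<..<q}. \<bar>s - t\<bar> < d \<longrightarrow> (\<forall>x. \<bar>m s x - m t x - (s - t) * m' t x\<bar> \<le> e * \<bar>s - t\<bar>)"
      if "e > 0" for e using unif[OF _ that, of t] t by fastforce
  qed (use mB mB' t U in auto)
  show "continuous_on ?I (\<lambda>s. mul (m s) (U s))" if U: "continuous_on ?I U"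
    unfolding continuous_on_def
  proof
    fix t assume t: "t \<in> ?I"
    obtain d where d: "d > 0" "\<And>s x. s \<in> ?I \<Longrightarrow> \<bar>s - t\<bar> < d \<Longrightarrow>
        \<bar>m s x - m t x - (s - t) * m' t x\<bar> \<le> 1 * \<bar>s - t\<bar>"
      using unif[OF t, of 1] by auto
    let ?J = "?I \<inter> ball t d"
    have Ut: "(U \<longlongrightarrow> U t) (at t within ?J)"
      using U t by (auto simp: continuous_on_def intro: tendsto_within_subset)
    have cb: "\<bar>m s x - m t x\<bar> \<le> (1 + max B1 B2) * \<bar>s - t\<bar>" if s: "s \<in> ?J" for s x
    proof -
      have "\<bar>m s x - m t x - (s - t) * m' t x\<bar> \<le> \<bar>s - t\<bar>" using d(2)[of s x] s by (auto simp: dist_real_def)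
      moreover have "\<bar>(s - t) * m' t x\<bar> \<le> \<bar>s - t\<bar> * max B1 B2"
        using mB'[OF t] unfolding bounded_by_def abs_mult by (intro mult_left_mono) auto
      moreover have "(1 + max B1 B2) * \<bar>s - t\<bar> = \<bar>s - t\<bar> + \<bar>s - t\<bar> * max B1 B2" by (simp add: algebra_simps)
      ultimately show ?thesis
        using abs_triangle_ineq[of "m s x - m t x - (s - t) * m' t x" "(s - t) * m' t x"] by linarith
    qed
    have "((\<lambda>s. (1 + max B1 B2) * \<bar>s - t\<bar>) \<longlongrightarrow> (1 + max B1 B2) * \<bar>t - t\<bar>) (at t within ?J)"
      by (intro tendsto_intros)
    then have c0: "((\<lambda>s. (1 + max B1 B2) * \<bar>s - t\<bar>) \<longlongrightarrow> 0) (at t within ?J)" by simp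
    have mJ: "bounded_by (max B1 B2) (m s)" if "s \<in> ?J" for s using mB that by auto
    have "((\<lambda>s. mul (m s) (U s)) \<longlongrightarrow> mul (m t) (U t)) (at t within ?J)"
      using tendsto_mul[of ?J "max B1 B2" m t "\<lambda>s. (1 + max B1 B2) * \<bar>s - t\<bar>" U, OF mJ _ cb c0 Ut] t d(1) by simp
    moreover have "at t within ?J = at t within ?I"
      by (rule at_within_nhd[of _ "ball t d"]) (use d in auto)
    ultimately show "((\<lambda>s. mul (m s) (U s)) \<longlongrightarrow> mul (m t) (U t)) (at t within ?I)" by simp
  qed
qed

text \<open>With m = (1 + t)^(2\<gamma>) W the derivative of <m U, U> is <m' U, U> - 2 <F, m U>.
  Testing the equation with W U turns <F, W U> into the energy that \<open>wedge_inequality\<close>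
  bounds from below, so the functional is nonincreasing.\<close>

lemma weighted_decay:
  assumes a: "0 < a" "a \<le> 1" and \<theta>: "\<And>r. r > 0 \<Longrightarrow> (\<theta> has_real_derivative \<theta>' r) (at r)"
    and \<theta>': "continuous_on {0<..} \<theta>'"
    and T: "0 < T" and \<epsilon>: "0 < \<epsilon>"
  defines "\<Omega> \<equiv> curved_wedge \<theta> a" and "\<nu> \<equiv> 1 / (2 * a)"
  assumes small: "\<epsilon> * (2 * (2 + T) * (\<nu> + 2)\<^sup>2) \<le> \<nu> + 1 - 2 * \<gamma>"
    and U: "continuous_on {0..} U"
      "\<And>t. 0 < t \<Longrightarrow> \<exists>F. grad.form_op \<Omega> (U t) F \<and> (U has_vector_derivative - F) (at t)"
  shows "(1 + T) powr (2 * \<gamma>) * (norm (U T))\<^sup>2 \<le> inner (mul (\<lambda>x. weight \<epsilon> 1 (sqn x)) (U 0)) (U 0)"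
proof -
  have \<Omega>: "open \<Omega>" unfolding \<Omega>_def by (rule open_curved_wedge[OF a \<theta>])
  let ?y = "\<lambda>x. cap \<epsilon> (sqn x)"
  define m where "m t x = lyapunov \<gamma> t (?y x)" for t x
  define m' where "m' t x = lyapunov' \<gamma> t (?y x)" for t x
  \<comment> \<open>The interval extends past T, so that T is an interior point; on it 1 + t \<le> 2
    + T, the factor in \<open>small\<close>.\<close>
  let ?I = "{0..1 + T}" and ?Y = "{0..1 / \<epsilon>}"
  have Y: "?y x \<in> ?Y" for x using cap_bounds[OF \<epsilon>, of "sqn x"] by simp
  have cl: "continuous_on (?I \<times> ?Y) (\<lambda>(t, y). lyapunov \<gamma> t y)"
    unfolding lyapunov_def case_prod_unfold by (intro continuous_intros) auto
  have cl': "continuous_on (?I \<times> ?Y) (\<lambda>(t, y). lyapunov' \<gamma> t y)"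
    unfolding lyapunov'_def case_prod_unfold by (intro continuous_intros) auto
  have cap_m: "continuous_on UNIV ?y"
  proof -
    have "1 + \<epsilon> * sqn x \<noteq> 0" for x using \<epsilon> sqn_nonneg[of x] by (smt (verit) mult_nonneg_nonneg)
    then show ?thesis unfolding cap_def by (intro continuous_intros) auto
  qed
  have ym: "?y \<in> borel_measurable lborel" using borel_measurable_continuous_onI[OF cap_m] by simp
  have cl1: "\<forall>t\<in>?I. continuous_on UNIV (lyapunov \<gamma> t)" and cl1': "\<forall>t\<in>?I. continuous_on UNIV (lyapunov' \<gamma> t)"
    unfolding lyapunov_def lyapunov'_def by (auto intro!: continuous_intros)
  have der: "\<forall>s\<in>?I. \<forall>y\<in>?Y. ((\<lambda>s. lyapunov \<gamma> s y) has_real_derivative lyapunov' \<gamma> s y) (at s)"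
    using DERIV_lyapunov by simp
  note curve = mul_curve[OF compact_Icc ym Y cl cl1 cl' cl1' der, folded m_def m'_def]
  obtain B where mB: "\<And>t. t \<in> ?I \<Longrightarrow> bounded_by B (m t)" and mB': "\<And>t. t \<in> ?I \<Longrightarrow> bounded_by B (m' t)"
    using curve(1) by blast
  define G where "G t = inner (mul (m t) (U t)) (U t)" for t
  have dG: "\<exists>y. DERIV G t :> y \<and> y \<le> 0" if t: "0 < t" "t < 1 + T" for t
  proof -
    obtain F where F: "grad.form_op \<Omega> (U t) F" "(U has_vector_derivative - F) (at t)" using U(2)[OF t(1)] by blast
    have tI: "t \<in> ?I" using t by simp
    have "((\<lambda>s. mul (m s) (U s)) has_vector_derivative mul (m t) (- F) + mul (m' t) (U t)) (at t)"
      by (rule curve(2)[OF t F(2)])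
    from bounded_bilinear.has_vector_derivative[OF bounded_bilinear_inner this F(2)]
    have "(G has_real_derivative inner (mul (m t) (U t)) (- F) + inner (mul (m t) (- F) + mul (m' t) (U t)) (U t)) (at t)"
      unfolding G_def[abs_def] has_real_derivative_iff_has_vector_derivative .
    moreover have "inner (mul (m t) (U t)) (- F) + inner (mul (m t) (- F) + mul (m' t) (U t)) (U t) \<le> 0"
    proof -
      let ?\<tau> = "1 + t"
      have \<tau>: "0 < ?\<tau>" using t by simp
      let ?W = "\<lambda>x. weight \<epsilon> ?\<tau> (sqn x)"
      let ?W1 = "\<lambda>x. weight \<epsilon> ?\<tau> (sqn x) / (4 * ?\<tau> * (1 + \<epsilon> * sqn x)\<^sup>2) * (2 * fst x)"
      let ?W2 = "\<lambda>x. weight \<epsilon> ?\<tau> (sqn x) / (4 * ?\<tau> * (1 + \<epsilon> * sqn x)\<^sup>2) * (2 * snd x)"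
      let ?P = "\<lambda>x. ?W x * (\<gamma> / ?\<tau> - cap \<epsilon> (sqn x) / (8 * ?\<tau>\<^sup>2))"
      let ?c = "?\<tau> powr (2 * \<gamma>)"
      have c: "0 < ?c" using \<tau> by simp
      note b = bounded_by_weight[OF \<epsilon> \<tau>]
      have m_eq: "m t = (\<lambda>x. ?c * ?W x)" by (simp add: m_def[abs_def] lyapunov_def weight_def)
      have P_eq: "?P = (\<lambda>x. 1 / (2 * ?c) * m' t x)"
      proof
        have aux: "w * p = 1 / (2 * c) * (c * (w * (2 * p)))" if "c \<noteq> 0" for w p c :: real
          using that by simp
        show "?P x = 1 / (2 * ?c) * m' t x" for x
          unfolding m'_def lyapunov'_def weight_def by (rule aux) (use c in simp)
      qed
      have bP: "bounded_by (\<bar>1 / (2 * ?c)\<bar> * B) ?P" unfolding P_eq by (rule bounded_by_scale[OF mB'[OF tI]])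
      have m'_eq: "m' t = (\<lambda>x. 2 * ?c * ?P x)"
      proof
        fix x
        have "m' t x = 2 * ?c * (1 / (2 * ?c) * m' t x)" using c by simp
        also have "1 / (2 * ?c) * m' t x = ?P x" by (rule fun_cong[OF P_eq, symmetric])
        finally show "m' t x = 2 * ?c * ?P x" .
      qed
      have sm: "\<epsilon> * (2 * ?\<tau> * (1 / (2 * a) + 2)\<^sup>2) \<le> 1 / (2 * a) + 1 - 2 * \<gamma>"
      proof -
        have "\<epsilon> * (2 * ?\<tau> * (\<nu> + 2)\<^sup>2) \<le> \<epsilon> * (2 * (2 + T) * (\<nu> + 2)\<^sup>2)"
          using \<epsilon> t by (intro mult_left_mono mult_right_mono) auto
        then show ?thesis using small unfolding \<nu>_def by linarith
      qed
      obtain g1 g2 where g: "(U t, g1, g2) \<in> grad_graph \<Omega>"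
        and gF: "\<And>v k. (v, k) \<in> grad_graph \<Omega> \<Longrightarrow> inner (g1, g2) k = inner F v"
        using F(1) unfolding grad.form_op_def by (metis surj_pair)
      have "inner (mul ?P (U t)) (U t) \<le> inner g1 (mul ?W g1 + mul ?W1 (U t)) + inner g2 (mul ?W g2 + mul ?W2 (U t))"
      proof (rule grad_graph_inequality[OF \<Omega> b bP _ g])
        fix \<phi> d1 d2 assume "Cc1 \<Omega> \<phi> d1 d2"
        from wedge_inequality[OF a \<theta> \<theta>' this[unfolded \<Omega>_def] \<tau> \<epsilon> sm]
        show "(LINT x|lborel. ?P x * (\<phi> x)\<^sup>2)
          \<le> (LINT x|lborel. d1 x * (d1 x * ?W x + \<phi> x * ?W1 x) + d2 x * (d2 x * ?W x + \<phi> x * ?W2 x))" by simp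
      qed
      also have "\<dots> = inner F (mul ?W (U t))"
        using gF[OF grad_graph_mult[OF C1_on_weight[OF \<epsilon> \<tau>] b g \<Omega>]] by simp
      finally have le: "inner (mul ?P (U t)) (U t) \<le> inner F (mul ?W (U t))" .
      have "inner (mul (m t) (- F)) (U t) = - inner F (mul (m t) (U t))"
        by (simp add: inner_mul_commute[OF mB[OF tI]])
      moreover have "inner (mul (m t) (U t)) (- F) = - inner F (mul (m t) (U t))"
        by (simp add: inner_commute)
      ultimately have "inner (mul (m t) (U t)) (- F) + inner (mul (m t) (- F) + mul (m' t) (U t)) (U t)
        = inner (mul (m' t) (U t)) (U t) - 2 * inner F (mul (m t) (U t))"
        by (simp add: inner_add_left)
      also have "\<dots> = 2 * ?c * (inner (mul ?P (U t)) (U t) - inner F (mul ?W (U t)))"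
        unfolding m'_eq m_eq mul_scale_left[OF bP] mul_scale_left[OF b(1)] by (simp add: algebra_simps)
      also have "\<dots> \<le> 0" using le c by (simp add: mult_le_0_iff)
      finally show ?thesis .
    qed
    ultimately show ?thesis by blast
  qed
  have "G T \<le> G 0"
  proof (rule DERIV_nonpos_imp_decreasing_open[OF less_imp_le[OF T]])
    show "\<exists>y. DERIV G t :> y \<and> y \<le> 0" if "0 < t" "t < T" for t using dG that by simp
    have U': "continuous_on ?I U" by (rule continuous_on_subset[OF U(1)]) auto
    have "continuous_on ?I G" unfolding G_def[abs_def] by (intro continuous_intros curve(3)[OF U'] U')
    then show "continuous_on {0..T} G" by (rule continuous_on_subset) auto
  qed
  moreover have "G 0 = inner (mul (\<lambda>x. weight \<epsilon> 1 (sqn x)) (U 0)) (U 0)"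
    by (simp add: G_def m_def[abs_def] lyapunov_def weight_def)
  moreover have "(1 + T) powr (2 * \<gamma>) * (norm (U T))\<^sup>2 \<le> G T"
  proof -
    let ?c = "(1 + T) powr (2 * \<gamma>)"
    have b1: "bounded_by 1 (\<lambda>x. 1)" by (simp add: bounded_by_def)
    have "inner (mul (\<lambda>x. ?c * 1) (U T)) (U T) \<le> inner (mul (m T) (U T)) (U T)"
    proof (rule inner_mul_mono[OF bounded_by_scale[OF b1, of ?c]])
      show "?c * 1 \<le> m T x" for x
        using weight_bounds(1)[OF \<epsilon>, of "1 + T" "sqn x"] T
        by (simp add: m_def lyapunov_def weight_def)
    qed (use mB[of T] T in auto)
    moreover have "mul (\<lambda>x. ?c * 1) (U T) = ?c *\<^sub>R U T"
      by (simp only: mul_scale_left[OF b1]) (simp add: mul_def)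
    ultimately show ?thesis by (simp add: G_def power2_norm_eq_inner)
  qed
  ultimately show ?thesis by simp
qed

text \<open>The right-hand side of \<open>weighted_decay\<close> is below the squared
  \<open>L2w_norm\<close> of the datum for every \<epsilon>, so \<epsilon> may shrink with the time
  t; hence the constant 1. The strict inequality for \<gamma> leaves room for a positive
  \<epsilon>.\<close>

theorem decay_bound_below_threshold:
  assumes a: "0 < a" "a \<le> 1" and \<theta>: "\<And>r. r > 0 \<Longrightarrow> (\<theta> has_real_derivative \<theta>' r) (at r)"
    and \<theta>': "continuous_on {0<..} \<theta>'" and \<gamma>: "\<gamma> < 1 / 2 + 1 / (4 * a)"
  shows "decay_bound \<theta> a \<gamma>"
proof -
  let ?\<Omega> = "curved_wedge \<theta> a" and ?\<nu> = "1 / (2 * a)"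
  have \<Omega>: "open ?\<Omega>" by (rule open_curved_wedge[OF a \<theta>])
  have "L2_norm ?\<Omega> (u t) \<le> 1 * (1 + t) powr (- \<gamma>) * L2w_norm ?\<Omega> u0"
    if u0: "u0 \<in> L2w ?\<Omega>" and sol: "heat_sol ?\<Omega> u0 u" and t: "0 \<le> t" for u0 u t
  proof -
    note c = heat_sol_imp_curve[OF \<Omega> sol]
    let ?U = "\<lambda>t. clsO ?\<Omega> (u t)"
    let ?g = "\<lambda>x. indicator ?\<Omega> x *\<^sub>R (gauss_weight x * (u0 x)\<^sup>2)"
    have u0L: "u0 \<in> L2 ?\<Omega>" using sol unfolding heat_sol_def by blast
    have g: "integrable lborel ?g" using u0 by (simp add: L2w_def set_integrable_def)
    have w0: "inner (mul (\<lambda>x. weight \<epsilon> 1 (sqn x)) (?U 0)) (?U 0) \<le> (L2w_norm ?\<Omega> u0)\<^sup>2" if \<epsilon>: "0 < \<epsilon>" for \<epsilon>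
    proof -
      note b = bounded_by_weight(1)[OF \<epsilon>, of 1, simplified]
      have s: "square_integrable (\<lambda>x. indicator ?\<Omega> x * u0 x)" using u0L by (simp add: L2_iff[OF \<Omega>])
      let ?h = "\<lambda>x. weight \<epsilon> 1 (sqn x) * (indicator ?\<Omega> x * u0 x) * (indicator ?\<Omega> x * u0 x)"
      have "inner (mul (\<lambda>x. weight \<epsilon> 1 (sqn x)) (?U 0)) (?U 0) = (LINT x|lborel. ?h x)"
        unfolding c(1) unfolding clsO_def
        by (simp add: mul_cls[OF b s] inner_cls square_integrable_bounded_mult[OF b s] s)
      also have "\<dots> \<le> (LINT x|lborel. ?g x)"
      proof (rule integral_mono[OF integrable_bounded_mult3[OF b s s] g])
        fix x
        have "weight \<epsilon> 1 (sqn x) \<le> gauss_weight x"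
          using cap_bounds(2)[OF \<epsilon>, of "sqn x"] by (simp add: weight_def gauss_weight_def sqn_norm)
        from mult_right_mono[OF this, of "(u0 x)\<^sup>2"] show "?h x \<le> ?g x"
          by (auto simp: indicator_def power2_eq_square mult.assoc)
      qed
      also have "\<dots> = (L2w_norm ?\<Omega> u0)\<^sup>2"
      proof -
        have "0 \<le> (LINT x|lborel. ?g x)" by (rule integral_nonneg_AE) (simp add: gauss_weight_def)
        then show ?thesis by (simp add: L2w_norm_def set_lebesgue_integral_def)
      qed
      finally show ?thesis .
    qed
    have L: "0 \<le> L2w_norm ?\<Omega> u0"
      unfolding L2w_norm_def set_lebesgue_integral_def
      by (intro real_sqrt_ge_zero integral_nonneg_AE) (simp add: gauss_weight_def)
    have "(1 + t) powr (2 * \<gamma>) * (norm (?U t))\<^sup>2 \<le> (L2w_norm ?\<Omega> u0)\<^sup>2"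
    proof (cases "t = 0")
      case True
      have b1: "bounded_by 1 (\<lambda>x. 1)" by (simp add: bounded_by_def)
      have "inner (mul (\<lambda>x. 1) (?U 0)) (?U 0) \<le> inner (mul (\<lambda>x. weight 1 1 (sqn x)) (?U 0)) (?U 0)"
        by (rule inner_mul_mono[OF b1 bounded_by_weight(1)]) (auto intro: weight_bounds)
      then show ?thesis using w0[of 1] by (simp add: True mul_def power2_norm_eq_inner)
    next
      case False
      then have t: "0 < t" using t by simp
      define \<epsilon> where "\<epsilon> = (?\<nu> + 1 - 2 * \<gamma>) / (2 * (2 + t) * (?\<nu> + 2)\<^sup>2)"
      have pos: "0 < ?\<nu> + 1 - 2 * \<gamma>" using \<gamma> a by (simp add: field_simps)
      have den: "0 < 2 * (2 + t) * (?\<nu> + 2)\<^sup>2"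
      proof -
        have "0 < ?\<nu> + 2" using a by (simp add: add_pos_pos)
        then show ?thesis using t by (intro mult_pos_pos zero_less_power) auto
      qed
      have \<epsilon>: "0 < \<epsilon>" unfolding \<epsilon>_def using pos den by (rule divide_pos_pos)
      have "\<epsilon> * (2 * (2 + t) * (?\<nu> + 2)\<^sup>2) \<le> ?\<nu> + 1 - 2 * \<gamma>"
        unfolding \<epsilon>_def using den by (subst nonzero_divide_eq_eq[THEN iffD1, OF _ refl]) auto
      from weighted_decay[OF a \<theta> \<theta>' t \<epsilon> this c(3,4)] w0[OF \<epsilon>] show ?thesis by linarith
    qed
    then have "(norm (?U t))\<^sup>2 \<le> ((1 + t) powr (- \<gamma>) * L2w_norm ?\<Omega> u0)\<^sup>2"
    proof -
      assume "(1 + t) powr (2 * \<gamma>) * (norm (?U t))\<^sup>2 \<le> (L2w_norm ?\<Omega> u0)\<^sup>2"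
      moreover have "0 < (1 + t) powr (2 * \<gamma>)" using t by simp
      ultimately have 1: "(norm (?U t))\<^sup>2 \<le> (L2w_norm ?\<Omega> u0)\<^sup>2 / (1 + t) powr (2 * \<gamma>)"
        by (simp add: pos_le_divide_eq mult.commute)
      have "((1 + t) powr (- \<gamma>))\<^sup>2 = inverse ((1 + t) powr (2 * \<gamma>))"
        by (simp add: power2_eq_square flip: powr_add powr_minus)
      then have 2: "((1 + t) powr (- \<gamma>))\<^sup>2 = 1 / (1 + t) powr (2 * \<gamma>)" by (simp only: inverse_eq_divide)
      show ?thesis unfolding power_mult_distrib 2 using 1 by simp
    qed
    then have "norm (?U t) \<le> (1 + t) powr (- \<gamma>) * L2w_norm ?\<Omega> u0"
      by (rule power2_le_imp_le) (use L in simp)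
    then show ?thesis by (simp add: L2_norm_eq[OF \<Omega> c(2)[OF t]])
  qed
  then show ?thesis unfolding decay_bound_def by (intro exI[of _ 1]) auto
qed

section \<open>Nonnegative solutions\<close>

text \<open>Integration by parts against test functions, extended to the form domain because the
  identity is a closed condition. It feeds both the initial bump and the comparison function into
  \<open>form_op\<close>.\<close>

lemma laplacian_form_op:
  assumes \<Omega>: "open \<Omega>" and u: "Cc1 \<Omega> u p q" and p: "Cc1 \<Omega> p p1 p2" and q: "Cc1 \<Omega> q q1 q2"
  shows "grad.form_op \<Omega> (cls u) (- (cls p1 + cls q2))"
proof -
  let ?S = "{(v, k1, k2). inner (cls p) k1 + inner (cls q) k2 = inner (- (cls p1 + cls q2)) v}"
  have "?S = {z. inner (cls p) (fst (snd z)) + inner (cls q) (snd (snd z)) = inner (- (cls p1 + cls q2)) (fst z)}"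
    by auto
  also have "closed \<dots>" by (intro closed_Collect_eq continuous_intros)
  finally have "closed ?S" .
  moreover have "smooth_graph \<Omega> \<subseteq> ?S"
  proof
    fix z assume "z \<in> smooth_graph \<Omega>"
    then obtain \<phi> d1 d2 where \<phi>: "Cc1 \<Omega> \<phi> d1 d2" and z: "z = (cls \<phi>, cls d1, cls d2)"
      unfolding smooth_graph_def by blast
    have "inner (cls p) (cls d1) + inner (cls p1) (cls \<phi>) = 0"
    proof -
      have "(LINT x|lborel. p1 x * \<phi> x + p x * d1 x) = 0"
        using Cc1_integral_eq_0(1)[OF Cc1_mult[OF \<Omega> p Cc1_C1_on[OF \<phi>]]] .
      then show ?thesis
        by (simp add: inner_cls square_integrable_mult Cc1_square_integrable[OF \<phi>] Cc1_square_integrable[OF p])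
    qed
    moreover have "inner (cls q) (cls d2) + inner (cls q2) (cls \<phi>) = 0"
    proof -
      have "(LINT x|lborel. q2 x * \<phi> x + q x * d2 x) = 0"
        using Cc1_integral_eq_0(2)[OF Cc1_mult[OF \<Omega> q Cc1_C1_on[OF \<phi>]]] .
      then show ?thesis
        by (simp add: inner_cls square_integrable_mult Cc1_square_integrable[OF \<phi>] Cc1_square_integrable[OF q])
    qed
    ultimately show "z \<in> ?S" by (simp add: z inner_add_left inner_diff_left)
  qed
  ultimately have "grad_graph \<Omega> \<subseteq> ?S" unfolding grad_graph_def by (rule closure_minimal[rotated])
  then show ?thesis
    unfolding grad.form_op_def using grad_graphI[OF u]
    by (intro exI[of _ "(cls p, cls q)"]) auto
qed

text \<open>The quadratic bound near 0 makes the right derivative vanish there, as the left one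
  does.\<close>

lemma DERIV_pos_part:
  fixes g g' :: "real \<Rightarrow> real"
  assumes g: "\<And>y. y > 0 \<Longrightarrow> (g has_real_derivative g' y) (at y)" and b: "\<And>y. y > 0 \<Longrightarrow> y \<le> 1 \<Longrightarrow> \<bar>g y\<bar> \<le> C * y\<^sup>2"
  shows "((\<lambda>y. if y > 0 then g y else 0) has_real_derivative (if y > 0 then g' y else 0)) (at y)"
proof -
  let ?f = "\<lambda>y. if y > 0 then g y else 0"
  consider "y > 0" | "y < 0" | "y = 0" by linarith
  then show ?thesis
  proof cases
    case 1
    then show ?thesis
      using has_field_derivative_transform_within_open[OF g[OF 1], of "{0<..}" ?f] by auto
  next
    case 2
    have "((\<lambda>y. 0) has_real_derivative 0) (at y)" by simp
    then show ?thesis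
      using has_field_derivative_transform_within_open[of "\<lambda>y. 0" 0 y "{..<0}" ?f] 2 by auto
  next
    case 3
    have le: "norm ((?f (0 + h) - ?f 0) / h) \<le> \<bar>C\<bar> * \<bar>h\<bar>" if h: "h < 1" for h
    proof (cases "h > 0")
      case True
      have "\<bar>g h\<bar> \<le> \<bar>C\<bar> * h\<^sup>2"
        using b[OF True] h mult_right_mono[OF abs_ge_self[of C], of "h\<^sup>2"] by simp
      then show ?thesis using True by (simp add: power2_eq_square divide_le_eq mult.assoc)
    qed (auto simp: mult_nonneg_nonpos)
    have "((\<lambda>h. \<bar>C\<bar> * \<bar>h\<bar>) \<longlongrightarrow> \<bar>C\<bar> * \<bar>0\<bar>) (at 0)" by (intro tendsto_intros)
    then have "((\<lambda>h. \<bar>C\<bar> * \<bar>h\<bar>) \<longlongrightarrow> 0) (at 0)" by simp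
    then have "((\<lambda>h. (?f (0 + h) - ?f 0) / h) \<longlongrightarrow> 0) (at 0)"
    proof (rule Lim_null_comparison[rotated])
      have "\<forall>\<^sub>F h in at 0. h < (1::real)"
        by (rule order_tendstoD(2)[OF tendsto_ident_at]) simp
      then show "\<forall>\<^sub>F h in at 0. norm ((?f (0 + h) - ?f 0) / h) \<le> \<bar>C\<bar> * \<bar>h\<bar>"
        by eventually_elim (rule le)
    qed
    then show ?thesis unfolding 3 DERIV_def by simp
  qed
qed

lemma continuous_pos_part:
  fixes g :: "real \<Rightarrow> real"
  assumes "continuous_on {0..} g" "g 0 = 0"
  shows "continuous_on UNIV (\<lambda>y. if y > 0 then g y else 0)"
proof -
  have "continuous_on UNIV (\<lambda>y. g (max y 0))"
    by (rule continuous_on_compose2[OF assms(1)]) (auto intro!: continuous_intros)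
  also have "(\<lambda>y. g (max y 0)) = (\<lambda>y. if y > 0 then g y else 0)"
    using assms(2) by (auto simp: max_def)
  finally show ?thesis .
qed

section \<open>Bump functions in the domain of the cube of the operator\<close>

definition pos_part_power :: "nat \<Rightarrow> real \<Rightarrow> real" where
  "pos_part_power k y = (if y > 0 then y ^ k else 0)"

lemma DERIV_pos_part_power:
  assumes "2 \<le> k"
  shows "(pos_part_power k has_real_derivative real k * pos_part_power (k - 1) y) (at y)"
proof -
  have "((\<lambda>y. if y > 0 then y ^ k else 0) has_real_derivative (if y > 0 then real k * y ^ (k - 1) else 0)) (at y)"
  proof (rule DERIV_pos_part)
    show "((\<lambda>y. y ^ k) has_real_derivative real k * y ^ (k - 1)) (at y)" for y
      by (auto intro!: derivative_eq_intros)
    show "\<bar>y ^ k\<bar> \<le> 1 * y\<^sup>2" if "0 < y" "y \<le> 1" for y :: real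
      using power_decreasing[OF assms, of y] that by simp
  qed
  moreover have "real k * pos_part_power (k - 1) y = (if y > 0 then real k * y ^ (k - 1) else 0)"
    by (simp add: pos_part_power_def)
  ultimately show ?thesis by (simp only: pos_part_power_def[abs_def])
qed

lemma continuous_pos_part_power: "1 \<le> k \<Longrightarrow> continuous_on UNIV (pos_part_power k)"
  unfolding pos_part_power_def[abs_def] by (rule continuous_pos_part) (auto intro!: continuous_intros)

text \<open>Differentiating P(z) (1 - z^2)^(8-j) and taking out (1 - z^2)^(8-j-1) leaves P'(z) (1 -
  z^2) - 2(8 - j) z P(z).\<close>

primrec bump_poly :: "nat \<Rightarrow> real poly" where
  "bump_poly 0 = 1"
| "bump_poly (Suc j) = pderiv (bump_poly j) * [:1, 0, -1:] - smult (2 * real (8 - j)) ([:0, 1:] * bump_poly j)"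

text \<open>The \<open>j\<close>-th derivative of \<open>(1 - z\<^sup>2)\<^sub>+\<^sup>8\<close>, where \<open>z = (s - c) / r\<close>. Six continuous
  derivatives are enough to apply the Laplacian three times.\<close>

definition bump :: "real \<Rightarrow> real \<Rightarrow> nat \<Rightarrow> real \<Rightarrow> real" where
  "bump c r j s = poly (bump_poly j) ((s - c) / r) * pos_part_power (8 - j) (1 - ((s - c) / r)\<^sup>2) / r ^ j"

lemma DERIV_bump:
  assumes r: "0 < r" and j: "j \<le> 6"
  shows "(bump c r j has_real_derivative bump c r (Suc j) s) (at s)"
proof -
  define k where "k = 8 - j"
  have k: "2 \<le> k" "8 - Suc j = k - 1" using j by (auto simp: k_def)
  let ?z = "\<lambda>s. (s - c) / r"
  let ?P = "bump_poly j" and ?p = "pos_part_power (k - 1) (1 - (?z s)\<^sup>2)"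
  have z: "(?z has_real_derivative 1 / r) (at s)"
    using r by (auto intro!: derivative_eq_intros)
  have w: "((\<lambda>s. 1 - (?z s)\<^sup>2) has_real_derivative - (2 * ?z s * (1 / r))) (at s)"
    using r by (auto intro!: derivative_eq_intros simp: field_simps power2_eq_square)
  have 1: "((\<lambda>s. poly ?P (?z s)) has_real_derivative poly (pderiv ?P) (?z s) * (1 / r)) (at s)"
    by (rule DERIV_chain2[OF poly_DERIV z])
  have 2: "((\<lambda>s. pos_part_power k (1 - (?z s)\<^sup>2)) has_real_derivative
      real k * ?p * - (2 * ?z s * (1 / r))) (at s)"
    by (rule DERIV_chain2[OF DERIV_pos_part_power[OF k(1)] w])
  have split: "pos_part_power k y = y * pos_part_power (k - 1) y" for y
    using k(1) by (auto simp: pos_part_power_def power_eq_if)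
  have alg: "(D * (1 / r) * ((1 - z\<^sup>2) * p) + n * p * - (2 * z * (1 / r)) * P) / r ^ j
      = (D * (1 - z\<^sup>2) - 2 * n * (z * P)) * p / (r * r ^ j)" for D z p n P :: real
  proof -
    have alg1: "D * i * ((1 - z\<^sup>2) * p) + n * p * - (2 * z * i) * P = (D * (1 - z\<^sup>2) - 2 * n * (z * P)) * p * i" for i :: real
      by (simp add: algebra_simps)
    show ?thesis unfolding alg1 by simp
  qed
  have Q: "poly (bump_poly (Suc j)) z = poly (pderiv ?P) z * (1 - z\<^sup>2) - 2 * real k * (z * poly ?P z)" for z
    by (simp add: k_def power2_eq_square algebra_simps)
  show ?thesis
    unfolding bump_def[abs_def] k_def[symmetric]
    by (rule DERIV_cong[OF DERIV_cdivide[OF DERIV_mult[OF 1 2]]])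
      (simp only: split[of "1 - (?z s)\<^sup>2"] alg Q k(2) power_Suc)
qed

lemma continuous_bump: "0 < r \<Longrightarrow> j \<le> 7 \<Longrightarrow> continuous_on UNIV (bump c r j)"
  unfolding bump_def[abs_def]
  by (intro continuous_intros continuous_on_compose2[OF continuous_pos_part_power]) auto

lemma bump_eq_0:
  assumes "0 < r" "r \<le> \<bar>s - c\<bar>"
  shows "bump c r j s = 0"
proof -
  have "1 \<le> \<bar>(s - c) / r\<bar>" using assms by simp
  then have "1 \<le> ((s - c) / r)\<^sup>2" using power_mono[of 1 "\<bar>(s - c) / r\<bar>" 2] by (simp only: power2_abs power_one zero_le_one)
  then show ?thesis by (simp add: bump_def pos_part_power_def)
qed

definition tensor_bump :: "real \<times> real \<Rightarrow> real \<Rightarrow> nat \<Rightarrow> nat \<Rightarrow> plane_fun" where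
  "tensor_bump c r i j x = bump (fst c) r i (fst x) * bump (snd c) r j (snd x)"

lemma Cc1_tensor_bump:
  assumes r: "0 < r" and S: "cbox (fst c - r, snd c - r) (fst c + r, snd c + r) \<subseteq> S"
    and ij: "i \<le> 6" "j \<le> 6"
  shows "Cc1 S (tensor_bump c r i j) (tensor_bump c r (Suc i) j) (tensor_bump c r i (Suc j))"
proof -
  have c: "continuous_on UNIV (\<lambda>x::real \<times> real. bump (fst c) r n (fst x))"
    "continuous_on UNIV (\<lambda>x::real \<times> real. bump (snd c) r n (snd x))" if "n \<le> 7" for n
    by (rule continuous_on_compose2[OF continuous_bump[OF r that]]; auto intro!: continuous_intros)+
  have "C1_on UNIV (\<lambda>x. bump (fst c) r i (fst x)) (\<lambda>x. bump (fst c) r (Suc i) (fst x) * 1) (\<lambda>x. bump (fst c) r (Suc i) (fst x) * 0)"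
    by (rule C1_on_compose[OF C1_on_fst DERIV_bump[OF r ij(1)]]) (use c ij in auto)
  moreover have "C1_on UNIV (\<lambda>x. bump (snd c) r j (snd x)) (\<lambda>x. bump (snd c) r (Suc j) (snd x) * 0) (\<lambda>x. bump (snd c) r (Suc j) (snd x) * 1)"
    by (rule C1_on_compose[OF C1_on_snd DERIV_bump[OF r ij(2)]]) (use c ij in auto)
  ultimately have "C1_on UNIV (tensor_bump c r i j) (tensor_bump c r (Suc i) j) (tensor_bump c r i (Suc j))"
    using C1_on_mult by (fastforce simp: tensor_bump_def[abs_def])
  moreover have "tensor_bump c r i j x = 0" if "x \<notin> cbox (fst c - r, snd c - r) (fst c + r, snd c + r)" for x
  proof -
    have "r \<le> \<bar>fst x - fst c\<bar> \<or> r \<le> \<bar>snd x - snd c\<bar>"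
      using that by (cases x) (auto simp: cbox_Pair_eq)
    then show ?thesis using bump_eq_0[OF r] by (auto simp: tensor_bump_def)
  qed
  ultimately show ?thesis unfolding Cc1_iff using S compact_cbox by blast
qed

lemma form_op_tensor_bump:
  assumes \<Omega>: "open \<Omega>" and r: "0 < r" and S: "cbox (fst c - r, snd c - r) (fst c + r, snd c + r) \<subseteq> \<Omega>"
    and ij: "i \<le> 5" "j \<le> 5"
  shows "grad.form_op \<Omega> (cls (tensor_bump c r i j))
    (- (cls (tensor_bump c r (Suc (Suc i)) j) + cls (tensor_bump c r i (Suc (Suc j)))))"
  by (rule laplacian_form_op[OF \<Omega> Cc1_tensor_bump[OF r S] Cc1_tensor_bump[OF r S] Cc1_tensor_bump[OF r S]])
    (use ij in auto)

text \<open>A product of one-dimensional bumps. Six derivatives in each variable allow three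
  applications of the Laplacian, which is what \<open>form_op_semigroup\<close> and
  \<open>semigroup_has_vector_derivative\<close> ask of the datum.\<close>

lemma exists_smooth_bump:
  assumes \<Omega>: "open \<Omega>" and S: "open S" "S \<subseteq> \<Omega>" "c \<in> S"
  obtains u f e d K where "continuous_on UNIV u" "compact K" "K \<subseteq> S" "\<And>x. x \<notin> K \<Longrightarrow> u x = 0"
    "\<And>x. 0 \<le> u x" "0 < u c"
    "grad.form_op \<Omega> (cls u) f" "grad.form_op \<Omega> f e" "grad.form_op \<Omega> e d"
proof -
  obtain r0 where r0: "r0 > 0" "ball c r0 \<subseteq> S" using S openE by blast
  \<comment> \<open>The box of half-width r around c lies within distance 2r of c, below r0.\<close>
  define r where "r = r0 / 3"
  have r: "0 < r" using r0 by (simp add: r_def)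
  let ?K = "cbox (fst c - r, snd c - r) (fst c + r, snd c + r)"
  have K: "?K \<subseteq> S"
  proof
    fix x assume "x \<in> ?K"
    then have "\<bar>fst x - fst c\<bar> \<le> r" "\<bar>snd x - snd c\<bar> \<le> r" by (cases x; auto simp: cbox_Pair_eq)+
    then have "norm (x - c) \<le> 2 * r"
      using sqrt_sum_squares_le_sum_abs[of "fst (x - c)" "snd (x - c)"] by (simp add: norm_prod_def)
    then have "dist c x < r0" using r0 by (simp add: dist_norm norm_minus_commute r_def)
    then show "x \<in> S" using r0 by auto
  qed
  then have K\<Omega>: "?K \<subseteq> \<Omega>" using S by blast
  let ?T = "\<lambda>i j. cls (tensor_bump c r i j)"
  note op = form_op_tensor_bump[OF \<Omega> r K\<Omega>]
  have Cc: "Cc1 S (tensor_bump c r 0 0) (tensor_bump c r (Suc 0) 0) (tensor_bump c r 0 (Suc 0))"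
    by (rule Cc1_tensor_bump[OF r K]) auto
  have 1: "grad.form_op \<Omega> (?T 0 0) (- (?T 2 0 + ?T 0 2))"
    using op[of 0 0] by (simp add: numeral_2_eq_2)
  have step: "grad.form_op \<Omega> (- (?T i j)) (?T (Suc (Suc i)) j + ?T i (Suc (Suc j)))" if "i \<le> 5" "j \<le> 5" for i j
    using grad.form_op_scale[OF op[OF that], of "-1"] by (simp add: add.commute)
  have step': "grad.form_op \<Omega> (?T i j) (- (?T (Suc (Suc i)) j) - ?T i (Suc (Suc j)))" if "i \<le> 5" "j \<le> 5" for i j
    using op[OF that] by simp
  have "\<exists>e d. grad.form_op \<Omega> (- (?T 2 0 + ?T 0 2)) e \<and> grad.form_op \<Omega> e d"
  proof (intro exI conjI)
    show "grad.form_op \<Omega> (- (?T 2 0 + ?T 0 2)) ((?T 4 0 + ?T 2 2) + (?T 2 2 + ?T 0 4))"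
      using grad.form_op_add[OF step[of 2 0] step[of 0 2]] by (simp add: eval_nat_numeral)
    show "grad.form_op \<Omega> ((?T 4 0 + ?T 2 2) + (?T 2 2 + ?T 0 4))
      ((- ?T 6 0 - ?T 4 2 + (- ?T 4 2 - ?T 2 4)) + (- ?T 4 2 - ?T 2 4 + (- ?T 2 4 - ?T 0 6)))"
      using grad.form_op_add[OF grad.form_op_add[OF step'[of 4 0] step'[of 2 2]] grad.form_op_add[OF step'[of 2 2] step'[of 0 4]]]
      by (simp add: eval_nat_numeral)
  qed
  then obtain e d where ed: "grad.form_op \<Omega> (- (?T 2 0 + ?T 0 2)) e" "grad.form_op \<Omega> e d" by blast
  show thesis
  proof (rule that[OF Cc1_continuous(1)[OF Cc] compact_cbox K _ _ _ 1 ed])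
    show "tensor_bump c r 0 0 x = 0" if "x \<notin> ?K" for x
    proof -
      have "r \<le> \<bar>fst x - fst c\<bar> \<or> r \<le> \<bar>snd x - snd c\<bar>"
        using that by (cases x) (auto simp: cbox_Pair_eq)
      then show ?thesis using bump_eq_0[OF r] by (auto simp: tensor_bump_def)
    qed
    have b: "0 \<le> bump a r 0 s" for a s by (simp add: bump_def pos_part_power_def)
    show "0 \<le> tensor_bump c r 0 0 x" for x using b by (simp add: tensor_bump_def)
    show "0 < tensor_bump c r 0 0 c" by (simp add: tensor_bump_def bump_def pos_part_power_def)
  qed
qed

section \<open>Preservation of positivity\<close>

definition nonneg_cone :: "l2 set" where
  "nonneg_cone = {v. AE x in lborel. 0 \<le> rep v x}"

text \<open>The cone is self-dual: testing with the negative part recovers the sign. In this form it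
  is an intersection of closed half-spaces.\<close>

lemma nonneg_cone_iff:
  "v \<in> nonneg_cone \<longleftrightarrow> (\<forall>w. square_integrable w \<and> (\<forall>x. 0 \<le> w x) \<longrightarrow> 0 \<le> inner v (cls w))"
proof
  assume v: "v \<in> nonneg_cone"
  have "0 \<le> inner v (cls w)" if w: "square_integrable w" "\<forall>x. 0 \<le> w x" for w
  proof -
    have "inner v (cls w) = (LINT x|lborel. rep v x * w x)"
      using inner_cls[OF square_integrable_rep w(1), of v] by simp
    also have "0 \<le> \<dots>"
      by (rule integral_nonneg_AE) (use v w in \<open>auto simp: nonneg_cone_def\<close>)
    finally show ?thesis .
  qed
  then show "\<forall>w. square_integrable w \<and> (\<forall>x. 0 \<le> w x) \<longrightarrow> 0 \<le> inner v (cls w)" by blast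
next
  assume a: "\<forall>w. square_integrable w \<and> (\<forall>x. 0 \<le> w x) \<longrightarrow> 0 \<le> inner v (cls w)"
  let ?n = "\<lambda>x. max 0 (- rep v x)"
  have m: "rep v \<in> borel_measurable lborel" by (rule square_integrable_measurable[OF square_integrable_rep])
  have n: "square_integrable ?n"
    by (rule square_integrable_bound[OF square_integrable_rep[of v]]) (use m in \<open>auto simp: max_def\<close>)
  have "0 \<le> inner v (cls ?n)" using a n by auto
  also have "inner v (cls ?n) = (LINT x|lborel. rep v x * ?n x)"
    using inner_cls[OF square_integrable_rep n, of v] by simp
  also have "\<dots> = - (LINT x|lborel. ?n x * ?n x)"
    unfolding Bochner_Integration.integral_minus[symmetric]
    by (rule Bochner_Integration.integral_cong) (auto simp: max_def)
  finally have "(LINT x|lborel. ?n x * ?n x) \<le> 0" by simp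
  moreover have "0 \<le> (LINT x|lborel. ?n x * ?n x)" by (rule integral_nonneg_AE) simp
  ultimately have "(LINT x|lborel. ?n x * ?n x) = 0" by simp
  then have "AE x in lborel. ?n x = 0" using integral_square_eq_0[OF n] by simp
  then show "v \<in> nonneg_cone" unfolding nonneg_cone_def by (auto simp: max_def split: if_splits elim!: eventually_mono)
qed

lemma closed_nonneg_cone: "closed nonneg_cone"
proof -
  have eq: "nonneg_cone = (\<Inter>w\<in>{w. square_integrable w \<and> (\<forall>x. 0 \<le> w x)}. {v. 0 \<le> inner v (cls w)})"
    using nonneg_cone_iff by blast
  show ?thesis unfolding eq by (intro closed_INT ballI closed_Collect_le continuous_intros)
qed

text \<open>A smooth substitute for the negative part, used as a test function.\<close>

definition neg_trunc :: "real \<Rightarrow> real" where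
  "neg_trunc s = - (if - s > 0 then (- s)\<^sup>2 / (1 + (- s)) else 0)"

definition neg_trunc' :: "real \<Rightarrow> real" where
  "neg_trunc' s = (if - s > 0 then 1 - 1 / (1 + (- s))\<^sup>2 else 0)"

lemma DERIV_neg_trunc: "(neg_trunc has_real_derivative neg_trunc' s) (at s)"
proof -
  have "((\<lambda>y::real. if y > 0 then y\<^sup>2 / (1 + y) else 0) has_real_derivative (if y > 0 then 1 - 1 / (1 + y)\<^sup>2 else 0)) (at y)" for y
  proof (rule DERIV_pos_part)
    fix y :: real assume y: "0 < y"
    have "((\<lambda>y. y\<^sup>2 / (1 + y)) has_real_derivative (2 * y * (1 + y) - y\<^sup>2 * 1) / ((1 + y) * (1 + y))) (at y)"
      using y by (auto intro!: derivative_eq_intros)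
    moreover have "(2 * y * (1 + y) - y\<^sup>2 * 1) / ((1 + y) * (1 + y)) = 1 - 1 / (1 + y)\<^sup>2"
    proof -
      have "2 * y * (1 + y) - y\<^sup>2 * 1 = (1 + y) * (1 + y) - 1" by (simp add: power2_eq_square algebra_simps)
      then show ?thesis using y by (simp add: diff_divide_distrib power2_eq_square)
    qed
    ultimately show "((\<lambda>y. y\<^sup>2 / (1 + y)) has_real_derivative 1 - 1 / (1 + y)\<^sup>2) (at y)" by simp
    have "y\<^sup>2 / (1 + y) \<le> y\<^sup>2 / 1" using y by (intro divide_left_mono) auto
    then show "\<bar>y\<^sup>2 / (1 + y)\<bar> \<le> 1 * y\<^sup>2" using y by simp
  qed
  from DERIV_minus[OF DERIV_chain2[OF this[of "- s"] DERIV_minus[OF DERIV_ident]]]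
  show ?thesis unfolding neg_trunc_def[abs_def] neg_trunc'_def by simp
qed

lemma neg_trunc'_bounds: "0 \<le> neg_trunc' s" "neg_trunc' s \<le> 1"
  by (auto simp: neg_trunc'_def divide_le_eq power2_eq_square intro!: mult_ge1_I)

lemma continuous_neg_trunc': "continuous_on UNIV neg_trunc'"
proof -
  have "continuous_on UNIV (\<lambda>y::real. if y > 0 then 1 - 1 / (1 + y)\<^sup>2 else 0)"
    by (rule continuous_pos_part) (auto intro!: continuous_intros)
  from continuous_on_compose2[OF this continuous_on_minus[OF continuous_on_id]]
  show ?thesis unfolding neg_trunc'_def[abs_def] by simp
qed

lemma neg_trunc_lipschitz: "\<bar>neg_trunc s - neg_trunc t\<bar> \<le> \<bar>s - t\<bar>"
proof -
  have "norm (neg_trunc s - neg_trunc t) \<le> 1 * norm (s - t)"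
    by (rule field_differentiable_bound[of UNIV _ neg_trunc'])
      (use DERIV_neg_trunc neg_trunc'_bounds in auto)
  then show ?thesis by simp
qed

lemma neg_trunc_sign: "neg_trunc s \<le> 0" "0 \<le> s * neg_trunc s" "s * neg_trunc s = 0 \<Longrightarrow> 0 \<le> s"
proof -
  have "s * neg_trunc s = (- s) * ((- s)\<^sup>2 / (1 + (- s)))" if "s < 0" using that by (simp add: neg_trunc_def)
  moreover have "0 < (- s) * ((- s)\<^sup>2 / (1 + (- s)))" if "s < 0"
    using that by (intro mult_pos_pos divide_pos_pos) auto
  ultimately have neg: "0 < s * neg_trunc s" if "s < 0" using that by simp
  show "neg_trunc s \<le> 0" by (simp add: neg_trunc_def)
  show "0 \<le> s * neg_trunc s" using neg by (cases "s < 0") (auto simp: neg_trunc_def)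
  show "0 \<le> s" if "s * neg_trunc s = 0" using neg that by (cases "s < 0") auto
qed

lemma neg_trunc_0 [simp]: "neg_trunc 0 = 0" by (simp add: neg_trunc_def)

lemma square_integrable_neg_trunc:
  assumes "square_integrable f"
  shows "square_integrable (\<lambda>x. neg_trunc (f x))"
proof (rule square_integrable_bound[OF assms])
  have "continuous_on UNIV neg_trunc" using DERIV_neg_trunc DERIV_isCont continuous_at_imp_continuous_on by blast
  then have "neg_trunc \<in> borel_measurable borel" by (rule borel_measurable_continuous_onI)
  then show "(\<lambda>x. neg_trunc (f x)) \<in> borel_measurable lborel"
    using measurable_compose[OF square_integrable_measurable[OF assms]] by simp
  show "AE x in lborel. \<bar>neg_trunc (f x)\<bar> \<le> \<bar>f x\<bar>"
    using neg_trunc_lipschitz[of _ 0] by simp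
qed

text \<open>Write \<eta> for \<open>neg_trunc\<close>. The inner product of d with \<eta>'(\<phi>) d
  is nonnegative because \<eta>' \<ge> 0, and replacing the first factor by g costs at most the
  stated product of norms because \<eta>' \<le> 1. This takes the place of a chain rule for limits
  of test functions.\<close>

lemma inner_grad_neg_trunc:
  assumes \<Omega>: "open \<Omega>" and \<phi>: "Cc1 \<Omega> \<phi> d1 d2"
  shows "(cls (\<lambda>x. neg_trunc (\<phi> x)), cls (\<lambda>x. neg_trunc' (\<phi> x) * d1 x), cls (\<lambda>x. neg_trunc' (\<phi> x) * d2 x)) \<in> grad_graph \<Omega>"
    and "square_integrable d \<Longrightarrow> - (norm (g - cls d) * norm (cls d)) \<le> inner g (cls (\<lambda>x. neg_trunc' (\<phi> x) * d x))"
proof -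
  have c: "continuous_on UNIV (\<lambda>x. neg_trunc' (\<phi> x))"
    by (rule continuous_on_compose2[OF continuous_neg_trunc' Cc1_continuous(1)[OF \<phi>]]) auto
  have "C1_on UNIV (\<lambda>x. neg_trunc (\<phi> x)) (\<lambda>x. neg_trunc' (\<phi> x) * d1 x) (\<lambda>x. neg_trunc' (\<phi> x) * d2 x)"
    by (rule C1_on_compose[OF Cc1_C1_on[OF \<phi>] DERIV_neg_trunc c])
  moreover obtain K where "compact K" "K \<subseteq> \<Omega>" "\<And>x. x \<notin> K \<Longrightarrow> \<phi> x = 0" using Cc1_support[OF \<phi>] by blast
  ultimately have "Cc1 \<Omega> (\<lambda>x. neg_trunc (\<phi> x)) (\<lambda>x. neg_trunc' (\<phi> x) * d1 x) (\<lambda>x. neg_trunc' (\<phi> x) * d2 x)"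
    unfolding Cc1_iff by auto
  then show "(cls (\<lambda>x. neg_trunc (\<phi> x)), cls (\<lambda>x. neg_trunc' (\<phi> x) * d1 x), cls (\<lambda>x. neg_trunc' (\<phi> x) * d2 x)) \<in> grad_graph \<Omega>"
    by (rule grad_graphI)
  show "- (norm (g - cls d) * norm (cls d)) \<le> inner g (cls (\<lambda>x. neg_trunc' (\<phi> x) * d x))"
    if d: "square_integrable d"
  proof -
    have b: "bounded_by 1 (\<lambda>x. neg_trunc' (\<phi> x))"
      using borel_measurable_continuous_onI[OF c] neg_trunc'_bounds by (simp add: bounded_by_def abs_of_nonneg)
    have m: "mul (\<lambda>x. neg_trunc' (\<phi> x)) (cls d) = cls (\<lambda>x. neg_trunc' (\<phi> x) * d x)" by (rule mul_cls[OF b d])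
    have b0: "bounded_by 0 (\<lambda>x. 0)" by (simp add: bounded_by_def)
    have "mul (\<lambda>x. 0) (cls d) = 0" by (simp add: mul_def cls_0)
    then have "0 \<le> inner (cls d) (mul (\<lambda>x. neg_trunc' (\<phi> x)) (cls d))"
      using inner_mul_mono[OF b0 b, of "cls d"] neg_trunc'_bounds by (simp add: inner_commute)
    moreover have "- (norm (g - cls d) * norm (cls d)) \<le> inner (g - cls d) (mul (\<lambda>x. neg_trunc' (\<phi> x)) (cls d))"
    proof -
      have "\<bar>inner (g - cls d) (mul (\<lambda>x. neg_trunc' (\<phi> x)) (cls d))\<bar> \<le> norm (g - cls d) * norm (mul (\<lambda>x. neg_trunc' (\<phi> x)) (cls d))"
        by (rule Cauchy_Schwarz_ineq2)
      also have "\<dots> \<le> norm (g - cls d) * norm (cls d)"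
        using norm_mul_le[OF b, of "cls d"] by (intro mult_left_mono) auto
      finally show ?thesis by linarith
    qed
    ultimately show ?thesis by (simp add: m inner_diff_left)
  qed
qed

text \<open>Weak maximum principle: testing the resolvent equation with \<eta>(u), \<eta> =
  \<open>neg_trunc\<close>, gives <u, \<eta>(u)> \<le> <f, \<eta>(u)> \<le> 0, while s \<eta>(s)
  \<ge> 0 with equality only for s \<ge> 0. The function \<eta>(u) is reached as the limit of
  \<eta>(\<phi>_n) for test functions \<phi>_n converging to u.\<close>

lemma resolvent_nonneg:
  assumes \<Omega>: "open \<Omega>" and h: "0 < h" and f: "f \<in> nonneg_cone"
  shows "grad.resolvent \<Omega> h f \<in> nonneg_cone"
proof -
  define u where "u = grad.resolvent \<Omega> h f"
  obtain g1 g2 where g: "(u, g1, g2) \<in> grad_graph \<Omega>"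
    and t: "\<And>v k. (v, k) \<in> grad_graph \<Omega> \<Longrightarrow> inner (g1, g2) k = inner ((1 / h) *\<^sub>R (f - u)) v"
    using grad.form_op_resolvent[OF h, of \<Omega> f] unfolding grad.form_op_def u_def by (metis surj_pair)
  obtain p where p: "\<And>n. p n \<in> smooth_graph \<Omega>" "p \<longlonglongrightarrow> (u, g1, g2)"
    using g unfolding grad_graph_def closure_sequential by blast
  then have "\<forall>n. \<exists>\<phi> d1 d2. Cc1 \<Omega> \<phi> d1 d2 \<and> p n = (cls \<phi>, cls d1, cls d2)"
    unfolding smooth_graph_def by blast
  then obtain \<phi> d1 d2 where c: "\<And>n. Cc1 \<Omega> (\<phi> n) (d1 n) (d2 n)"
    and pn: "\<And>n. p n = (cls (\<phi> n), cls (d1 n), cls (d2 n))" by metis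
  have l: "(\<lambda>n. cls (\<phi> n)) \<longlonglongrightarrow> u" "(\<lambda>n. cls (d1 n)) \<longlonglongrightarrow> g1" "(\<lambda>n. cls (d2 n)) \<longlonglongrightarrow> g2"
    using tendsto_fst[OF p(2)] tendsto_fst[OF tendsto_snd[OF p(2)]] tendsto_snd[OF tendsto_snd[OF p(2)]]
    by (simp_all add: pn)
  let ?\<zeta> = "\<lambda>n. cls (\<lambda>x. neg_trunc (\<phi> n x))"
  let ?z = "cls (\<lambda>x. neg_trunc (rep u x))"
  note s = Cc1_square_integrable[OF c]
  have "?\<zeta> \<longlonglongrightarrow> ?z"
  proof (rule LIM_zero_cancel, rule Lim_null_comparison)
    have "norm (?\<zeta> n - ?z) \<le> norm (cls (\<phi> n) - u)" for n
    proof -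
      note sd = square_integrable_diff[OF s(1)[of n] square_integrable_rep[of u]]
      have "norm (cls (\<lambda>x. neg_trunc (\<phi> n x) - neg_trunc (rep u x))) \<le> norm (cls (\<lambda>x. \<phi> n x - rep u x))"
        by (rule norm_cls_mono[OF sd])
          (use neg_trunc_lipschitz square_integrable_measurable[OF square_integrable_diff[OF
             square_integrable_neg_trunc[OF s(1)[of n]] square_integrable_neg_trunc[OF square_integrable_rep[of u]]]] in auto)
      then show ?thesis
        by (simp add: cls_diff[symmetric] square_integrable_neg_trunc s square_integrable_rep)
    qed
    then show "\<forall>\<^sub>F n in sequentially. norm (?\<zeta> n - ?z) \<le> norm (cls (\<phi> n) - u)" by simp
    show "(\<lambda>n. norm (cls (\<phi> n) - u)) \<longlonglongrightarrow> 0" using l(1) by (simp add: tendsto_norm_zero_iff LIM_zero)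
  qed
  then have "(\<lambda>n. inner ((1 / h) *\<^sub>R (f - u)) (?\<zeta> n)) \<longlonglongrightarrow> inner ((1 / h) *\<^sub>R (f - u)) ?z"
    by (intro tendsto_intros)
  moreover have "(\<lambda>n. - (norm (g1 - cls (d1 n)) * norm (cls (d1 n))) - norm (g2 - cls (d2 n)) * norm (cls (d2 n)))
      \<longlonglongrightarrow> - (norm (g1 - g1) * norm g1) - norm (g2 - g2) * norm g2"
    by (intro tendsto_intros l)
  moreover have "- (norm (g1 - cls (d1 n)) * norm (cls (d1 n))) - norm (g2 - cls (d2 n)) * norm (cls (d2 n))
      \<le> inner ((1 / h) *\<^sub>R (f - u)) (?\<zeta> n)" for n
    using t[OF inner_grad_neg_trunc(1)[OF \<Omega> c[of n]]]
      inner_grad_neg_trunc(2)[OF \<Omega> c[of n] s(2)[of n], of g1] inner_grad_neg_trunc(2)[OF \<Omega> c[of n] s(3)[of n], of g2]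
    by simp
  ultimately have "0 \<le> inner ((1 / h) *\<^sub>R (f - u)) ?z"
    by (intro LIMSEQ_le[of "\<lambda>n. - (norm (g1 - cls (d1 n)) * norm (cls (d1 n))) - norm (g2 - cls (d2 n)) * norm (cls (d2 n))" 0]) auto
  then have le: "inner u ?z \<le> inner f ?z" using h by (simp add: inner_diff_left zero_le_divide_iff)
  note z = square_integrable_neg_trunc[OF square_integrable_rep[of u]]
  have "0 \<le> inner f (cls (\<lambda>x. - 1 * neg_trunc (rep u x)))"
    using f square_integrable_scale[OF z, of "-1"] neg_trunc_sign(1) unfolding nonneg_cone_iff by simp
  then have "inner f ?z \<le> 0" by (simp only: cls_scale[OF z, symmetric] inner_scaleR_right)
  then have "inner u ?z \<le> 0" using le by simp
  moreover have "inner u ?z = (LINT x|lborel. rep u x * neg_trunc (rep u x))"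
    using inner_cls[OF square_integrable_rep z, of u] by simp
  moreover have "0 \<le> (LINT x|lborel. rep u x * neg_trunc (rep u x))"
    by (rule integral_nonneg_AE) (simp add: neg_trunc_sign)
  ultimately have "(LINT x|lborel. rep u x * neg_trunc (rep u x)) = 0" by simp
  then have "AE x in lborel. rep u x * neg_trunc (rep u x) = 0"
    using integral_nonneg_eq_0_iff_AE[OF square_integrable_mult[OF square_integrable_rep z]] neg_trunc_sign(2) by simp
  then show ?thesis unfolding u_def[symmetric] nonneg_cone_def using neg_trunc_sign(3) by auto
qed

text \<open>The semigroup started from a nonnegative bump; the freedom in \<open>S\<close> and
  \<open>c\<close> places the bump where the comparison function is large.\<close>

lemma exists_nonneg_solution:
  assumes \<Omega>: "open \<Omega>" and S: "open S" "S \<subseteq> \<Omega>" "c \<in> S"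
  obtains u0 K U where "continuous_on UNIV u0" "compact K" "K \<subseteq> S" "\<And>x. x \<notin> K \<Longrightarrow> u0 x = 0"
    "\<And>x. 0 \<le> u0 x" "0 < u0 c" "square_integrable u0" "U 0 = cls u0"
    "(U \<longlongrightarrow> U 0) (at 0 within {0..})" "\<And>t. 0 \<le> t \<Longrightarrow> U t \<in> nonneg_cone"
    "\<And>t. 0 < t \<Longrightarrow> \<exists>F. grad.form_op \<Omega> (U t) F \<and> (U has_vector_derivative - F) (at t)"
proof -
  obtain u f e d K where u: "continuous_on UNIV u" "compact K" "K \<subseteq> S" "\<And>x. x \<notin> K \<Longrightarrow> u x = 0"
    "\<And>x. 0 \<le> u x" "0 < u c"
    and op: "grad.form_op \<Omega> (cls u) f" "grad.form_op \<Omega> f e" "grad.form_op \<Omega> e d"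
    by (rule exists_smooth_bump[OF \<Omega> S]) (rule that, assumption+)
  have s: "square_integrable u"
    unfolding square_integrable_def
  proof
    show "u \<in> borel_measurable lborel" using borel_measurable_continuous_onI[OF u(1)] by simp
    show "integrable lborel (\<lambda>x. (u x)\<^sup>2)"
      by (rule integrable_compact_support[OF _ u(2)]) (use u in \<open>auto intro!: continuous_intros\<close>)
  qed
  have C: "cls u \<in> nonneg_cone" unfolding nonneg_cone_def using rep_cls[OF s] u(5) by (auto elim!: eventually_mono)
  let ?U = "\<lambda>t. grad.semigroup \<Omega> t (cls u)"
  show thesis
  proof (rule that[OF u s, of ?U])
    show "?U 0 = cls u" by simp
    show "(?U \<longlongrightarrow> ?U 0) (at 0 within {0..})" using grad.semigroup_tendsto_0[OF op(1,2)] by simp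
    show "?U t \<in> nonneg_cone" if "0 \<le> t" for t
      by (rule grad.semigroup_closed_invariant[OF that op(1,2) closed_nonneg_cone C resolvent_nonneg[OF \<Omega>]])
    show "\<exists>F. grad.form_op \<Omega> (?U t) F \<and> (?U has_vector_derivative - F) (at t)" if "0 < t" for t
      using grad.form_op_semigroup[OF less_imp_le[OF that] op] grad.semigroup_has_vector_derivative[OF that op] by blast
  qed
qed

section \<open>The comparison function\<close>

lemma C1_on_transform:
  assumes S: "open S" and g: "C1_on S g f1 f2" and eq: "\<And>x. x \<in> S \<Longrightarrow> g x = f x"
  shows "C1_on S f f1 f2"
  using g unfolding C1_on_def
  by (auto intro: has_derivative_transform_within_open[OF _ S _ eq])

lemma Cc1_extend:
  assumes S: "open S" and K: "compact K" "K \<subseteq> S" and f: "C1_on S f f1 f2"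
    and 0: "\<And>x. x \<in> S \<Longrightarrow> x \<notin> K \<Longrightarrow> f x = 0 \<and> f1 x = 0 \<and> f2 x = 0"
  shows "Cc1 S (\<lambda>x. if x \<in> S then f x else 0) (\<lambda>x. if x \<in> S then f1 x else 0) (\<lambda>x. if x \<in> S then f2 x else 0)"
proof (rule Cc1_glue[OF S K])
  show "C1_on S (\<lambda>x. if x \<in> S then f x else 0) (\<lambda>x. if x \<in> S then f1 x else 0) (\<lambda>x. if x \<in> S then f2 x else 0)"
    by (rule C1_on_cong[OF C1_on_transform[OF S f]]) auto
qed (use 0 in auto)

text \<open>A convex \<open>C\<^sup>2\<close> substitute for the positive part with linear growth.\<close>

definition psi :: "real \<Rightarrow> real" where
  "psi s = (if s > 0 then s ^ 3 / (1 + s)\<^sup>2 else 0)"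

definition psi1 :: "real \<Rightarrow> real" where
  "psi1 s = (if s > 0 then s\<^sup>2 * (s + 3) / (1 + s) ^ 3 else 0)"

definition psi2 :: "real \<Rightarrow> real" where
  "psi2 s = (if s > 0 then 6 * s / (1 + s) ^ 4 else 0)"

lemma DERIV_psi: "(psi has_real_derivative psi1 s) (at s)"
  unfolding psi_def[abs_def] psi1_def
proof (rule DERIV_pos_part)
  fix y :: real assume y: "0 < y"
  have nz: "1 + y \<noteq> 0" using y by simp
  show "((\<lambda>s. s ^ 3 / (1 + s)\<^sup>2) has_real_derivative y\<^sup>2 * (y + 3) / (1 + y) ^ 3) (at y)"
  proof (rule DERIV_cong[OF DERIV_divide])
    show "((\<lambda>s. s ^ 3) has_real_derivative 3 * y\<^sup>2) (at y)" "((\<lambda>s. (1 + s)\<^sup>2) has_real_derivative 2 * (1 + y)) (at y)"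
      by (auto intro!: derivative_eq_intros)
    have "3 * y\<^sup>2 * (1 + y)\<^sup>2 - y ^ 3 * (2 * (1 + y)) = (1 + y) * (y\<^sup>2 * (y + 3))"
      by (simp add: power2_eq_square power3_eq_cube algebra_simps)
    moreover have "(1 + y)\<^sup>2 * (1 + y)\<^sup>2 = (1 + y) * (1 + y) ^ 3"
      by (simp add: power2_eq_square power3_eq_cube)
    ultimately show "(3 * y\<^sup>2 * (1 + y)\<^sup>2 - y ^ 3 * (2 * (1 + y))) / ((1 + y)\<^sup>2 * (1 + y)\<^sup>2) = y\<^sup>2 * (y + 3) / (1 + y) ^ 3"
      using nz by (simp only: mult_divide_mult_cancel_left not_False_eq_True)
  qed (use nz in simp)
  assume "y \<le> 1"
  then have "y ^ 3 \<le> y\<^sup>2" using y by (intro power_decreasing) auto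
  moreover have "y ^ 3 / (1 + y)\<^sup>2 \<le> y ^ 3 / 1" using y by (intro divide_left_mono) (auto simp: one_le_power)
  moreover have "0 \<le> y ^ 3 / (1 + y)\<^sup>2" using y by simp
  ultimately show "\<bar>y ^ 3 / (1 + y)\<^sup>2\<bar> \<le> 1 * y\<^sup>2" by simp
qed

lemma DERIV_psi1: "(psi1 has_real_derivative psi2 s) (at s)"
  unfolding psi1_def[abs_def] psi2_def
proof (rule DERIV_pos_part)
  fix y :: real assume y: "0 < y"
  have nz: "1 + y \<noteq> 0" using y by simp
  show "((\<lambda>s. s\<^sup>2 * (s + 3) / (1 + s) ^ 3) has_real_derivative 6 * y / (1 + y) ^ 4) (at y)"
  proof (rule DERIV_cong[OF DERIV_divide])
    show "((\<lambda>s. s\<^sup>2 * (s + 3)) has_real_derivative 2 * y * (y + 3) + y\<^sup>2) (at y)"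
      "((\<lambda>s. (1 + s) ^ 3) has_real_derivative 3 * (1 + y)\<^sup>2) (at y)"
      by (auto intro!: derivative_eq_intros simp: mult.commute)
    have "(2 * y * (y + 3) + y\<^sup>2) * (1 + y) ^ 3 - y\<^sup>2 * (y + 3) * (3 * (1 + y)\<^sup>2) = (1 + y)\<^sup>2 * (6 * y)"
      by (simp add: power2_eq_square power3_eq_cube algebra_simps)
    moreover have "(1 + y) ^ 3 * (1 + y) ^ 3 = (1 + y)\<^sup>2 * (1 + y) ^ 4"
      by (simp flip: power_add)
    moreover have "(1 + y)\<^sup>2 \<noteq> 0" using nz by simp
    ultimately show "((2 * y * (y + 3) + y\<^sup>2) * (1 + y) ^ 3 - y\<^sup>2 * (y + 3) * (3 * (1 + y)\<^sup>2)) / ((1 + y) ^ 3 * (1 + y) ^ 3) = 6 * y / (1 + y) ^ 4"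
      by (simp only: mult_divide_mult_cancel_left not_False_eq_True)
  qed (use nz in simp)
  assume "y \<le> 1"
  then have "y\<^sup>2 * (y + 3) \<le> y\<^sup>2 * 4" by (intro mult_left_mono) auto
  moreover have "y\<^sup>2 * (y + 3) / (1 + y) ^ 3 \<le> y\<^sup>2 * (y + 3) / 1"
    using y by (intro divide_left_mono) (auto simp: one_le_power)
  moreover have "0 \<le> y\<^sup>2 * (y + 3) / (1 + y) ^ 3" using y by simp
  ultimately show "\<bar>y\<^sup>2 * (y + 3) / (1 + y) ^ 3\<bar> \<le> 4 * y\<^sup>2" by linarith
qed

lemma continuous_psi: "continuous_on UNIV psi" "continuous_on UNIV psi1" "continuous_on UNIV psi2"
proof -
  show "continuous_on UNIV psi"
    by (intro continuous_at_imp_continuous_on ballI DERIV_isCont[OF DERIV_psi])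
  show "continuous_on UNIV psi1"
    by (intro continuous_at_imp_continuous_on ballI DERIV_isCont[OF DERIV_psi1])
  show "continuous_on UNIV psi2"
    unfolding psi2_def[abs_def] by (rule continuous_pos_part) (auto intro!: continuous_intros)
qed

lemma psi_nonpos: "s \<le> 0 \<Longrightarrow> psi s = 0 \<and> psi1 s = 0 \<and> psi2 s = 0"
  by (simp add: psi_def psi1_def psi2_def)

lemma psi2_nonneg: "0 \<le> psi2 s"
  by (simp add: psi2_def)

lemma psi_nonneg: "0 \<le> psi s"
  by (simp add: psi_def)

lemma psi_le: "psi s \<le> max 0 s"
proof (cases "s > 0")
  case True
  have "s ^ 3 \<le> s * (1 + s)\<^sup>2" using True by (simp add: power2_eq_square power3_eq_cube algebra_simps)
  then show ?thesis using True by (simp add: psi_def divide_le_eq)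
qed (simp add: psi_def)

lemma psi_ge: "1 \<le> s \<Longrightarrow> 1 / 4 \<le> psi s"
proof -
  assume s: "1 \<le> s"
  have "(1 + s)\<^sup>2 \<le> (2 * s)\<^sup>2" using s by (intro power_mono) auto
  also have "\<dots> \<le> 4 * s ^ 3" using s power_increasing[of 2 3 s] by simp
  finally show ?thesis using s by (simp add: psi_def le_divide_eq)
qed

text \<open>\<open>G(\<bar>x\<bar>\<^sup>2) sin (\<nu> \<alpha>)\<close> with \<open>G(s) = A s\<^bsup>\<nu>/2\<^esup> e\<^bsup>-s/(4\<sigma>)\<^esup>\<close> is the Gaussian solution of the heat equation
  with the angular dependence of the first Dirichlet mode of the wedge.\<close>

lemma heat_profile_laplacian:
  fixes \<alpha> :: plane_fun and A \<nu> \<sigma> :: real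
  assumes S0: "\<And>x. x \<in> S \<Longrightarrow> x \<noteq> 0"
    and \<alpha>: "C1_on S \<alpha> (\<lambda>x. - snd x / sqn x) (\<lambda>x. fst x / sqn x)" and \<sigma>: "0 < \<sigma>"
  defines "H \<equiv> \<lambda>x. A * sqn x powr (\<nu> / 2) * exp (- sqn x / (4 * \<sigma>)) * sin (\<nu> * \<alpha> x)"
  shows "\<exists>H1 H2 H11 H12 H21 H22. C1_on S H H1 H2 \<and> C1_on S H1 H11 H12 \<and> C1_on S H2 H21 H22 \<and>
    (\<forall>x\<in>S. H11 x + H22 x = (sqn x / (4 * \<sigma>\<^sup>2) - (1 + \<nu>) / \<sigma>) * H x)"
proof -
  define l where "l s = \<nu> / (2 * s) - 1 / (4 * \<sigma>)" for s
  define l' where "l' s = - \<nu> / (2 * s\<^sup>2)" for s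
  define G where "G s = A * s powr (\<nu> / 2) * exp (- s / (4 * \<sigma>))" for s
  have im: "sqn ` S \<subseteq> {0<..}" using S0 sqn_pos by auto
  have dl: "(l has_real_derivative l' s) (at s)" if "0 < s" for s
    unfolding l_def[abs_def] l'_def using that
    by (auto intro!: derivative_eq_intros simp: power2_eq_square)
  have cl: "continuous_on {0<..} l" "continuous_on {0<..} l'"
    unfolding l_def[abs_def] l'_def[abs_def] using \<sigma> by (auto intro!: continuous_intros)
  have dG: "(G has_real_derivative G s * l s) (at s)" if s: "0 < s" for s
  proof -
    have 1: "((\<lambda>s. s powr (\<nu> / 2)) has_real_derivative \<nu> / 2 * s powr (\<nu> / 2 - 1)) (at s)"
      by (rule has_real_derivative_powr[OF s])
    have 2: "((\<lambda>s. exp (- s / (4 * \<sigma>))) has_real_derivative exp (- s / (4 * \<sigma>)) * (- 1 / (4 * \<sigma>))) (at s)"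
      using \<sigma> by (auto intro!: derivative_eq_intros)
    have pd: "s powr (\<nu> / 2 - 1) = s powr (\<nu> / 2) / s" unfolding powr_diff using s by simp
    show ?thesis
      unfolding G_def[abs_def]
      by (rule DERIV_cong[OF DERIV_mult[OF DERIV_cmult[OF 1] 2]])
        (simp add: pd l_def algebra_simps)
  qed
  have cG: "continuous_on {0<..} G" by (rule DERIV_continuous_on, rule DERIV_subset[OF dG]) auto
  have CG: "C1_on S (\<lambda>x. G (sqn x)) (\<lambda>x. G (sqn x) * l (sqn x) * (2 * fst x)) (\<lambda>x. G (sqn x) * l (sqn x) * (2 * snd x))"
    using C1_on_radial[of S G "\<lambda>s. G s * l s"] dG im
      continuous_on_subset[OF continuous_on_mult[OF cG cl(1)] im] by auto
  define L where "L x = 2 * l (sqn x)" for x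
  define a where "a x = 2 * (l' (sqn x) * 2)" for x
  have CL: "C1_on S L (\<lambda>x. a x * fst x) (\<lambda>x. a x * snd x)"
  proof -
    have "C1_on S (\<lambda>x. l (sqn x)) (\<lambda>x. l' (sqn x) * (2 * fst x)) (\<lambda>x. l' (sqn x) * (2 * snd x))"
      by (rule C1_on_radial) (use dl im continuous_on_subset[OF cl(2) im] in auto)
    from C1_on_cmult[OF this, of 2] show ?thesis
      unfolding L_def[abs_def] by (rule C1_on_cong) (auto simp: a_def)
  qed
  define N where "N x = - \<nu> / sqn x" for x
  define b where "b x = \<nu> / (sqn x)\<^sup>2 * 2" for x
  have CN: "C1_on S N (\<lambda>x. b x * fst x) (\<lambda>x. b x * snd x)"
  proof -
    have "C1_on S (\<lambda>x. (\<lambda>s. - \<nu> / s) (sqn x)) (\<lambda>x. (\<lambda>s. \<nu> / s\<^sup>2) (sqn x) * (2 * fst x)) (\<lambda>x. (\<lambda>s. \<nu> / s\<^sup>2) (sqn x) * (2 * snd x))"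
    proof (rule C1_on_radial)
      show "((\<lambda>s. - \<nu> / s) has_real_derivative \<nu> / s\<^sup>2) (at s)" if "s \<in> sqn ` S" for s
        using subsetD[OF im that] by (auto intro!: derivative_eq_intros simp: power2_eq_square)
      show "continuous_on (sqn ` S) (\<lambda>s. \<nu> / s\<^sup>2)" using im by (auto intro!: continuous_intros)
    qed
    then show ?thesis unfolding N_def[abs_def] by (rule C1_on_cong) (auto simp: b_def)
  qed
  note ang = C1_on_cmult[OF \<alpha>, of \<nu>]
  have c\<alpha>: "continuous_on S (\<lambda>x. \<nu> * \<alpha> x)" by (rule C1_on_continuous[OF ang])
  have CS: "C1_on S (\<lambda>x. sin (\<nu> * \<alpha> x)) (\<lambda>x. cos (\<nu> * \<alpha> x) * (snd x * N x)) (\<lambda>x. cos (\<nu> * \<alpha> x) * (- fst x * N x))"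
    by (rule C1_on_cong[OF C1_on_compose[OF ang, of sin cos]])
      (auto simp: N_def intro!: DERIV_sin continuous_intros c\<alpha>)
  have CC: "C1_on S (\<lambda>x. cos (\<nu> * \<alpha> x)) (\<lambda>x. - sin (\<nu> * \<alpha> x) * (snd x * N x)) (\<lambda>x. - sin (\<nu> * \<alpha> x) * (- fst x * N x))"
    by (rule C1_on_cong[OF C1_on_compose[OF ang, of cos "\<lambda>x. - sin x"]])
      (auto simp: N_def intro!: DERIV_cos continuous_intros c\<alpha>)
  \<comment> \<open>The sine profile H and its cosine companion C are closed under differentiation:
    each first derivative is a combination of the two, with coefficients built from L (radial
    logarithmic derivative) and N (angular part). The product rule then yields the second
    derivatives.\<close>
  define C where "C x = G (sqn x) * cos (\<nu> * \<alpha> x)" for x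
  have H_eq: "H = (\<lambda>x. G (sqn x) * sin (\<nu> * \<alpha> x))" by (simp add: H_def G_def)
  define H1 where "H1 x = H x * (fst x * L x) + C x * (snd x * N x)" for x
  define H2 where "H2 x = H x * (snd x * L x) + C x * (- fst x * N x)" for x
  have CH: "C1_on S H H1 H2"
    unfolding H_eq by (rule C1_on_cong[OF C1_on_mult[OF CG CS]]) (auto simp: H1_def H2_def H_eq C_def L_def)
  have CCC: "C1_on S C (\<lambda>x. C x * (fst x * L x) - H x * (snd x * N x)) (\<lambda>x. C x * (snd x * L x) - H x * (- fst x * N x))"
    unfolding C_def[abs_def] by (rule C1_on_cong[OF C1_on_mult[OF CG CC]]) (auto simp: H_eq L_def)
  have neg_fst: "C1_on S (\<lambda>x. - fst x) (\<lambda>x. - 1) (\<lambda>x. 0)" using C1_on_cmult[OF C1_on_fst, of S "-1"] by simp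
  note D1 = C1_on_add[OF C1_on_mult[OF CH C1_on_mult[OF C1_on_fst CL]] C1_on_mult[OF CCC C1_on_mult[OF C1_on_snd CN]]]
  note D2 = C1_on_add[OF C1_on_mult[OF CH C1_on_mult[OF C1_on_snd CL]] C1_on_mult[OF CCC C1_on_mult[OF neg_fst CN]]]
  note D = D1[folded H1_def] D2[folded H2_def]
  show ?thesis
  proof (intro exI conjI)
    show "C1_on S H H1 H2" by (rule CH)
    show "C1_on S H1 (\<lambda>x. (H1 x * (fst x * L x) + H x * (1 * L x + fst x * (a x * fst x))) +
        ((C x * (fst x * L x) - H x * (snd x * N x)) * (snd x * N x) + C x * (0 * N x + snd x * (b x * fst x))))
        (\<lambda>x. (H2 x * (fst x * L x) + H x * (0 * L x + fst x * (a x * snd x))) +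
        ((C x * (snd x * L x) - H x * (- fst x * N x)) * (snd x * N x) + C x * (1 * N x + snd x * (b x * snd x))))"
      by (rule D(1))
    show "C1_on S H2 (\<lambda>x. (H1 x * (snd x * L x) + H x * (0 * L x + snd x * (a x * fst x))) +
        ((C x * (fst x * L x) - H x * (snd x * N x)) * (- fst x * N x) + C x * (- 1 * N x + - fst x * (b x * fst x))))
        (\<lambda>x. (H2 x * (snd x * L x) + H x * (1 * L x + snd x * (a x * snd x))) +
        ((C x * (snd x * L x) - H x * (- fst x * N x)) * (- fst x * N x) + C x * (0 * N x + - fst x * (b x * snd x))))"
      by (rule D(2))
    show "\<forall>x\<in>S. (H1 x * (fst x * L x) + H x * (1 * L x + fst x * (a x * fst x))) +
        ((C x * (fst x * L x) - H x * (snd x * N x)) * (snd x * N x) + C x * (0 * N x + snd x * (b x * fst x))) +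
        ((H2 x * (snd x * L x) + H x * (1 * L x + snd x * (a x * snd x))) +
        ((C x * (snd x * L x) - H x * (- fst x * N x)) * (- fst x * N x) + C x * (0 * N x + - fst x * (b x * snd x))))
      = (sqn x / (4 * \<sigma>\<^sup>2) - (1 + \<nu>) / \<sigma>) * H x"
    proof
      fix x assume x: "x \<in> S"
      define s where "s = sqn x"
      have s: "0 < s" using S0[OF x] sqn_pos by (simp add: s_def)
      \<comment> \<open>The C terms cancel, since the radial and the rotational field are orthogonal
        and the latter is divergence free.\<close>
      have alg: "((h * (X * L) + c * (Y * N)) * (X * L) + h * (1 * L + X * (a * X))) +
        ((c * (X * L) - h * (Y * N)) * (Y * N) + c * (0 * N + Y * (b * X))) +
        (((h * (Y * L) + c * (- X * N)) * (Y * L) + h * (1 * L + Y * (a * Y))) +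
        ((c * (Y * L) - h * (- X * N)) * (- X * N) + c * (0 * N + - X * (b * Y))))
        = (2 * L + (X * X + Y * Y) * (L\<^sup>2 + a - N\<^sup>2)) * h" for h X Y L c N a b :: real
        by (simp add: algebra_simps power2_eq_square)
      have ss: "fst x * fst x + snd x * snd x = s" by (simp add: s_def sqn_def power2_eq_square)
      have "2 * L x + s * ((L x)\<^sup>2 + a x - (N x)\<^sup>2) = s / (4 * \<sigma>\<^sup>2) - (1 + \<nu>) / \<sigma>"
        unfolding L_def a_def N_def s_def[symmetric] l_def l'_def using s \<sigma>
        by (simp add: field_simps power2_eq_square)
      then show "(H1 x * (fst x * L x) + H x * (1 * L x + fst x * (a x * fst x))) +
        ((C x * (fst x * L x) - H x * (snd x * N x)) * (snd x * N x) + C x * (0 * N x + snd x * (b x * fst x))) +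
        ((H2 x * (snd x * L x) + H x * (1 * L x + snd x * (a x * snd x))) +
        ((C x * (snd x * L x) - H x * (- fst x * N x)) * (- fst x * N x) + C x * (0 * N x + - fst x * (b x * snd x))))
        = (sqn x / (4 * \<sigma>\<^sup>2) - (1 + \<nu>) / \<sigma>) * H x"
        unfolding H1_def H2_def alg ss by (simp only: s_def)
    qed
  qed
qed

text \<open>The Laplacian of \<open>psi (H x - c)\<close> is \<open>psi1 (H x - c)\<close> times
  that of H plus \<open>psi2 (H x - c)\<close> times |\<nabla>H|^2, and convexity makes the second
  term nonnegative. As \<open>psi\<close> and both derivatives vanish on the negative half-line,
  everything extends by zero outside K.\<close>

lemma truncated_laplacian:
  assumes S: "open S" and K: "compact K" "K \<subseteq> S" and small: "\<And>x. x \<in> S \<Longrightarrow> x \<notin> K \<Longrightarrow> H x \<le> c"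
    and H: "C1_on S H H1 H2" "C1_on S H1 H11 H12" "C1_on S H2 H21 H22"
  shows "\<exists>p q p1 p2 q1 q2. Cc1 S (\<lambda>x. if x \<in> S then psi (H x - c) else 0) p q \<and>
    Cc1 S p p1 p2 \<and> Cc1 S q q1 q2 \<and> (\<forall>x. x \<notin> S \<longrightarrow> p1 x + q2 x = 0) \<and>
    (\<forall>x\<in>S. psi1 (H x - c) * (H11 x + H22 x) \<le> p1 x + q2 x)"
proof -
  have Hc: "C1_on S (\<lambda>x. H x - c) H1 H2" using C1_on_diff[OF H(1) C1_on_const, of c] by simp
  have cc: "continuous_on S (\<lambda>x. f (H x - c))" if "continuous_on UNIV f" for f :: "real \<Rightarrow> real"
    by (rule continuous_on_compose2[OF that C1_on_continuous[OF Hc]]) auto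
  note f0 = C1_on_compose[OF Hc DERIV_psi cc[OF continuous_psi(2)]]
  note f1 = C1_on_compose[OF Hc DERIV_psi1 cc[OF continuous_psi(3)]]
  note p = C1_on_mult[OF f1 H(2)] and q = C1_on_mult[OF f1 H(3)]
  have z: "psi (H x - c) = 0 \<and> psi1 (H x - c) = 0 \<and> psi2 (H x - c) = 0" if "x \<in> S" "x \<notin> K" for x
    using psi_nonpos[of "H x - c"] small[OF that] by simp
  note e0 = Cc1_extend[OF S K f0] and e1 = Cc1_extend[OF S K p] and e2 = Cc1_extend[OF S K q]
  show ?thesis
  proof (intro exI conjI)
    show "Cc1 S (\<lambda>x. if x \<in> S then psi (H x - c) else 0) (\<lambda>x. if x \<in> S then psi1 (H x - c) * H1 x else 0) (\<lambda>x. if x \<in> S then psi1 (H x - c) * H2 x else 0)"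
      by (rule e0) (use z in auto)
    show "Cc1 S (\<lambda>x. if x \<in> S then psi1 (H x - c) * H1 x else 0)
      (\<lambda>x. if x \<in> S then psi2 (H x - c) * H1 x * H1 x + psi1 (H x - c) * H11 x else 0)
      (\<lambda>x. if x \<in> S then psi2 (H x - c) * H2 x * H1 x + psi1 (H x - c) * H12 x else 0)"
      by (rule e1) (use z in auto)
    show "Cc1 S (\<lambda>x. if x \<in> S then psi1 (H x - c) * H2 x else 0)
      (\<lambda>x. if x \<in> S then psi2 (H x - c) * H1 x * H2 x + psi1 (H x - c) * H21 x else 0)
      (\<lambda>x. if x \<in> S then psi2 (H x - c) * H2 x * H2 x + psi1 (H x - c) * H22 x else 0)"
      by (rule e2) (use z in auto)
    have "0 \<le> psi2 (H x - c) * H1 x * H1 x + psi2 (H x - c) * H2 x * H2 x" for x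
      using psi2_nonneg by (simp add: mult.assoc)
    then show "\<forall>x\<in>S. psi1 (H x - c) * (H11 x + H22 x)
      \<le> (if x \<in> S then psi2 (H x - c) * H1 x * H1 x + psi1 (H x - c) * H11 x else 0) +
        (if x \<in> S then psi2 (H x - c) * H2 x * H2 x + psi1 (H x - c) * H22 x else 0)"
      by (simp add: distrib_left)
  qed simp
qed

section \<open>Gaussian norms and the time-dependent test function\<close>

lemma powr_le_exp:
  fixes s p k :: real
  assumes "0 < p" "0 < k" "0 \<le> s"
  shows "s powr p \<le> (p / k) powr p * exp (k * s)"
proof -
  have "s = p / k * (k * s / p)" using assms by simp
  also have "\<dots> \<le> p / k * exp (k * s / p)"
    using assms by (intro mult_left_mono order_trans[OF _ exp_ge_add_one_self]) auto
  finally have "s powr p \<le> (p / k * exp (k * s / p)) powr p" using assms by (intro powr_mono2) auto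
  also have "\<dots> = (p / k) powr p * exp (k * s)"
  proof -
    have "exp (k * s / p) powr p = exp (k * s)" using assms by (simp add: powr_def)
    then show ?thesis using assms by (subst powr_mult) auto
  qed
  finally show ?thesis .
qed

text \<open>Up to the factor 4 pi T the integrand is a product of two normal densities of variance
  2T.\<close>

lemma gaussian_integral:
  assumes T: "0 < T"
  shows "integrable lborel (\<lambda>x. exp (- sqn x / (4 * T)))" "(LINT x|lborel. exp (- sqn x / (4 * T))) = 4 * pi * T"
proof -
  define d where "d = normal_density 0 (sqrt (2 * T))"
  have d: "d t = 1 / sqrt (4 * pi * T) * exp (- t\<^sup>2 / (4 * T))" for t
    using T by (simp add: d_def normal_density_def mult_ac)
  have eq: "exp (- sqn x / (4 * T)) = 4 * pi * T * (d (fst x) * d (snd x))" for x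
  proof -
    have "exp (- sqn x / (4 * T)) = exp (- (fst x)\<^sup>2 / (4 * T)) * exp (- (snd x)\<^sup>2 / (4 * T))"
      by (simp add: sqn_def add_divide_distrib flip: exp_add) (simp add: diff_divide_distrib)
    moreover have "sqrt (4 * pi * T) * sqrt (4 * pi * T) = 4 * pi * T" using T by simp
    ultimately show ?thesis using T unfolding d by (simp add: field_simps)
  qed
  have id: "integrable lborel d" "(LINT t|lborel. d t) = 1" using T by (simp_all add: d_def)
  have d0: "0 \<le> d t" for t by (simp add: d_def)
  have m: "(\<lambda>x. d (fst x) * d (snd x)) \<in> borel_measurable (lborel \<Otimes>\<^sub>M lborel)"
    using id(1) by (intro borel_measurable_times measurable_compose[OF measurable_fst] measurable_compose[OF measurable_snd]) auto
  have i: "integrable (lborel \<Otimes>\<^sub>M lborel) (\<lambda>x. d (fst x) * d (snd x))"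
    by (rule lborel_pair.Fubini_integrable[OF m]) (use id d0 in \<open>auto simp: abs_mult\<close>)
  have "(LINT x|(lborel \<Otimes>\<^sub>M lborel). d (fst x) * d (snd x)) = 1"
    using lborel_pair.integral_fst'[OF i] id by simp
  then show "integrable lborel (\<lambda>x. exp (- sqn x / (4 * T)))" "(LINT x|lborel. exp (- sqn x / (4 * T))) = 4 * pi * T"
    unfolding eq using i by (simp_all add: lborel_prod)
qed

text \<open>Half of the exponential in f^2 absorbs the power and yields T^\<nu>; the other half is
  integrated and yields T.\<close>

lemma norm_gaussian_profile:
  assumes T: "0 < T" and \<nu>: "0 < \<nu>"
  defines "f \<equiv> \<lambda>x. sqn x powr (\<nu> / 2) * exp (- sqn x / (4 * T))"
  shows "square_integrable f" "norm (cls f) \<le> sqrt ((4 * \<nu>) powr \<nu> * (4 * pi)) * T powr ((1 + \<nu>) / 2)"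
proof -
  have c: "continuous_on UNIV f"
    unfolding f_def by (intro continuous_intros continuous_on_powr') (use T \<nu> in auto)
  then have m: "f \<in> borel_measurable lborel" by (simp add: borel_measurable_continuous_onI)
  have le: "(f x)\<^sup>2 \<le> (4 * T * \<nu>) powr \<nu> * exp (- sqn x / (4 * T))" for x
  proof -
    have "(sqn x powr (\<nu> / 2))\<^sup>2 = sqn x powr \<nu>"
      by (simp add: power2_eq_square flip: powr_add)
    moreover have "(exp (- sqn x / (4 * T)))\<^sup>2 = exp (- (1 / (4 * T)) * sqn x) * exp (- sqn x / (4 * T))"
      by (simp add: power2_eq_square)
    moreover have "sqn x powr \<nu> \<le> (4 * T * \<nu>) powr \<nu> * exp (1 / (4 * T) * sqn x)"
      using powr_le_exp[OF \<nu>, of "1 / (4 * T)" "sqn x"] T by (simp add: mult.commute)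
    ultimately have "(f x)\<^sup>2 \<le> (4 * T * \<nu>) powr \<nu> * exp (1 / (4 * T) * sqn x) * (exp (- (1 / (4 * T)) * sqn x) * exp (- sqn x / (4 * T)))"
      unfolding f_def power_mult_distrib by (simp only: mult_right_mono exp_ge_zero mult_nonneg_nonneg)
    also have "\<dots> = (4 * T * \<nu>) powr \<nu> * (exp (1 / (4 * T) * sqn x) * exp (- (1 / (4 * T)) * sqn x)) * exp (- sqn x / (4 * T))"
      by (simp only: mult.assoc)
    also have "exp (1 / (4 * T) * sqn x) * exp (- (1 / (4 * T)) * sqn x) = 1"
      by (simp flip: exp_add)
    finally show ?thesis by simp
  qed
  have ig: "integrable lborel (\<lambda>x. (4 * T * \<nu>) powr \<nu> * exp (- sqn x / (4 * T)))"
    using gaussian_integral(1)[OF T] by (rule integrable_mult_right)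
  have i: "integrable lborel (\<lambda>x. (f x)\<^sup>2)"
    by (rule Bochner_Integration.integrable_bound[OF ig]) (use m le in auto)
  then show s: "square_integrable f" using m by (simp add: square_integrable_def)
  have "(LINT x|lborel. (f x)\<^sup>2) \<le> (4 * T * \<nu>) powr \<nu> * (4 * pi * T)"
    using integral_mono[OF i ig le] gaussian_integral(2)[OF T] by simp
  also have "\<dots> = (4 * \<nu>) powr \<nu> * (4 * pi) * T powr (1 + \<nu>)"
    using T \<nu> by (simp add: powr_mult powr_add)
  finally have "norm (cls f) \<le> sqrt ((4 * \<nu>) powr \<nu> * (4 * pi) * T powr (1 + \<nu>))"
    by (simp add: norm_cls[OF s])
  also have "\<dots> = sqrt ((4 * \<nu>) powr \<nu> * (4 * pi)) * T powr ((1 + \<nu>) / 2)"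
    using T by (simp add: real_sqrt_mult powr_half_sqrt_powr)
  finally show "norm (cls f) \<le> sqrt ((4 * \<nu>) powr \<nu> * (4 * pi)) * T powr ((1 + \<nu>) / 2)" .
qed

text \<open>This is (2T)^(1+\<nu>) H with the angular mode h = r^\<nu> sin(\<nu>\<phi>) and s = r^2
  as free parameters, so that time derivatives can be controlled uniformly over a compact parameter
  set. At t = 0 the two powers cancel.\<close>

definition amp :: "real \<Rightarrow> real \<Rightarrow> real \<Rightarrow> real \<Rightarrow> real \<Rightarrow> real" where
  "amp T \<nu> t h s = (2 * T) powr (1 + \<nu>) * (2 * T - t) powr (- (1 + \<nu>)) * h * exp (- s / (4 * (2 * T - t)))"

text \<open>The factor is the opposite of the one in \<open>heat_profile_laplacian\<close> with
  \<sigma> = 2T - t; this is the backward heat equation.\<close>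

lemma DERIV_amp:
  assumes t: "t < 2 * T"
  shows "((\<lambda>t. amp T \<nu> t h s) has_real_derivative
    amp T \<nu> t h s * ((1 + \<nu>) / (2 * T - t) - s / (4 * (2 * T - t)\<^sup>2))) (at t)"
proof -
  let ?\<sigma> = "2 * T - t"
  have \<sigma>: "0 < ?\<sigma>" using t by simp
  have d: "((\<lambda>t. 2 * T - t) has_real_derivative - 1) (at t)" by (auto intro!: derivative_eq_intros)
  have 1: "((\<lambda>t. (2 * T - t) powr (- e)) has_real_derivative ?\<sigma> powr (- e) * (e / ?\<sigma>)) (at t)" for e
  proof (rule DERIV_cong[OF DERIV_fun_powr[OF d \<sigma>]])
    have pd: "?\<sigma> powr (- e - 1) = ?\<sigma> powr (- e) / ?\<sigma>"
      unfolding powr_diff using \<sigma> by simp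
    show "- e * ?\<sigma> powr (- e - of_nat 1) * - 1 = ?\<sigma> powr (- e) * (e / ?\<sigma>)"
      unfolding of_nat_1 pd by simp
  qed
  have "((\<lambda>t. inverse (2 * T - t)) has_real_derivative inverse (?\<sigma>\<^sup>2)) (at t)"
    using DERIV_inverse_fun[OF d] \<sigma> by (simp add: power2_eq_square)
  from DERIV_cmult[OF this, of "- s / 4"]
  have "((\<lambda>t. - s / (4 * (2 * T - t))) has_real_derivative - (s / (4 * ?\<sigma>\<^sup>2))) (at t)"
    by (simp add: inverse_eq_divide)
  from DERIV_chain2[OF DERIV_exp this]
  have 2: "((\<lambda>t. exp (- s / (4 * (2 * T - t)))) has_real_derivative exp (- s / (4 * ?\<sigma>)) * - (s / (4 * ?\<sigma>\<^sup>2))) (at t)" .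
  have alg: "c * (p * u) * h * e + e * - v * (c * p * h) = c * p * h * e * (u - v)" for c p u h e v :: real
    by (simp add: algebra_simps)
  show ?thesis
    unfolding amp_def
    by (rule DERIV_cong[OF DERIV_mult[OF DERIV_cmult_right[OF DERIV_cmult[OF 1]] 2]]) (rule alg)
qed

text \<open>When \<theta>' vanishes beyond R, the twist is constant there and this set is a straight
  wedge without its tip.\<close>

definition outer_wedge :: "(real \<Rightarrow> real) \<Rightarrow> real \<Rightarrow> real \<Rightarrow> (real \<times> real) set" where
  "outer_wedge \<theta> a R = {x \<in> curved_wedge \<theta> a. R < norm x}"

definition outer_mode :: "(real \<Rightarrow> real) \<Rightarrow> real \<Rightarrow> real \<Rightarrow> plane_fun" where
  "outer_mode \<theta> a R x =
    (if x \<in> outer_wedge \<theta> a R then norm x powr (1 / (2 * a)) * sin (1 / (2 * a) * wedge_angle \<theta> x) else 0)"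

text \<open>For 0 \<le> t \<le> 3T/2 the amplitude (2T/(2T - t))^(1+\<nu>) is at most 4^(1+\<nu>),
  so \<open>amp\<close> stays below the level on the circle |x| = R, uniformly in T; the summand 1
  makes this strict.\<close>

definition level :: "real \<Rightarrow> real \<Rightarrow> real" where
  "level a R = 4 powr (1 + 1 / (2 * a)) * R powr (1 / (2 * a)) + 1"

text \<open>Subtracting the level before truncating keeps the support away from the curved part \<open>\<bar>x\<bar> \<le> R\<close> and from
  the boundary rays. Convexity of \<open>psi\<close> turns the solution of the backward heat equation into a
  subsolution.\<close>

definition test_fun :: "(real \<Rightarrow> real) \<Rightarrow> real \<Rightarrow> real \<Rightarrow> real \<Rightarrow> real \<Rightarrow> plane_fun" where
  "test_fun \<theta> a R T t x = psi (amp T (1 / (2 * a)) t (outer_mode \<theta> a R x) (sqn x) - level a R)"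

lemma lower_comparison:
  fixes U :: "real \<Rightarrow> l2"
  assumes a: "0 < a" "a \<le> 1" and \<theta>: "\<And>r. r > 0 \<Longrightarrow> (\<theta> has_real_derivative \<theta>' r) (at r)"
    and \<theta>': "continuous_on {0<..} \<theta>'" and R: "0 < R" and flat: "\<And>r. R \<le> r \<Longrightarrow> \<theta>' r = 0" and T: "0 < T"
  defines "\<Omega> \<equiv> curved_wedge \<theta> a"
  assumes U: "continuous_on {0..} U" "\<And>t. 0 \<le> t \<Longrightarrow> U t \<in> nonneg_cone"
      "\<And>t. 0 < t \<Longrightarrow> \<exists>F. grad.form_op \<Omega> (U t) F \<and> (U has_vector_derivative - F) (at t)"
  shows "square_integrable (test_fun \<theta> a R T 0)" "square_integrable (test_fun \<theta> a R T T)"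
    "inner (cls (test_fun \<theta> a R T 0)) (U 0) \<le> inner (cls (test_fun \<theta> a R T T)) (U T)"
proof -
  define \<nu> where "\<nu> = 1 / (2 * a)"
  define S where "S = {x \<in> \<Omega>. R < norm x}"
  define c where "c = 4 powr (1 + \<nu>) * R powr \<nu> + 1"
  define h where "h = (\<lambda>x. if x \<in> S then norm x powr \<nu> * sin (\<nu> * wedge_angle \<theta> x) else 0)"
  define k where "k = (\<lambda>t x. psi (amp T \<nu> t (h x) (sqn x) - c))"
  have test_fun: "test_fun \<theta> a R T = k"
    by (simp add: fun_eq_iff test_fun_def k_def h_def c_def S_def \<nu>_def \<Omega>_def level_def outer_mode_def outer_wedge_def)
  have \<Omega>: "open \<Omega>" unfolding \<Omega>_def by (rule open_curved_wedge[OF a \<theta>])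
  have S: "open S" "S \<subseteq> \<Omega>"
  proof -
    have "S = \<Omega> \<inter> {x. R < norm x}" by (auto simp: S_def)
    moreover have "open {x::real \<times> real. R < norm x}" by (intro open_Collect_less continuous_intros)
    ultimately show "open S" using \<Omega> by auto
  qed (auto simp: S_def)
  have \<nu>: "0 < \<nu>" using a by (simp add: \<nu>_def)
  have SR: "R < norm x" "x \<noteq> 0" if "x \<in> S" for x using that R by (auto simp: S_def)
  have ang: "0 < wedge_angle \<theta> x" "wedge_angle \<theta> x < 2 * pi * a" if "x \<in> \<Omega>" for x
    using that curved_wedge_iff[OF a] unfolding \<Omega>_def by blast+
  have sin0: "0 < sin (\<nu> * wedge_angle \<theta> x)" if "x \<in> S" for x
    unfolding \<nu>_def by (rule sin_wedge_angle_pos[OF a]) (use that S \<Omega>_def in auto)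
  have \<theta>R: "\<theta> r = \<theta> R" if "R \<le> r" for r
  proof (cases "r = R")
    case False
    then have "R < r" using that by simp
    then show ?thesis
    proof (rule DERIV_isconst2)
      show "continuous_on {R..r} \<theta>"
        by (rule DERIV_continuous_on, rule DERIV_subset[OF \<theta>]) (use R in auto)
      show "(\<theta> has_real_derivative 0) (at x)" if "R < x" "x < r" for x
        using \<theta>[of x] flat[of x] that R by simp
    qed (use that in auto)
  qed simp
  have \<alpha>: "C1_on S (wedge_angle \<theta>) (\<lambda>x. - snd x / sqn x) (\<lambda>x. fst x / sqn x)"
    by (rule C1_on_cong[OF C1_on_subset[OF C1_on_wedge_angle[OF a \<theta> \<theta>']]])
      (use SR flat S in \<open>auto simp: wedge_angle1_def wedge_angle2_def \<Omega>_def less_imp_le\<close>)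
  have h_bounds: "0 \<le> h x" "h x \<le> norm x powr \<nu>" for x
    using sin0[of x] by (auto simp: h_def mult_left_le)
  \<comment> \<open>Past T, so that T is interior, yet with 2T - t \<ge> T/2; this is the origin of
    the base 4 in \<open>level\<close>.\<close>
  define q where "q = 3 * T / 2"
  define B where "B t = (2 * T) powr (1 + \<nu>) * (2 * T - t) powr (- (1 + \<nu>))" for t
  have B: "0 < B t" "B t \<le> 4 powr (1 + \<nu>)" if t: "t \<in> {0..q}" for t
  proof -
    have \<sigma>: "0 < 2 * T - t" "2 * T \<le> 4 * (2 * T - t)" using t T by (auto simp: q_def)
    then show "0 < B t" using T by (simp add: B_def)
    have "(2 * T / (2 * T - t)) powr (1 + \<nu>) = (2 * T) powr (1 + \<nu>) / (2 * T - t) powr (1 + \<nu>)"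
      by (rule powr_divide)
    then have "B t = (2 * T / (2 * T - t)) powr (1 + \<nu>)"
      by (simp only: B_def powr_minus divide_inverse)
    also have "\<dots> \<le> 4 powr (1 + \<nu>)" using \<sigma> T \<nu> by (intro powr_mono2) (auto simp: divide_le_eq)
    finally show "B t \<le> 4 powr (1 + \<nu>)" .
  qed
  have c: "0 < c" by (simp add: c_def add_nonneg_pos)
  have bound: "B t * r powr \<nu> * exp (- s / (4 * (2 * T - t))) * w \<le> 4 powr (1 + \<nu>) * r powr \<nu> * exp (- s / (8 * T))"
    if t: "t \<in> {0..q}" and s: "0 \<le> s" and w: "w \<le> 1" for t r s w
  proof -
    have \<sigma>: "0 < 2 * T - t" using t T by (auto simp: q_def)
    have "s / (8 * T) \<le> s / (4 * (2 * T - t))" using s \<sigma> t T by (intro divide_left_mono) auto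
    then have "exp (- s / (4 * (2 * T - t))) \<le> exp (- s / (8 * T))" by simp
    then have 1: "B t * r powr \<nu> * exp (- s / (4 * (2 * T - t))) \<le> 4 powr (1 + \<nu>) * r powr \<nu> * exp (- s / (8 * T))"
      using B[OF t] by (intro mult_mono) auto
    have "B t * r powr \<nu> * exp (- s / (4 * (2 * T - t))) * w \<le> B t * r powr \<nu> * exp (- s / (4 * (2 * T - t))) * 1"
      using w B(1)[OF t] by (intro mult_left_mono) auto
    with 1 show ?thesis by simp
  qed
  \<comment> \<open>A radius beyond which H stays below c for all t in [0, q]: half of the exponent
    beats the power, the rest decays. It may depend on T, since its only purpose is compact
    support.\<close>
  obtain \<rho> where \<rho>: "R < \<rho>" "\<And>r. \<rho> \<le> r \<Longrightarrow> 4 powr (1 + \<nu>) * r powr \<nu> * exp (- r\<^sup>2 / (8 * T)) \<le> c"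
  proof -
    define M where "M = 4 powr (1 + \<nu>) * (\<nu> / 2 / (1 / (16 * T))) powr (\<nu> / 2)"
    define \<rho> where "\<rho> = R + 1 + M * (16 * T)"
    have M: "0 < M" using T \<nu> by (simp add: M_def)
    have MT: "0 < M * (16 * T)" using M T by simp
    show thesis
    proof (rule that)
      show "R < \<rho>" using MT by (simp add: \<rho>_def)
      fix r assume r: "\<rho> \<le> r"
      have r1: "1 \<le> r" "M * (16 * T) \<le> r" using r MT R by (auto simp: \<rho>_def)
      have "r powr \<nu> = (r\<^sup>2) powr (\<nu> / 2)"
        using r1 by (simp add: powr_powr flip: powr_numeral)
      also have "\<dots> \<le> (\<nu> / 2 / (1 / (16 * T))) powr (\<nu> / 2) * exp (1 / (16 * T) * r\<^sup>2)"
        by (rule powr_le_exp) (use T \<nu> in auto)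
      finally have "4 powr (1 + \<nu>) * r powr \<nu> * exp (- r\<^sup>2 / (8 * T))
          \<le> 4 powr (1 + \<nu>) * ((\<nu> / 2 / (1 / (16 * T))) powr (\<nu> / 2) * exp (1 / (16 * T) * r\<^sup>2)) * exp (- r\<^sup>2 / (8 * T))"
        by (intro mult_right_mono mult_left_mono) auto
      also have "\<dots> = M * (exp (1 / (16 * T) * r\<^sup>2) * exp (- r\<^sup>2 / (8 * T)))" by (simp only: M_def mult.assoc)
      also have "exp (1 / (16 * T) * r\<^sup>2) * exp (- r\<^sup>2 / (8 * T)) = exp (- (r\<^sup>2 / (16 * T)))"
        by (simp add: field_simps flip: exp_add)
      also have "M * exp (- (r\<^sup>2 / (16 * T))) \<le> M * (1 / (r\<^sup>2 / (16 * T)))"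
      proof (rule mult_left_mono)
        have y: "0 < r\<^sup>2 / (16 * T)" using r1 T by simp
        have "r\<^sup>2 / (16 * T) \<le> exp (r\<^sup>2 / (16 * T))"
          using exp_ge_add_one_self[of "r\<^sup>2 / (16 * T)"] by linarith
        then have "1 / exp (r\<^sup>2 / (16 * T)) \<le> 1 / (r\<^sup>2 / (16 * T))" by (intro divide_left_mono mult_pos_pos y exp_gt_zero) auto
        then show "exp (- (r\<^sup>2 / (16 * T))) \<le> 1 / (r\<^sup>2 / (16 * T))" by (simp add: exp_minus inverse_eq_divide)
      qed (use M in simp)
      also have "\<dots> = M * (16 * T) / r\<^sup>2" by simp
      also have "\<dots> \<le> 1"
      proof -
        have "M * (16 * T) \<le> r * 1" using r1 by simp
        also have "\<dots> \<le> r * r" using r1 by (intro mult_left_mono) auto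
        finally show ?thesis using r1 by (simp add: power2_eq_square divide_le_eq)
      qed
      also have "1 \<le> c" by (simp add: c_def)
      finally show "4 powr (1 + \<nu>) * r powr \<nu> * exp (- r\<^sup>2 / (8 * T)) \<le> c" .
    qed
  qed
  define H where "H t x = B t * norm x powr \<nu> * exp (- sqn x / (4 * (2 * T - t))) * sin (\<nu> * wedge_angle \<theta> x)" for t x
  have amp_S: "amp T \<nu> t (h x) (sqn x) = H t x" if "x \<in> S" for t x
    using that by (simp add: amp_def H_def h_def B_def)
  have k_eq: "k t x = (if x \<in> S then psi (H t x - c) else 0)" for t x
    using amp_S[of x t] c psi_nonpos[of "- c"] by (auto simp: k_def amp_def h_def)
  have H_far: "H t x \<le> c" if "t \<in> {0..q}" "\<rho> \<le> norm x" for t x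
    using bound[OF that(1), of "sqn x" "sin (\<nu> * wedge_angle \<theta> x)" "norm x"] \<rho>(2)[OF that(2)]
    by (simp add: H_def sqn_norm)
  define polar where "polar p = (fst p * cos (snd p + \<theta> R), fst p * sin (snd p + \<theta> R))" for p
  \<comment> \<open>Superlevel set of H in polar coordinates over a closed rectangle. It avoids r =
    R by the choice of the level and both end angles because the sine vanishes there, so its image
    is a compact subset of the open set S, outside which the truncated function is zero.\<close>
  define P where "P t = {p \<in> {R..\<rho>} \<times> {0..2 * pi * a}. c \<le> B t * fst p powr \<nu> * exp (- (fst p)\<^sup>2 / (4 * (2 * T - t))) * sin (\<nu> * snd p)}" for t
  have K: "compact (polar ` P t)" "polar ` P t \<subseteq> S" "\<And>x. x \<in> S \<Longrightarrow> x \<notin> polar ` P t \<Longrightarrow> H t x \<le> c"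
    if t: "t \<in> {0..q}" for t
  proof -
    have \<sigma>: "0 < 2 * T - t" using t T by (auto simp: q_def)
    let ?Q = "{R..\<rho>} \<times> {0..2 * pi * a}"
    have "closed (P t)"
      unfolding P_def
      by (intro continuous_on_closed_Collect_le continuous_intros closed_Times closed_atLeastAtMost)
        (use R \<sigma> in auto)
    moreover have "P t = ?Q \<inter> P t" by (auto simp: P_def)
    ultimately have "compact (P t)"
      using compact_Int_closed[of ?Q "P t"] compact_Times[OF compact_Icc compact_Icc] by metis
    then show "compact (polar ` P t)"
      by (rule compact_continuous_image[rotated]) (auto simp: polar_def[abs_def] intro!: continuous_intros)
    show "polar ` P t \<subseteq> S"
    proof
      fix x assume "x \<in> polar ` P t"
      then obtain r \<phi> where x: "x = (r * cos (\<phi> + \<theta> R), r * sin (\<phi> + \<theta> R))"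
        and r: "R \<le> r" and \<phi>: "0 \<le> \<phi>" "\<phi> \<le> 2 * pi * a"
        and cl: "c \<le> B t * r powr \<nu> * exp (- r\<^sup>2 / (4 * (2 * T - t))) * sin (\<nu> * \<phi>)"
        by (auto simp: P_def polar_def)
      have "r \<noteq> R"
      proof
        assume "r = R"
        have "exp (- R\<^sup>2 / (8 * T)) \<le> 1" using T by simp
        then have "4 powr (1 + \<nu>) * R powr \<nu> * exp (- R\<^sup>2 / (8 * T)) \<le> 4 powr (1 + \<nu>) * R powr \<nu> * 1"
          by (intro mult_left_mono) auto
        moreover have "B t * R powr \<nu> * exp (- R\<^sup>2 / (4 * (2 * T - t))) * sin (\<nu> * \<phi>)
            \<le> 4 powr (1 + \<nu>) * R powr \<nu> * exp (- R\<^sup>2 / (8 * T))"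
          by (rule bound[OF t]) auto
        ultimately show False using cl unfolding c_def \<open>r = R\<close> by linarith
      qed
      then have rR: "R < r" using r by simp
      have sn: "sin (\<nu> * \<phi>) \<noteq> 0" using cl c by auto
      have pi': "\<nu> * (2 * pi * a) = pi" using a by (simp add: \<nu>_def)
      have "\<phi> \<noteq> 0" using sn by auto
      moreover have "\<phi> \<noteq> 2 * pi * a"
      proof
        assume "\<phi> = 2 * pi * a"
        then have "sin (\<nu> * \<phi>) = 0" by (simp only: pi' sin_pi)
        with sn show False by simp
      qed
      ultimately have \<phi>': "0 < \<phi>" "\<phi> < 2 * pi * a" using \<phi> by auto
      have "2 * pi * a \<le> 2 * pi * 1" using a by (intro mult_left_mono) auto
      then have "\<phi> < 2 * pi" using \<phi>' by linarith
      moreover have x': "x = (r * cos (\<phi> + \<theta> r), r * sin (\<phi> + \<theta> r))" using x \<theta>R[OF r] by simp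
      ultimately have "norm x = r" using wedge_angle_polar(1)[of x r \<phi> \<theta>] \<phi>' rR R by simp
      moreover have "x \<in> \<Omega>"
        unfolding \<Omega>_def curved_wedge_def using x' \<phi>' rR R by (intro CollectI exI[of _ r] exI[of _ \<phi>]) auto
      ultimately show "x \<in> S" using rR by (simp add: S_def)
    qed
    show "H t x \<le> c" if x: "x \<in> S" "x \<notin> polar ` P t" for x
    proof (rule ccontr)
      assume H: "\<not> H t x \<le> c"
      then have "norm x < \<rho>" using H_far[OF t, of x] by linarith
      moreover have "x = polar (norm x, wedge_angle \<theta> x)"
        using wedge_angle_coordinates[of x \<theta>] \<theta>R[of "norm x"] SR[OF x(1)] by (simp add: polar_def)
      moreover have "x \<in> \<Omega>" using x(1) S by blast
      ultimately have "x \<in> polar ` P t"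
        using H SR[OF x(1)] ang[of x]
        by (intro image_eqI[of _ _ "(norm x, wedge_angle \<theta> x)"]) (auto simp: P_def H_def sqn_norm)
      then show False using x(2) by blast
    qed
  qed
  have pn: "norm x powr \<nu> = sqn x powr (\<nu> / 2)" for x :: "real \<times> real"
  proof (cases "x = 0")
    case False
    then show ?thesis by (simp add: sqn_norm powr_powr flip: powr_numeral)
  qed (simp add: sqn_norm)
  have lap: "\<exists>p q' p1 p2 q1 q2. Cc1 S (k t) p q' \<and> Cc1 S p p1 p2 \<and> Cc1 S q' q1 q2 \<and>
      (\<forall>x. x \<notin> S \<longrightarrow> p1 x + q2 x = 0) \<and>
      (\<forall>x\<in>S. psi1 (H t x - c) * ((sqn x / (4 * (2 * T - t)\<^sup>2) - (1 + \<nu>) / (2 * T - t)) * H t x) \<le> p1 x + q2 x)"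
    if t: "t \<in> {0..q}" for t
  proof -
    have \<sigma>: "0 < 2 * T - t" using t T by (auto simp: q_def)
    obtain H1 H2 H11 H12 H21 H22 where HH: "C1_on S (H t) H1 H2" "C1_on S H1 H11 H12" "C1_on S H2 H21 H22"
      and L: "\<And>x. x \<in> S \<Longrightarrow> H11 x + H22 x = (sqn x / (4 * (2 * T - t)\<^sup>2) - (1 + \<nu>) / (2 * T - t)) * H t x"
      using heat_profile_laplacian[OF SR(2) \<alpha> \<sigma>, where A = "B t" and \<nu> = \<nu>, folded pn] unfolding H_def by blast
    from truncated_laplacian[OF S(1) K(1,2)[OF t] K(3)[OF t] HH]
    show ?thesis unfolding k_eq[abs_def] using L by (simp cong: ball_cong)
  qed
  have sq: "square_integrable (k t)" if t: "t \<in> {0..q}" for t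
    using lap[OF t] Cc1_square_integrable(1) by blast
  have qT: "0 < T" "T < q" using T by (auto simp: q_def)
  show "square_integrable (test_fun \<theta> a R T 0)" "square_integrable (test_fun \<theta> a R T T)"
    unfolding test_fun using sq qT by auto
  define Y where "Y = {0..\<rho> powr \<nu>} \<times> {0..\<rho>\<^sup>2}"
  \<comment> \<open>Outside the ball of radius \<rho> the parameters are reset to (0, 0), where
    \<open>b\<close> vanishes just as \<open>k t\<close> does; thus y stays in the compact set
    Y.\<close>
  define y where "y x = (if norm x \<le> \<rho> then (h x, sqn x) else (0, 0))" for x
  define b where "b t z = psi (amp T \<nu> t (fst z) (snd z) - c)" for t z
  define n where "n t z = psi1 (amp T \<nu> t (fst z) (snd z) - c) *
      (amp T \<nu> t (fst z) (snd z) * ((1 + \<nu>) / (2 * T - t) - snd z / (4 * (2 * T - t)\<^sup>2)))" for t z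
  have b_y: "b t (y x) = k t x" if t: "t \<in> {0..q}" for t x
  proof (cases "norm x \<le> \<rho>")
    case False
    then have "k t x = 0" using H_far[OF t, of x] psi_nonpos[of "H t x - c"] by (simp add: k_eq)
    moreover have "b t (y x) = 0" using False c psi_nonpos[of "- c"] by (simp add: b_def y_def amp_def)
    ultimately show ?thesis by simp
  qed (simp add: b_def y_def k_def)
  have Y: "compact Y" unfolding Y_def by (intro compact_Times compact_Icc)
  have yY: "y x \<in> Y" for x
  proof (cases "norm x \<le> \<rho>")
    case True
    have "norm x powr \<nu> \<le> \<rho> powr \<nu>" using True \<nu> by (intro powr_mono2) auto
    moreover have "(norm x)\<^sup>2 \<le> \<rho>\<^sup>2" using True by (intro power_mono) auto
    ultimately show ?thesis using True h_bounds[of x] by (simp add: y_def Y_def sqn_norm)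
  qed (use \<rho> R in \<open>simp add: y_def Y_def\<close>)
  have hm: "h \<in> borel_measurable borel"
  proof -
    have "continuous_on S (\<lambda>x. norm x powr \<nu> * sin (\<nu> * wedge_angle \<theta> x))"
      by (intro continuous_intros C1_on_continuous[OF \<alpha>]) (use SR in auto)
    then have "(\<lambda>x. indicator S x *\<^sub>R (norm x powr \<nu> * sin (\<nu> * wedge_angle \<theta> x))) \<in> borel_measurable borel"
      using S(1) by (intro borel_measurable_continuous_on_indicator) auto
    also have "(\<lambda>x. indicator S x *\<^sub>R (norm x powr \<nu> * sin (\<nu> * wedge_angle \<theta> x))) = h"
      by (auto simp: h_def indicator_def)
    finally show ?thesis .
  qed
  have ym: "y \<in> borel_measurable lborel"
  proof -
    have "(\<lambda>x. (h x, sqn x)) \<in> borel_measurable borel"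
      by (intro borel_measurable_Pair hm borel_measurable_continuous_onI continuous_on_sqn)
    then have "(\<lambda>x. if x \<in> cball 0 \<rho> then (h x, sqn x) else (0, 0)) \<in> borel_measurable borel"
      by (intro measurable_If_set) auto
    then show ?thesis by (simp add: y_def[abs_def])
  qed
  have camp: "continuous_on W (\<lambda>w. amp T \<nu> (f w) (g w) (l w))"
    if "continuous_on W f" "continuous_on W g" "continuous_on W l" "\<And>w. w \<in> W \<Longrightarrow> f w < 2 * T"
    for W :: "'w::topological_space set" and f g l
    unfolding amp_def using that T by (intro continuous_intros) fastforce+
  have camp_pair: "continuous_on ({0..q} \<times> Y) (\<lambda>w. amp T \<nu> (fst w) (fst (snd w)) (snd (snd w)))"
    by (rule camp) (use qT T in \<open>auto intro!: continuous_intros simp: q_def\<close>)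
  have camp_snd: "continuous_on UNIV (\<lambda>z. amp T \<nu> t (fst z) (snd z))" if "t \<in> {0..q}" for t
    by (rule camp) (use that T in \<open>auto intro!: continuous_intros simp: q_def\<close>)
  have t2: "t < 2 * T" if "t \<in> {0..q}" for t using that T by (auto simp: q_def)
  have cb: "continuous_on ({0..q} \<times> Y) (\<lambda>(s, z). b s z)"
    unfolding b_def case_prod_unfold
    by (intro continuous_on_compose2[OF continuous_psi(1)] continuous_intros camp_pair) auto
  have cb': "\<forall>t\<in>{0..q}. continuous_on UNIV (b t)"
    unfolding b_def by (intro ballI continuous_on_compose2[OF continuous_psi(1)] continuous_intros camp_snd) auto
  have cn: "continuous_on ({0..q} \<times> Y) (\<lambda>(s, z). n s z)"
    unfolding n_def case_prod_unfold
    by (intro continuous_on_compose2[OF continuous_psi(2)] continuous_intros camp_pair) (use t2 in force)+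
  have cn': "\<forall>t\<in>{0..q}. continuous_on UNIV (n t)"
    unfolding n_def
    by (intro ballI continuous_on_compose2[OF continuous_psi(2)] continuous_intros camp_snd) (use t2 in force)+
  have der: "\<forall>s\<in>{0..q}. \<forall>z\<in>Y. ((\<lambda>s. b s z) has_real_derivative n s z) (at s)"
  proof (intro ballI)
    fix s z assume "s \<in> {0..q}"
    then have "((\<lambda>s. amp T \<nu> s (fst z) (snd z) - c) has_real_derivative
        amp T \<nu> s (fst z) (snd z) * ((1 + \<nu>) / (2 * T - s) - snd z / (4 * (2 * T - s)\<^sup>2))) (at s)"
      using DERIV_diff[OF DERIV_amp DERIV_const] t2 by fastforce
    from DERIV_chain2[OF DERIV_psi this] show "((\<lambda>s. b s z) has_real_derivative n s z) (at s)"
      unfolding b_def n_def .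
  qed
  note curve = mul_curve[OF Y ym yY cb cb' cn cn' der]
  obtain M where mB: "\<And>t. t \<in> {0..q} \<Longrightarrow> bounded_by M (\<lambda>x. b t (y x))"
    and mB': "\<And>t. t \<in> {0..q} \<Longrightarrow> bounded_by M (\<lambda>x. n t (y x))"
    using curve(1) by blast
  \<comment> \<open>The class of \<open>k t\<close> is written as a time-dependent multiplier acting
    on a fixed vector, so that \<open>mul_curve\<close> differentiates the pairing.\<close>
  let ?one = "indicator (cball 0 \<rho>) :: real \<times> real \<Rightarrow> real"
  have one: "square_integrable ?one"
    unfolding square_integrable_def
  proof
    have "(\<lambda>x. (?one x)\<^sup>2) = ?one" by (auto simp: indicator_def)
    moreover have "integrable lborel ?one"
      by (intro integrable_real_indicator emeasure_lborel_cball_finite) auto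
    ultimately show "integrable lborel (\<lambda>x. (?one x)\<^sup>2)" by simp
  qed (simp add: borel_measurable_indicator)
  define G where "G t = inner (cls ?one) (mul (\<lambda>x. b t (y x)) (U t))" for t
  have mul_one: "mul (\<lambda>x. b t (y x)) (cls ?one) = cls (k t)" if t: "t \<in> {0..q}" for t
  proof -
    have "k t x = 0" if "x \<notin> cball 0 \<rho>" for x
      using that H_far[OF t, of x] psi_nonpos[of "H t x - c"] by (simp add: k_eq)
    then have "(\<lambda>x. b t (y x) * ?one x) = k t"
      using b_y[OF t] by (intro ext) (auto simp: indicator_def)
    then show ?thesis by (simp add: mul_cls[OF mB[OF t] one])
  qed
  have G_eq: "G t = inner (cls (k t)) (U t)" if "t \<in> {0..q}" for t
    by (simp add: G_def inner_mul_commute[OF mB[OF that], symmetric] mul_one[OF that])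
  have dG: "\<exists>d. DERIV G t :> d \<and> 0 \<le> d" if t: "0 < t" "t < T" for t
  proof -
    have tq: "t \<in> {0..q}" "t < q" using t qT by auto
    obtain F where F: "grad.form_op \<Omega> (U t) F" "(U has_vector_derivative - F) (at t)" using U(3)[OF t(1)] by blast
    let ?m = "\<lambda>x. b t (y x)" and ?m' = "\<lambda>x. n t (y x)"
    have "((\<lambda>s. mul (\<lambda>x. b s (y x)) (U s)) has_vector_derivative mul ?m (- F) + mul ?m' (U t)) (at t)"
      by (rule curve(2)[OF t(1) tq(2) F(2)])
    from bounded_linear.has_vector_derivative[OF bounded_linear_inner_right this]
    have "(G has_real_derivative inner (cls ?one) (mul ?m (- F) + mul ?m' (U t))) (at t)"
      unfolding G_def[abs_def] has_real_derivative_iff_has_vector_derivative .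
    moreover have "0 \<le> inner (cls ?one) (mul ?m (- F) + mul ?m' (U t))"
    proof -
      obtain p q' p1 p2 q1 q2 where Cc: "Cc1 S (k t) p q'" "Cc1 S p p1 p2" "Cc1 S q' q1 q2"
        and out: "\<And>x. x \<notin> S \<Longrightarrow> p1 x + q2 x = 0"
        and ins: "\<And>x. x \<in> S \<Longrightarrow> psi1 (H t x - c) * ((sqn x / (4 * (2 * T - t)\<^sup>2) - (1 + \<nu>) / (2 * T - t)) * H t x) \<le> p1 x + q2 x"
        using lap[OF tq(1)] by blast
      note C\<Omega> = Cc[THEN Cc1_mono[OF _ S(2)]]
      have lf: "grad.form_op \<Omega> (cls (k t)) (- (cls p1 + cls q2))" by (rule laplacian_form_op[OF \<Omega> C\<Omega>])
      have s: "square_integrable p1" "square_integrable q2"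
        using Cc1_square_integrable[OF Cc(2)] Cc1_square_integrable[OF Cc(3)] by auto
      have "inner (cls ?one) (mul ?m (- F)) = - inner F (cls (k t))"
        unfolding inner_mul_commute[OF mB[OF tq(1)], symmetric] mul_one[OF tq(1)] by (simp add: inner_commute)
      \<comment> \<open>Symmetry of the form moves the operator from U t onto the test
        function.\<close>
      also have "\<dots> = inner (cls p1 + cls q2) (U t)"
        using grad.form_op_symmetric[OF F(1) lf] by (simp add: inner_diff_left inner_add_left)
      finally have 1: "inner (cls ?one) (mul ?m (- F)) = inner (cls p1 + cls q2) (U t)" .
      have sm: "square_integrable (\<lambda>x. ?m' x * ?one x)" by (rule square_integrable_bounded_mult[OF mB'[OF tq(1)] one])
      have 2: "inner (cls ?one) (mul ?m' (U t)) = inner (cls (\<lambda>x. ?m' x * ?one x)) (U t)"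
        unfolding inner_mul_commute[OF mB'[OF tq(1)], symmetric] mul_cls[OF mB'[OF tq(1)] one] ..
      \<comment> \<open>Laplacian plus time derivative of \<open>k t\<close>: where both are active,
        the \<open>psi1\<close> terms cancel by the backward heat equation and only the convexity
        term is left.\<close>
      let ?w = "\<lambda>x. p1 x + q2 x + ?m' x * ?one x"
      have sw: "square_integrable ?w" by (intro square_integrable_add s sm)
      have w: "0 \<le> ?w x" for x
      proof (cases "x \<in> S \<and> norm x \<le> \<rho>")
        case True
        then have "?m' x * ?one x = psi1 (H t x - c) * (H t x * ((1 + \<nu>) / (2 * T - t) - sqn x / (4 * (2 * T - t)\<^sup>2)))"
          by (simp add: n_def y_def amp_S)
        moreover have "psi1 (H t x - c) * ((sqn x / (4 * (2 * T - t)\<^sup>2) - (1 + \<nu>) / (2 * T - t)) * H t x)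
          = - (psi1 (H t x - c) * (H t x * ((1 + \<nu>) / (2 * T - t) - sqn x / (4 * (2 * T - t)\<^sup>2))))"
          by (simp add: algebra_simps)
        ultimately show ?thesis using ins[of x] True by linarith
      next
        case False
        have "?m' x * ?one x = 0"
          using False c psi_nonpos[of "- c"] by (auto simp: n_def y_def amp_def h_def indicator_def)
        moreover have "0 \<le> p1 x + q2 x"
        proof (cases "x \<in> S")
          case True
          then have "psi1 (H t x - c) = 0" using False H_far[OF tq(1), of x] psi_nonpos[of "H t x - c"] by simp
          then show ?thesis using ins[OF True] by simp
        qed (use out in simp)
        ultimately show ?thesis by linarith
      qed
      have "inner (cls ?one) (mul ?m (- F) + mul ?m' (U t)) = inner (cls ?w) (U t)"
        by (simp add: inner_add_right 1 2 inner_add_left square_integrable_add s sm flip: cls_add)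
      also have "\<dots> = inner (U t) (cls ?w)" by (rule inner_commute)
      also have "0 \<le> \<dots>" using U(2)[of t] t sw w unfolding nonneg_cone_iff by simp
      finally show ?thesis .
    qed
    ultimately show ?thesis by blast
  qed
  have "G 0 \<le> G T"
  proof (rule DERIV_nonneg_imp_increasing_open[of 0 T G])
    show "0 \<le> T" using T by simp
    show "\<exists>d. DERIV G t :> d \<and> 0 \<le> d" if "0 < t" "t < T" for t by (rule dG[OF that])
    have "continuous_on {0..q} U" by (rule continuous_on_subset[OF U(1)]) auto
    then have "continuous_on {0..q} G" unfolding G_def[abs_def] by (intro continuous_intros curve(3))
    then show "continuous_on {0..T} G" by (rule continuous_on_subset) (use qT in auto)
  qed
  then show "inner (cls (test_fun \<theta> a R T 0)) (U 0) \<le> inner (cls (test_fun \<theta> a R T T)) (U T)"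
    unfolding test_fun using G_eq[of 0] G_eq[of T] qT by simp
qed

lemma integral_pos_of_continuous:
  fixes u :: plane_fun
  assumes u: "continuous_on UNIV u" "integrable lborel u" "\<And>x. 0 \<le> u x" "0 < u c"
  shows "0 < (LINT x|lborel. u x)"
proof -
  have "(LINT x|lborel. u x) \<noteq> 0"
  proof
    assume "(LINT x|lborel. u x) = 0"
    then have "AE x in lborel. u x = 0"
      using integral_nonneg_eq_0_iff_AE[OF u(2)] u(3) by simp
    moreover have o: "open {x. u x \<noteq> 0}"
      by (intro open_Collect_neq u(1) continuous_on_const)
    ultimately have "{x. u x \<noteq> 0} \<in> null_sets lborel"
      using AE_iff_null[of lborel "\<lambda>x. u x = 0"] by simp
    then have "negligible {x. u x \<noteq> 0}"
      unfolding negligible_iff_null_sets by (rule null_sets_completionI)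
    moreover have "c \<in> {x. u x \<noteq> 0}" using u(4) by simp
    ultimately show False using open_not_negligible[OF o] by blast
  qed
  moreover have "0 \<le> (LINT x|lborel. u x)" by (rule integral_nonneg_AE) (simp add: u)
  ultimately show ?thesis by simp
qed

theorem not_decay_bound_above_threshold:
  assumes a: "0 < a" "a \<le> 1" and \<theta>: "\<And>r. r > 0 \<Longrightarrow> (\<theta> has_real_derivative \<theta>' r) (at r)"
    and \<theta>': "continuous_on {0<..} \<theta>'" and R: "0 < R" and flat: "\<And>r. R \<le> r \<Longrightarrow> \<theta>' r = 0"
    and \<gamma>: "1 / 2 + 1 / (4 * a) < \<gamma>"
  shows "\<not> decay_bound \<theta> a \<gamma>"
proof
  assume "decay_bound \<theta> a \<gamma>"
  let ?\<Omega> = "curved_wedge \<theta> a" and ?S = "outer_wedge \<theta> a R" and ?h = "outer_mode \<theta> a R" and ?c = "level a R"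
  define \<nu> where "\<nu> = 1 / (2 * a)"
  have \<nu>: "0 < \<nu>" using a by (simp add: \<nu>_def)
  obtain C where C: "C > 0" and decay: "\<And>u0 u t. u0 \<in> L2w ?\<Omega> \<Longrightarrow> heat_sol ?\<Omega> u0 u \<Longrightarrow> 0 \<le> t \<Longrightarrow>
      L2_norm ?\<Omega> (u t) \<le> C * (1 + t) powr (- \<gamma>) * L2w_norm ?\<Omega> u0"
    using \<open>decay_bound \<theta> a \<gamma>\<close> unfolding decay_bound_def by blast
  have \<Omega>: "open ?\<Omega>" by (rule open_curved_wedge[OF a \<theta>])
  have S: "open ?S" "?S \<subseteq> ?\<Omega>"
  proof -
    have "?S = ?\<Omega> \<inter> {x. R < norm x}" by (auto simp: outer_wedge_def)
    moreover have "open {x::real \<times> real. R < norm x}" by (intro open_Collect_less continuous_intros)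
    ultimately show "open ?S" using \<Omega> by auto
  qed (auto simp: outer_wedge_def)
  have c: "0 < ?c" "R powr \<nu> < ?c"
  proof -
    have "1 * R powr \<nu> \<le> 4 powr (1 + \<nu>) * R powr \<nu>"
      using \<nu> by (intro mult_right_mono ge_one_powr_ge_zero) auto
    then show "R powr \<nu> < ?c" by (simp add: level_def \<nu>_def)
    then show "0 < ?c" using powr_ge_zero[of R \<nu>] by linarith
  qed
  \<comment> \<open>On the bisector, at angle pi a, the mode is r^\<nu>; this radius makes it exceed
    the level by 3 and lies beyond R.\<close>
  define r0 where "r0 = (?c + 3) powr (1 / \<nu>)"
  have r0\<nu>: "r0 powr \<nu> = ?c + 3" using c \<nu> by (simp add: r0_def powr_powr)
  have r0: "0 < r0" using c by (simp add: r0_def)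
  have Rr0: "R < r0"
  proof (rule ccontr)
    assume "\<not> R < r0"
    then have "r0 powr \<nu> \<le> R powr \<nu>" using r0 \<nu> by (intro powr_mono2) auto
    then show False using c r0\<nu> by simp
  qed
  define x0 where "x0 = (r0 * cos (pi * a + \<theta> r0), r0 * sin (pi * a + \<theta> r0))"
  have "pi * a < 2 * pi" using a mult_left_le[of a pi] pi_gt_zero by (simp add: mult.commute)
  then have x0: "norm x0 = r0" "wedge_angle \<theta> x0 = pi * a"
    using wedge_angle_polar[of x0 r0 "pi * a" \<theta>] x0_def r0 a by auto
  have "x0 \<in> ?\<Omega>" using x0 r0 a by (auto simp: curved_wedge_iff[OF a])
  then have x0S: "x0 \<in> ?S" using x0 Rr0 by (simp add: outer_wedge_def)
  have hx0: "?h x0 = ?c + 3"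
  proof -
    have "1 / (2 * a) * (pi * a) = pi / 2" using a by simp
    then have "sin (1 / (2 * a) * (pi * a)) = 1" by (simp only: sin_pi_half)
    then show ?thesis using x0S x0 r0\<nu> by (simp add: outer_mode_def \<nu>_def)
  qed
  have h_bounds: "0 \<le> ?h x" "?h x \<le> norm x powr \<nu>" for x
  proof -
    have "0 < sin (1 / (2 * a) * wedge_angle \<theta> x)" if "x \<in> ?S" using sin_wedge_angle_pos[OF a] that S by blast
    then show "0 \<le> ?h x" "?h x \<le> norm x powr \<nu>" by (auto simp: outer_mode_def \<nu>_def mult_left_le)
  qed
  define r1 where "r1 = r0 + 1"
  \<comment> \<open>Region around x0 where the mode still exceeds the level by more than 2: one unit
    is spent on the Gaussian factor, the other makes \<open>psi_ge\<close> applicable.\<close>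
  define S0 where "S0 = {x \<in> ?S. ?c + 2 < ?h x} \<inter> ball 0 r1"
  have S0: "open S0" "S0 \<subseteq> ?\<Omega>" "x0 \<in> S0"
  proof -
    have "continuous_on ?S (\<lambda>x. norm x powr (1 / (2 * a)) * sin (1 / (2 * a) * wedge_angle \<theta> x))"
      by (intro continuous_intros C1_on_continuous[OF C1_on_subset[OF C1_on_wedge_angle[OF a \<theta> \<theta>'] S(2)]])
        (use R in \<open>auto simp: outer_wedge_def\<close>)
    then have "continuous_on ?S ?h" by (rule continuous_on_cong[THEN iffD1, rotated 2]) (auto simp: outer_mode_def)
    then have "open (?S \<inter> ?h -` {?c + 2<..})" by (rule continuous_open_preimage[OF _ S(1) open_greaterThan])
    moreover have "S0 = (?S \<inter> ?h -` {?c + 2<..}) \<inter> ball 0 r1" by (auto simp: S0_def)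
    ultimately show "open S0" by auto
    show "S0 \<subseteq> ?\<Omega>" using S by (auto simp: S0_def)
    show "x0 \<in> S0" using x0S hx0 x0 by (simp add: S0_def r1_def)
  qed
  obtain u0 K U where u0: "continuous_on UNIV u0" "compact K" "K \<subseteq> S0" "\<And>x. x \<notin> K \<Longrightarrow> u0 x = 0"
    "\<And>x. 0 \<le> u0 x" "0 < u0 x0" and s0: "square_integrable u0" and U0: "U 0 = cls u0"
    and U: "(U \<longlongrightarrow> U 0) (at 0 within {0..})" "\<And>t. 0 \<le> t \<Longrightarrow> U t \<in> nonneg_cone"
    "\<And>t. 0 < t \<Longrightarrow> \<exists>F. grad.form_op ?\<Omega> (U t) F \<and> (U has_vector_derivative - F) (at t)"
    by (rule exists_nonneg_solution[OF \<Omega> S0]) (rule that, assumption+)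
  have Uc: "continuous_on {0..} U"
    unfolding continuous_on_def
  proof
    fix t :: real assume t: "t \<in> {0..}"
    show "(U \<longlongrightarrow> U t) (at t within {0..})"
    proof (cases "t = 0")
      case False
      then have "isCont U t" using U(3)[of t] t has_vector_derivative_continuous by fastforce
      then show ?thesis by (simp add: isCont_def tendsto_within_subset[OF _ subset_UNIV])
    qed (use U in simp)
  qed
  have sol: "heat_sol ?\<Omega> u0 (\<lambda>t. rep (U t))" by (rule heat_sol_of_curve[OF \<Omega> s0 U0 U(1,3)])
  have u0w: "u0 \<in> L2w ?\<Omega>"
  proof -
    have "continuous_on UNIV gauss_weight" unfolding gauss_weight_def[abs_def] by (intro continuous_intros) auto
    then have "integrable lborel (\<lambda>x. gauss_weight x * (u0 x)\<^sup>2)"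
      by (intro integrable_compact_support[OF _ u0(2)] continuous_intros u0(1)) (auto simp: u0(4))
    then have "set_integrable lborel ?\<Omega> (\<lambda>x. gauss_weight x * (u0 x)\<^sup>2)"
      unfolding set_integrable_def using \<Omega> by (intro integrable_mult_indicator) auto
    then show ?thesis using square_integrable_measurable[OF s0] by (simp add: L2w_def)
  qed
  have iu0: "integrable lborel u0" by (rule integrable_compact_support[OF u0(1,2,4)])
  define c0 where "c0 = 1 / 4 * (LINT x|lborel. u0 x)"
  have c0: "0 < c0" using integral_pos_of_continuous[OF u0(1) iu0 u0(5,6)] by (simp add: c0_def)
  define M where "M = sqrt ((4 * \<nu>) powr \<nu> * (4 * pi))"
  define L where "L = L2w_norm ?\<Omega> u0"
  define D where "D = 2 powr (1 + \<nu>) * M * C * L"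
  \<comment> \<open>For T \<ge> T0 and |x| < r1 the quotient |x|^2/(8T) is at most 1/(c + 2), c
    being the level, so e^y \<ge> 1 + y keeps \<open>amp\<close> at time 0 above c + 1 on the
    support of u0.\<close>
  define T0 where "T0 = max 1 (r1\<^sup>2 * (?c + 2) / 8)"
  have L: "0 \<le> L"
    unfolding L_def L2w_norm_def set_lebesgue_integral_def
    by (intro real_sqrt_ge_zero integral_nonneg_AE) (simp add: gauss_weight_def)
  have M: "0 \<le> M" using \<nu> by (simp add: M_def)
  have main: "c0 \<le> D * T powr ((1 + \<nu>) / 2 - \<gamma>)" if T: "T0 \<le> T" for T
  proof -
    have T1: "1 \<le> T" "r1\<^sup>2 * (?c + 2) / 8 \<le> T" using T by (auto simp: T0_def)
    then have Tp: "0 < T" by simp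
    note cmp = lower_comparison[OF a \<theta> \<theta>' R flat Tp Uc U(2,3)]
    let ?k = "test_fun \<theta> a R T"
    have "c0 = (LINT x|lborel. 1 / 4 * u0 x)" by (simp add: c0_def)
    also have "\<dots> \<le> (LINT x|lborel. ?k 0 x * u0 x)"
    proof (rule integral_mono)
      show "integrable lborel (\<lambda>x. ?k 0 x * u0 x)" by (rule square_integrable_mult[OF cmp(1) s0])
      fix x
      show "1 / 4 * u0 x \<le> ?k 0 x * u0 x"
      proof (cases "x \<in> K")
        case True
        then have x: "?c + 2 < ?h x" "norm x < r1" using u0(3) by (auto simp: S0_def)
        have "(norm x)\<^sup>2 \<le> r1\<^sup>2" using x by (intro power_mono) auto
        then have "sqn x * (?c + 2) \<le> r1\<^sup>2 * (?c + 2)" using c by (intro mult_right_mono) (auto simp: sqn_norm)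
        also have "\<dots> \<le> 8 * T" using T1 by simp
        finally have "sqn x / (8 * T) * (?c + 2) \<le> 1" using Tp by (simp add: divide_le_eq)
        then have "?c + 1 \<le> (?c + 2) * (1 + - sqn x / (8 * T))" by (simp add: algebra_simps)
        also have "\<dots> \<le> (?c + 2) * exp (- sqn x / (8 * T))" using c by (intro mult_left_mono exp_ge_add_one_self) auto
        also have "\<dots> \<le> ?h x * exp (- sqn x / (8 * T))" using x by (intro mult_right_mono) auto
        also have "\<dots> = amp T (1 / (2 * a)) 0 (?h x) (sqn x)"
          using Tp by (simp add: amp_def powr_minus_divide flip: powr_add)
        finally have "1 / 4 \<le> ?k 0 x" unfolding test_fun_def by (intro psi_ge) simp
        then show ?thesis using u0(5) by (rule mult_right_mono)
      qed (simp add: u0(4))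
    qed (use iu0 in simp)
    also have "\<dots> = inner (cls (?k 0)) (U 0)" by (simp add: U0 inner_cls[OF cmp(1) s0])
    also have "\<dots> \<le> inner (cls (?k T)) (U T)" by (rule cmp(3))
    also have "\<dots> \<le> norm (cls (?k T)) * norm (U T)" by (rule norm_cauchy_schwarz)
    also have "\<dots> \<le> (2 powr (1 + \<nu>) * (M * T powr ((1 + \<nu>) / 2))) * (C * T powr (- \<gamma>) * L)"
    proof (rule mult_mono)
      let ?f = "\<lambda>x. sqn x powr (\<nu> / 2) * exp (- sqn x / (4 * T))"
      note f = norm_gaussian_profile[OF Tp \<nu>]
      have "norm (cls (?k T)) \<le> norm (cls (\<lambda>x. 2 powr (1 + \<nu>) * ?f x))"
      proof (rule norm_cls_mono)
        show "square_integrable (\<lambda>x. 2 powr (1 + \<nu>) * ?f x)" by (rule square_integrable_scale[OF f(1)])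
        show "?k T \<in> borel_measurable lborel" by (rule square_integrable_measurable[OF cmp(2)])
        have "\<bar>?k T x\<bar> \<le> \<bar>2 powr (1 + \<nu>) * ?f x\<bar>" for x
        proof -
        have pn: "norm x powr \<nu> = sqn x powr (\<nu> / 2)"
        proof (cases "x = 0")
          case False
          then show ?thesis by (simp add: sqn_norm powr_powr flip: powr_numeral)
        qed (simp add: sqn_norm)
        have A: "(2 * T) powr (1 + \<nu>) * T powr (- (1 + \<nu>)) = 2 powr (1 + \<nu>)"
          using Tp by (simp only: powr_mult mult.assoc powr_add[symmetric]) simp
        have "amp T \<nu> T (?h x) (sqn x) = 2 powr (1 + \<nu>) * ?h x * exp (- sqn x / (4 * T))"
          unfolding amp_def by (simp only: A[symmetric]) simp
        also have "\<dots> \<le> 2 powr (1 + \<nu>) * norm x powr \<nu> * exp (- sqn x / (4 * T))"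
          using h_bounds[of x] by (intro mult_right_mono mult_left_mono) auto
        finally have "amp T \<nu> T (?h x) (sqn x) \<le> 2 powr (1 + \<nu>) * ?f x" by (simp add: pn)
        moreover have "0 \<le> amp T \<nu> T (?h x) (sqn x)" unfolding amp_def using h_bounds[of x] by simp
        ultimately have "?k T x \<le> 2 powr (1 + \<nu>) * ?f x"
          using psi_le[of "amp T \<nu> T (?h x) (sqn x) - ?c"] c unfolding test_fun_def \<nu>_def[symmetric] by linarith
        then show ?thesis
          using psi_nonneg by (simp add: test_fun_def)
        qed
        then show "AE x in lborel. \<bar>?k T x\<bar> \<le> \<bar>2 powr (1 + \<nu>) * ?f x\<bar>" by simp
      qed
      also have "\<dots> = 2 powr (1 + \<nu>) * norm (cls ?f)" unfolding cls_scale[OF f(1), symmetric] by simp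
      also have "\<dots> \<le> 2 powr (1 + \<nu>) * (M * T powr ((1 + \<nu>) / 2))" using f(2) by (intro mult_left_mono) (auto simp: M_def)
      finally show "norm (cls (?k T)) \<le> 2 powr (1 + \<nu>) * (M * T powr ((1 + \<nu>) / 2))" .
      \<comment> \<open>U T lies in the form domain, hence vanishes outside \<Omega>, so its full
        norm is the \<open>L2_norm\<close> controlled by \<open>decay\<close>.\<close>
      obtain F where "grad.form_op ?\<Omega> (U T) F" using U(3)[OF Tp] by blast
      then obtain g1 g2 where "(U T, g1, g2) \<in> grad_graph ?\<Omega>" unfolding grad.form_op_def by (metis surj_pair)
      then have "clsO ?\<Omega> (rep (U T)) = U T" by (rule grad_graph_supported[OF \<Omega>])
      then have "norm (U T) = L2_norm ?\<Omega> (rep (U T))"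
        by (simp add: L2_norm_eq[OF \<Omega> square_integrable_L2[OF \<Omega> square_integrable_rep]])
      also have "\<dots> \<le> C * (1 + T) powr (- \<gamma>) * L" unfolding L_def by (rule decay[OF u0w sol]) (use Tp in simp)
      also have "\<dots> \<le> C * T powr (- \<gamma>) * L"
      proof (intro mult_right_mono mult_left_mono)
        have "0 < \<gamma>" using \<gamma> a by (smt (verit) divide_pos_pos)
        then show "(1 + T) powr (- \<gamma>) \<le> T powr (- \<gamma>)" using Tp by (intro powr_mono2') auto
      qed (use C L in auto)
      finally show "norm (U T) \<le> C * T powr (- \<gamma>) * L" .
    qed (use M in auto)
    also have "\<dots> = D * (T powr ((1 + \<nu>) / 2) * T powr (- \<gamma>))" by (simp add: D_def)
    also have "T powr ((1 + \<nu>) / 2) * T powr (- \<gamma>) = T powr ((1 + \<nu>) / 2 - \<gamma>)" by (simp flip: powr_add)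
    finally show ?thesis .
  qed
  \<comment> \<open>The assumed rate makes the right-hand side of \<open>main\<close> tend to 0 as T
    grows, while c0 is fixed.\<close>
  have "(1 + \<nu>) / 2 - \<gamma> < 0" using \<gamma> a by (simp add: \<nu>_def field_simps)
  then have "((\<lambda>T. D * T powr ((1 + \<nu>) / 2 - \<gamma>)) \<longlongrightarrow> D * 0) at_top"
    by (intro tendsto_mult tendsto_const tendsto_neg_powr filterlim_ident)
  then have "\<forall>\<^sub>F T in at_top. D * T powr ((1 + \<nu>) / 2 - \<gamma>) < c0"
    by (rule order_tendstoD) (use c0 in simp)
  then have "\<forall>\<^sub>F T in at_top. D * T powr ((1 + \<nu>) / 2 - \<gamma>) < c0 \<and> T0 \<le> T"
    by (intro eventually_conj eventually_ge_at_top)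
  then obtain T where "D * T powr ((1 + \<nu>) / 2 - \<gamma>) < c0" "T0 \<le> T"
    using eventually_happens'[OF trivial_limit_at_top_linorder] by blast
  then show False using main[of T] by linarith
qed

theorem theorem1p1:
  fixes \<theta> \<theta>' :: "real \<Rightarrow> real" and a :: real
  assumes "0 < a" and "a \<le> 1"
    and "\<forall>r>0. (\<theta> has_real_derivative \<theta>' r) (at r)"
    and "continuous_on {0<..} \<theta>'"
    and "\<exists>M. \<forall>r>0. \<bar>r * \<theta>' r\<bar> \<le> M"
    and "\<exists>R>0. \<forall>r\<ge>R. \<theta>' r = 0"
  shows "decay_rate \<theta> a = 1/2 + 1/(4*a)"
proof -
  have \<theta>: "\<And>r. r > 0 \<Longrightarrow> (\<theta> has_real_derivative \<theta>' r) (at r)" using assms(3) by blast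
  obtain R where R: "0 < R" "\<And>r. R \<le> r \<Longrightarrow> \<theta>' r = 0" using assms(6) by blast
  note below = decay_bound_below_threshold[OF assms(1,2) \<theta> assms(4)]
  note above = not_decay_bound_above_threshold[OF assms(1,2) \<theta> assms(4) R]
  show ?thesis
    unfolding decay_rate_def
  \<comment> \<open>All rates below the threshold are admissible and none above, which fixes the
    supremum by density; admissibility of the threshold itself is left undecided.\<close>
  proof (rule cSup_eq)
    show "\<gamma> \<le> 1/2 + 1/(4*a)" if "\<gamma> \<in> {\<gamma>. decay_bound \<theta> a \<gamma>}" for \<gamma>
      using above[of \<gamma>] that by (cases "1/2 + 1/(4*a) < \<gamma>") auto
    show "1/2 + 1/(4*a) \<le> y" if y: "\<And>\<gamma>. \<gamma> \<in> {\<gamma>. decay_bound \<theta> a \<gamma>} \<Longrightarrow> \<gamma> \<le> y" for y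
      by (rule dense_le) (use below y in blast)
  qed
qed

end
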